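(* Let $F\xrightarrow{i}X\xrightarrow{p}Y$ be a pointed fiber sequence of bisimplicial sets. For $m\ge0$, $n\ge0$, there is an induced long exact sequence of pointed sets $$\cdots\to\pi^{\mathrm{BC}}_{m,n}(\Omega F)\xrightarrow{i_*}\pi^{\mathrm{BC}}_{m,n}(\Omega X)\xrightarrow{p_*}\pi^{\mathrm{BC}}_{m,n}(\Omega Y)\xrightarrow{\tau}\pi^{\mathrm{BC}}_{m,n}(F)\xrightarrow{i_*}\pi^{\mathrm{BC}}_{m,n}(X)\xrightarrow{p_*}\pi^{\mathrm{BC}}_{m,n}(Y),$$ continuing to the left with the iterated loop spaces $\Omega^kF,\Omega^kX,\Omega^kY$.
   Context: **Notation.** A bisimplicial set $X$ has face and degeneracy maps $d_i,s_i$ in the first index and $\overline d_j,\overline s_j$ in the second. For simplicial sets $A,B$, $(A\boxtimes B)_{m,n}=A_m\times B_n$. $\Delta^{m,n}=\Delta^m\boxtimes\Delta^n$; elements of $X_{m,n}$ are identified with maps $\Delta^{m,n}\to X$. $d_i\Delta^m$ is the $i$-th face of $\Delta^m$ and $\Lambda^m_k=\bigcup_{i\ne k}d_i\Delta^m$. Subobjects of $\Delta^{m,n}$: $\delta\Delta^{m,n}=\partial\Delta^m\boxtimes\Delta^n\cup\Delta^m\boxtimes\partial\Delta^n$; $\Lambda^{m,n}=\Lambda^m_m\boxtimes\Delta^n\cup\Delta^m\boxtimes\Lambda^n_n$; $\delta_{\mathrm A}\Delta^{m,n}=\Lambda^{m,n}\cup\partial\Delta^m\boxtimes\partial\Delta^n$.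 **Fibrations.** Anodyne extensions are the monomorphisms in the saturated class generated by $\Lambda^m_k\boxtimes\Delta^n\cup\Delta^m\boxtimes\Lambda^n_l\to\Delta^m\boxtimes\Delta^n$ ($m,n\ge1$, $0\le k\le m$, $0\le l\le n$). Fibrations are the maps with the right lifting property against all anodyne extensions; $X$ is fibrant if $X\to\Delta^{0,0}$ is a fibration. A pointed bisimplicial set has a chosen vertex $*$; constant maps to it are also written $*$. A (pointed) fiber sequence $F\xrightarrow{i}X\xrightarrow{p}Y$ consists of a basepoint-preserving fibration $p:(X,* )\to(Y,* )$ with $Y$ fibrant, and its fiber $F=*\times_YX$ over the base point, with inclusion $i$ and base point that of $X$. **Homotopy.** For $h:K\times\Delta^{1,1}\to X$, operators in the $\Delta^{1,1}$-direction carry a hat. $h$ is a homotopy from $\alpha$ to $\beta$ if $\hat d_0h=\hat{\overline s}_0\alpha$, $\hat{\overline d}_0h=\hat s_0\alpha$ (i.e. $\alpha$ composed with the projection to $K$) and $\hat d_1\hat{\overline d}_1h=\beta$. A map $K\to X$ rel $L\subset K$ is one that is $*$ on $L$; a homotopy rel $L$ is one with $h|_{L\times\Delta^{1,1}}=*$. For fibrant $X$ this is an equivalence relation, and $\pi^{\mathrm{BC}}_{m,n}(X)$ is the set of relative homotopy classes of maps $\Delta^{m,n}\to X$ rel $\delta\Delta^{m,n}$, pointed by the class $[*]$ of the constant map. Pointed maps induce maps on $\pi^{\mathrm{BC}}_{m,n}$ by composition. **Loop space.** $\mathbf{Hom}(K,X)_{m,n}=\mathrm{Hom}(K\times\Delta^{m,n},X)$.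 $\Omega X$ is the fiber over the constant map of the restriction $\mathbf{Hom}(\Delta^{1,1},X)\to\mathbf{Hom}(\delta_{\mathrm A}\Delta^{1,1},X)$, pointed by the constant map. $\Omega$ is functorial; the maps $\Omega F\to\Omega X\to\Omega Y$ again form a fiber sequence, which is used to continue the sequence to the left. **The map $\tau$.** A map $\alpha:\Delta^{m,n}\to\Omega Y$ rel $\delta\Delta^{m,n}$ is viewed as a map $\alpha:\Delta^{m,n}\times\Delta^{1,1}\to Y$ that is $*$ on $\delta\Delta^{m,n}\times\Delta^{1,1}\cup\Delta^{m,n}\times\delta_{\mathrm A}\Delta^{1,1}$. Choose a lift $\widetilde\alpha:\Delta^{m,n}\times\Delta^{1,1}\to X$ with $p\widetilde\alpha=\alpha$ and $\widetilde\alpha=*$ on $\delta\Delta^{m,n}\times\Delta^{1,1}\cup\Delta^{m,n}\times\Lambda^{1,1}$. Then $\tau[\alpha]:=[\hat d_1\hat{\overline d}_1\widetilde\alpha]\in\pi^{\mathrm{BC}}_{m,n}(F)$ (well defined). **Exactness** means that the preimage of $[*]$ under each map equals the image of the preceding map. *)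

theory Defs
  imports Main "HOL-Library.FuncSet"
begin

section \<open>Simplicial operators and simplicial sets\<close>

text \<open>
  A monotone map from \<open>{0..k}\<close> to \<open>{0..m}\<close> is represented by the list of its \<open>k + 1\<close> values. These
  lists are at once the operators from \<open>[k]\<close> to \<open>[m]\<close> and the \<open>k\<close>-simplices of the standard
  \<open>m\<close>-simplex.
\<close>

definition ops :: "nat \<Rightarrow> nat \<Rightarrow> nat list set" where
  "ops m k = {a. length a = Suc k \<and> sorted a \<and> set a \<subseteq> {..m}}"

text \<open>\<open>a \<cdot> b\<close> is the composite ``first \<open>b\<close>, then \<open>a\<close>''.\<close>

definition op_comp :: "nat list \<Rightarrow> nat list \<Rightarrow> nat list" (infixl "\<cdot>" 75) where
  "a \<cdot> b = map (\<lambda>i. a ! i) b"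

definition op_id :: "nat \<Rightarrow> nat list" where
  "op_id m = [0..<Suc m]"

definition coface :: "nat \<Rightarrow> nat \<Rightarrow> nat list" where
  "coface m i = map (\<lambda>j. if j < i then j else Suc j) [0..<m]"

definition codegen :: "nat \<Rightarrow> nat \<Rightarrow> nat list" where
  "codegen m i = map (\<lambda>j. if j \<le> i then j else j - 1) [0..<Suc (Suc m)]"

text \<open>\<open>sact A m a\<close> is the map from \<open>m\<close>-simplices to \<open>k\<close>-simplices induced by \<open>a \<in> ops m k\<close>.\<close>

record 'a sset =
  simps :: "nat \<Rightarrow> 'a set"
  sact :: "nat \<Rightarrow> nat list \<Rightarrow> 'a \<Rightarrow> 'a"

definition simplex :: "nat \<Rightarrow> nat list sset" where
  "simplex m = \<lparr> simps = ops m, sact = (\<lambda>k a x. x \<cdot> a) \<rparr>"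

text \<open>The \<open>i\<close>-th face, i.e. the image of the \<open>i\<close>-th coface, consists of the simplices that avoid
  vertex \<open>i\<close>. For \<open>m = 0\<close> it is empty.\<close>

definition face :: "nat \<Rightarrow> nat \<Rightarrow> nat list sset" where
  "face m i = (simplex m)\<lparr> simps := (\<lambda>k. {x \<in> ops m k. i \<notin> set x}) \<rparr>"

definition boundary :: "nat \<Rightarrow> nat list sset" where
  "boundary m = (simplex m)\<lparr> simps := (\<lambda>k. \<Union>i\<in>{..m}. simps (face m i) k) \<rparr>"

definition horn :: "nat \<Rightarrow> nat \<Rightarrow> nat list sset" where
  "horn m j = (simplex m)\<lparr> simps := (\<lambda>k. \<Union>i\<in>{..m} - {j}. simps (face m i) k) \<rparr>"


section \<open>Bisimplicial sets\<close>

text \<open>A bisimplicial set is a contravariant functor of two ordinals; for \<open>a \<in> ops m k\<close> and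
  \<open>b \<in> ops n l\<close>, \<open>act X m n a b\<close> maps \<open>(m, n)\<close>-cells to \<open>(k, l)\<close>-cells. The values of \<open>act\<close> outside
  the cells are irrelevant. Cell sets of different bidegrees may overlap.\<close>

record 'a bisset =
  cells :: "nat \<Rightarrow> nat \<Rightarrow> 'a set"
  act :: "nat \<Rightarrow> nat \<Rightarrow> nat list \<Rightarrow> nat list \<Rightarrow> 'a \<Rightarrow> 'a"

record 'a pbisset = "'a bisset" +
  pt :: 'a

definition bisimplicial :: "('a, 'z) bisset_scheme \<Rightarrow> bool" where
  "bisimplicial X \<longleftrightarrow>
     (\<forall>m n k l. \<forall>a\<in>ops m k. \<forall>b\<in>ops n l. \<forall>x\<in>cells X m n. act X m n a b x \<in> cells X k l) \<and>
     (\<forall>m n. \<forall>x\<in>cells X m n. act X m n (op_id m) (op_id n) x = x) \<and>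
     (\<forall>m n k l k' l'. \<forall>a\<in>ops m k. \<forall>b\<in>ops n l. \<forall>c\<in>ops k k'. \<forall>d\<in>ops l l'. \<forall>x\<in>cells X m n.
        act X k l c d (act X m n a b x) = act X m n (a \<cdot> c) (b \<cdot> d) x)"

definition pointed_bisimplicial :: "'a pbisset \<Rightarrow> bool" where
  "pointed_bisimplicial X \<longleftrightarrow> bisimplicial X \<and> pt X \<in> cells X 0 0"

text \<open>The degenerate \<open>(m, n)\<close>-cell on the base point.\<close>

definition base :: "'a pbisset \<Rightarrow> nat \<Rightarrow> nat \<Rightarrow> 'a" where
  "base X m n = act X 0 0 (replicate (Suc m) 0) (replicate (Suc n) 0) (pt X)"

text \<open>Face and degeneracy operators in the first (horizontal) and second (vertical) index, applied
  to an \<open>(m, n)\<close>-cell.\<close>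

definition hface :: "('a, 'z) bisset_scheme \<Rightarrow> nat \<Rightarrow> nat \<Rightarrow> nat \<Rightarrow> 'a \<Rightarrow> 'a" where
  "hface X m n i = act X m n (coface m i) (op_id n)"

definition vface :: "('a, 'z) bisset_scheme \<Rightarrow> nat \<Rightarrow> nat \<Rightarrow> nat \<Rightarrow> 'a \<Rightarrow> 'a" where
  "vface X m n j = act X m n (op_id m) (coface n j)"

definition hdegen :: "('a, 'z) bisset_scheme \<Rightarrow> nat \<Rightarrow> nat \<Rightarrow> nat \<Rightarrow> 'a \<Rightarrow> 'a" where
  "hdegen X m n i = act X m n (codegen m i) (op_id n)"

definition vdegen :: "('a, 'z) bisset_scheme \<Rightarrow> nat \<Rightarrow> nat \<Rightarrow> nat \<Rightarrow> 'a \<Rightarrow> 'a" where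
  "vdegen X m n j = act X m n (op_id m) (codegen n j)"

definition box :: "'a sset \<Rightarrow> 'b sset \<Rightarrow> ('a \<times> 'b) bisset" (infixr "\<boxtimes>" 85) where
  "A \<boxtimes> B = \<lparr> cells = (\<lambda>m n. simps A m \<times> simps B n),
             act = (\<lambda>m n a b (x, y). (sact A m a x, sact B n b y)) \<rparr>"

text \<open>Union of two subobjects of one bisimplicial set (which share its operators).\<close>

definition bunion :: "'a bisset \<Rightarrow> 'a bisset \<Rightarrow> 'a bisset" (infixl "\<squnion>" 65) where
  "K \<squnion> L = K\<lparr> cells := (\<lambda>m n. cells K m n \<union> cells L m n) \<rparr>"

definition bprod :: "'a bisset \<Rightarrow> 'b bisset \<Rightarrow> ('a \<times> 'b) bisset" (infixr "\<otimes>" 80) where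
  "K \<otimes> L = \<lparr> cells = (\<lambda>m n. cells K m n \<times> cells L m n),
             act = (\<lambda>m n a b (x, y). (act K m n a b x, act L m n a b y)) \<rparr>"

type_synonym std = "nat list \<times> nat list"

definition bisimplex :: "nat \<Rightarrow> nat \<Rightarrow> std bisset" ("\<Delta>") where
  "\<Delta> m n = simplex m \<boxtimes> simplex n"

definition bi_boundary :: "nat \<Rightarrow> nat \<Rightarrow> std bisset" ("\<delta>\<Delta>") where
  "\<delta>\<Delta> m n = (boundary m \<boxtimes> simplex n) \<squnion> (simplex m \<boxtimes> boundary n)"

definition bi_horn :: "nat \<Rightarrow> nat \<Rightarrow> nat \<Rightarrow> nat \<Rightarrow> std bisset" where
  "bi_horn m n k l = (horn m k \<boxtimes> simplex n) \<squnion> (simplex m \<boxtimes> horn n l)"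

definition last_horn :: "nat \<Rightarrow> nat \<Rightarrow> std bisset" ("\<Lambda>") where
  "\<Lambda> m n = bi_horn m n m n"

definition a_boundary :: "nat \<Rightarrow> nat \<Rightarrow> std bisset" ("\<delta>\<^sub>A\<Delta>") where
  "\<delta>\<^sub>A\<Delta> m n = \<Lambda> m n \<squnion> (boundary m \<boxtimes> boundary n)"


section \<open>Maps\<close>

text \<open>Maps are undefined outside the cells of their source, so that equal maps are equal
  functions.\<close>

type_synonym ('a, 'b) bimap = "nat \<Rightarrow> nat \<Rightarrow> 'a \<Rightarrow> 'b"

definition bimaps ::
    "('a, 'y) bisset_scheme \<Rightarrow> ('b, 'z) bisset_scheme \<Rightarrow> ('a, 'b) bimap set" where
  "bimaps X Y = {f.
     (\<forall>m n. f m n \<in> cells X m n \<rightarrow>\<^sub>E cells Y m n) \<and>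
     (\<forall>m n k l. \<forall>a\<in>ops m k. \<forall>b\<in>ops n l. \<forall>x\<in>cells X m n.
        f k l (act X m n a b x) = act Y m n a b (f m n x))}"

text \<open>\<open>bicomp X g f\<close> is the composite ``first \<open>f\<close>, then \<open>g\<close>'' of maps, where \<open>X\<close> is the source
  of \<open>f\<close>.\<close>

definition bicomp ::
    "('a, 'z) bisset_scheme \<Rightarrow> ('b, 'c) bimap \<Rightarrow> ('a, 'b) bimap \<Rightarrow> ('a, 'c) bimap" where
  "bicomp X g f = (\<lambda>m n. compose (cells X m n) (g m n) (f m n))"

text \<open>The inclusion of a subobject; in particular the identity map.\<close>

definition incl :: "('a, 'z) bisset_scheme \<Rightarrow> ('a, 'a) bimap" where
  "incl A = (\<lambda>m n. \<lambda>x\<in>cells A m n. x)"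

definition const_map :: "('a, 'z) bisset_scheme \<Rightarrow> 'b pbisset \<Rightarrow> ('a, 'b) bimap" where
  "const_map K X = (\<lambda>m n. \<lambda>x\<in>cells K m n. base X m n)"

definition const_on :: "('a, 'z) bisset_scheme \<Rightarrow> 'b pbisset \<Rightarrow> ('a, 'b) bimap \<Rightarrow> bool" where
  "const_on L X f \<longleftrightarrow> (\<forall>m n. \<forall>x\<in>cells L m n. f m n x = base X m n)"

definition mono_map :: "('a, 'z) bisset_scheme \<Rightarrow> ('a, 'b) bimap \<Rightarrow> bool" where
  "mono_map X f \<longleftrightarrow> (\<forall>m n. inj_on (f m n) (cells X m n))"

text \<open>Transport of structure along a map \<open>e\<close> that is injective on the whole type.\<close>

definition relabel :: "('a \<Rightarrow> 'b) \<Rightarrow> ('a, 'z) bisset_scheme \<Rightarrow> 'b bisset" where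
  "relabel e X = \<lparr> cells = (\<lambda>m n. e ` cells X m n),
                   act = (\<lambda>m n a b x. e (act X m n a b (inv e x))) \<rparr>"

definition prelabel :: "('a \<Rightarrow> 'b) \<Rightarrow> 'a pbisset \<Rightarrow> 'b pbisset" where
  "prelabel e X = bisset.extend (relabel e X) (pbisset.fields (e (pt X)))"


section \<open>A type of cells closed under the formation of loop spaces\<close>

text \<open>A cell of the loop space of \<open>X\<close> is a family of cells of \<open>X\<close>, indexed by the cells of
  \<open>\<Delta> 1 1 \<otimes> \<Delta> m n\<close>. Since HOL has no type depending on the number of iterations, all iterated
  loop spaces are placed in the following type, which contains the given cells as \<open>Atom\<close>s and
  such families as \<open>Fam\<close>s.\<close>

datatype 'a univ =
    Atom (un_Atom: 'a)
  | Fam (un_Fam: "nat \<Rightarrow> nat \<Rightarrow> std \<times> std \<Rightarrow> 'a univ")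


section \<open>Anodyne extensions and fibrations\<close>

type_synonym 'c arrow = "'c bisset \<times> ('c, 'c) bimap \<times> 'c bisset"

definition arrows :: "'c arrow set" where
  "arrows = {(A, f, B). bisimplicial A \<and> bisimplicial B \<and> f \<in> bimaps A B}"

definition is_iso :: "'c bisset \<Rightarrow> ('c, 'c) bimap \<Rightarrow> 'c bisset \<Rightarrow> bool" where
  "is_iso A f B \<longleftrightarrow> (A, f, B) \<in> arrows \<and>
     (\<exists>g. (B, g, A) \<in> arrows \<and> bicomp A g f = incl A \<and> bicomp B f g = incl B)"

text \<open>The square formed by \<open>f : A \<rightarrow> B\<close>, \<open>g : A \<rightarrow> C\<close>, \<open>h : B \<rightarrow> D\<close>, \<open>k : C \<rightarrow> D\<close> is a pushout.\<close>

definition is_pushout ::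
    "'c bisset \<Rightarrow> ('c, 'c) bimap \<Rightarrow> 'c bisset \<Rightarrow> ('c, 'c) bimap \<Rightarrow> 'c bisset \<Rightarrow>
     ('c, 'c) bimap \<Rightarrow> ('c, 'c) bimap \<Rightarrow> 'c bisset \<Rightarrow> bool" where
  "is_pushout A f B g C h k D \<longleftrightarrow>
     (A, f, B) \<in> arrows \<and> (A, g, C) \<in> arrows \<and> (B, h, D) \<in> arrows \<and> (C, k, D) \<in> arrows \<and>
     bicomp A h f = bicomp A k g \<and>
     (\<forall>E u v. (B, u, E) \<in> arrows \<longrightarrow> (C, v, E) \<in> arrows \<longrightarrow> bicomp A u f = bicomp A v g \<longrightarrow>
        (\<exists>!w. (D, w, E) \<in> arrows \<and> bicomp B w h = u \<and> bicomp C w k = v))"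

text \<open>\<open>f'\<close> is a retract of \<open>f\<close>.\<close>

definition is_retract ::
    "'c bisset \<Rightarrow> ('c, 'c) bimap \<Rightarrow> 'c bisset \<Rightarrow>
     'c bisset \<Rightarrow> ('c, 'c) bimap \<Rightarrow> 'c bisset \<Rightarrow> bool" where
  "is_retract A' f' B' A f B \<longleftrightarrow>
     (A', f', B') \<in> arrows \<and> (A, f, B) \<in> arrows \<and>
     (\<exists>s r s' r'. (A', s, A) \<in> arrows \<and> (A, r, A') \<in> arrows \<and>
        (B', s', B) \<in> arrows \<and> (B, r', B') \<in> arrows \<and>
        bicomp A' r s = incl A' \<and> bicomp B' r' s' = incl B' \<and>
        bicomp A' f s = bicomp A' s' f' \<and> bicomp A f' r = bicomp A r' f)"

text \<open>\<open>L\<close> with the maps \<open>c j\<close> is a colimit of \<open>A 0 \<rightarrow> A 1 \<rightarrow> \<dots>\<close>.\<close>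

definition is_seq_colimit ::
    "(nat \<Rightarrow> 'c bisset) \<Rightarrow> (nat \<Rightarrow> ('c, 'c) bimap) \<Rightarrow>
     (nat \<Rightarrow> ('c, 'c) bimap) \<Rightarrow> 'c bisset \<Rightarrow> bool" where
  "is_seq_colimit A f c L \<longleftrightarrow>
     (\<forall>j. (A j, f j, A (Suc j)) \<in> arrows \<and> (A j, c j, L) \<in> arrows \<and>
          bicomp (A j) (c (Suc j)) (f j) = c j) \<and>
     (\<forall>E u. (\<forall>j. (A j, u j, E) \<in> arrows \<and> bicomp (A j) (u (Suc j)) (f j) = u j) \<longrightarrow>
        (\<exists>!w. (L, w, E) \<in> arrows \<and> (\<forall>j. bicomp (A j) w (c j) = u j)))"

definition is_coproduct ::
    "'i set \<Rightarrow> ('i \<Rightarrow> 'c bisset) \<Rightarrow> ('i \<Rightarrow> ('c, 'c) bimap) \<Rightarrow> 'c bisset \<Rightarrow> bool" where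
  "is_coproduct I A c S \<longleftrightarrow> bisimplicial S \<and>
     (\<forall>i\<in>I. (A i, c i, S) \<in> arrows) \<and>
     (\<forall>E u. bisimplicial E \<longrightarrow> (\<forall>i\<in>I. (A i, u i, E) \<in> arrows) \<longrightarrow>
        (\<exists>!w. (S, w, E) \<in> arrows \<and> (\<forall>i\<in>I. bicomp (A i) w (c i) = u i)))"

text \<open>The saturated class generated by \<open>G\<close>: closure under isomorphisms, pushouts, retracts,
  countable composition and arbitrary direct sums. Direct sums are indexed by sets of elements of
  the type of cells, which loses nothing, as every cell type used below is infinite.\<close>

inductive_set saturation :: "'c arrow set \<Rightarrow> 'c arrow set" for G :: "'c arrow set" where
  generator: "(A, f, B) \<in> G \<Longrightarrow> (A, f, B) \<in> saturation G"
| iso: "is_iso A f B \<Longrightarrow> (A, f, B) \<in> saturation G"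
| pushout: "(A, f, B) \<in> saturation G \<Longrightarrow> is_pushout A f B g C h k D \<Longrightarrow> (C, k, D) \<in> saturation G"
| retract: "(A, f, B) \<in> saturation G \<Longrightarrow> is_retract A' f' B' A f B \<Longrightarrow>
    (A', f', B') \<in> saturation G"
| composition: "(\<And>j. (A j, f j, A (Suc j)) \<in> saturation G) \<Longrightarrow> is_seq_colimit A f c L \<Longrightarrow>
    (A 0, c 0, L) \<in> saturation G"
| direct_sum: "(\<And>i. i \<in> (I :: 'c set) \<Longrightarrow> (A i, f i, B i) \<in> saturation G) \<Longrightarrow>
    is_coproduct I A a S \<Longrightarrow> is_coproduct I B b T \<Longrightarrow> (S, g, T) \<in> arrows \<Longrightarrow>
    (\<And>i. i \<in> I \<Longrightarrow> bicomp (A i) g (a i) = bicomp (A i) (b i) (f i)) \<Longrightarrow>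
    (S, g, T) \<in> saturation G"

text \<open>The inclusions \<open>bi_horn m n k l \<rightarrow> \<Delta> m n\<close>, copied into the type \<open>'c\<close>.\<close>

definition horn_inclusions :: "'c arrow set" where
  "horn_inclusions =
     {(relabel e (bi_horn m n k l), incl (relabel e (bi_horn m n k l)), relabel e (\<Delta> m n))
      | (e :: std \<Rightarrow> 'c) m n k l. inj e \<and> 1 \<le> m \<and> 1 \<le> n \<and> k \<le> m \<and> l \<le> n}"

definition anodyne :: "'c bisset \<Rightarrow> ('c, 'c) bimap \<Rightarrow> 'c bisset \<Rightarrow> bool" where
  "anodyne A j B \<longleftrightarrow> (A, j, B) \<in> saturation horn_inclusions \<and> mono_map A j"

text \<open>Every square from \<open>j : A \<rightarrow> B\<close> to \<open>p : X \<rightarrow> Y\<close> has a diagonal filler.\<close>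

definition has_lifting ::
    "'c bisset \<Rightarrow> ('c, 'c) bimap \<Rightarrow> 'c bisset \<Rightarrow>
     ('a, 'y) bisset_scheme \<Rightarrow> ('a, 'b) bimap \<Rightarrow> ('b, 'z) bisset_scheme \<Rightarrow> bool" where
  "has_lifting A j B X p Y \<longleftrightarrow>
     (\<forall>u\<in>bimaps A X. \<forall>v\<in>bimaps B Y. bicomp A p u = bicomp A v j \<longrightarrow>
        (\<exists>w\<in>bimaps B X. bicomp A w j = u \<and> bicomp B p w = v))"

text \<open>The anodyne extensions tested against have their cells in \<open>'a univ\<close>, which admits copies of
  all the generating inclusions. A map has the right lifting property against a saturated class as
  soon as it has it against the generators, so the size of the test type is immaterial.\<close>

definition fibration ::
    "('a, 'y) bisset_scheme \<Rightarrow> ('a, 'b) bimap \<Rightarrow> ('b, 'z) bisset_scheme \<Rightarrow> bool" where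
  "fibration X p Y \<longleftrightarrow> bisimplicial X \<and> bisimplicial Y \<and> p \<in> bimaps X Y \<and>
     (\<forall>(A :: 'a univ bisset) j (B :: 'a univ bisset). anodyne A j B \<longrightarrow> has_lifting A j B X p Y)"

definition to_point :: "('a, 'z) bisset_scheme \<Rightarrow> ('a, std) bimap" where
  "to_point X = (\<lambda>m n. \<lambda>x\<in>cells X m n. (replicate (Suc m) 0, replicate (Suc n) 0))"

definition fibrant :: "('a, 'z) bisset_scheme \<Rightarrow> bool" where
  "fibrant X \<longleftrightarrow> fibration X (to_point X) (\<Delta> 0 0)"

definition fiber :: "'a pbisset \<Rightarrow> ('a, 'b) bimap \<Rightarrow> 'b pbisset \<Rightarrow> 'a pbisset" where
  "fiber X p Y = X\<lparr> cells := (\<lambda>m n. {x \<in> cells X m n. p m n x = base Y m n}) \<rparr>"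

definition fiber_sequence ::
    "'a pbisset \<Rightarrow> ('a, 'a) bimap \<Rightarrow> 'a pbisset \<Rightarrow> ('a, 'b) bimap \<Rightarrow> 'b pbisset \<Rightarrow> bool" where
  "fiber_sequence F i X p Y \<longleftrightarrow>
     pointed_bisimplicial X \<and> pointed_bisimplicial Y \<and>
     fibration X p Y \<and> p 0 0 (pt X) = pt Y \<and> fibrant Y \<and>
     F = fiber X p Y \<and> i = incl F"


section \<open>Function complexes and homotopy\<close>

text \<open>The operators of \<open>Hom K X\<close> act through the standard-bisimplex factor of \<open>K \<otimes> \<Delta> m n\<close>; they
  are the operators that carry a hat. The base point is the constant map.\<close>

definition Hom :: "'k bisset \<Rightarrow> 'a pbisset \<Rightarrow> ('k \<times> std, 'a) bimap pbisset" where
  "Hom K X = \<lparr> cells = (\<lambda>m n. bimaps (K \<otimes> \<Delta> m n) X),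
     act = (\<lambda>m n a b f k l.
       \<lambda>(x, (c, d)) \<in> cells (K \<otimes> \<Delta> (length a - 1) (length b - 1)) k l. f k l (x, (a \<cdot> c, b \<cdot> d))),
     pt = const_map (K \<otimes> \<Delta> 0 0) X \<rparr>"

text \<open>A map \<open>K \<rightarrow> X\<close> regarded as a vertex of \<open>Hom K X\<close>.\<close>

definition vertex :: "'k bisset \<Rightarrow> ('k, 'a) bimap \<Rightarrow> ('k \<times> std, 'a) bimap" where
  "vertex K \<alpha> = (\<lambda>k l. \<lambda>z\<in>cells (K \<otimes> \<Delta> 0 0) k l. \<alpha> k l (fst z))"

text \<open>The corner of a map \<open>K \<otimes> \<Delta> 1 1 \<rightarrow> X\<close> obtained from the first faces in both directions.\<close>

definition corner ::
    "'k bisset \<Rightarrow> 'a pbisset \<Rightarrow> ('k \<times> std, 'a) bimap \<Rightarrow> ('k \<times> std, 'a) bimap" where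
  "corner K X h = hface (Hom K X) 1 0 1 (vface (Hom K X) 1 1 1 h)"

definition is_homotopy ::
    "'k bisset \<Rightarrow> 'a pbisset \<Rightarrow> ('k \<times> std, 'a) bimap \<Rightarrow>
     ('k, 'a) bimap \<Rightarrow> ('k, 'a) bimap \<Rightarrow> bool" where
  "is_homotopy K X h \<alpha> \<beta> \<longleftrightarrow>
     h \<in> bimaps (K \<otimes> \<Delta> 1 1) X \<and>
     hface (Hom K X) 1 1 0 h = vdegen (Hom K X) 0 0 0 (vertex K \<alpha>) \<and>
     vface (Hom K X) 1 1 0 h = hdegen (Hom K X) 0 0 0 (vertex K \<alpha>) \<and>
     corner K X h = vertex K \<beta>"

definition rel_maps :: "'k bisset \<Rightarrow> 'k bisset \<Rightarrow> 'a pbisset \<Rightarrow> ('k, 'a) bimap set" where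
  "rel_maps K L X = {\<alpha> \<in> bimaps K X. const_on L X \<alpha>}"

definition homotopy_rel ::
    "'k bisset \<Rightarrow> 'k bisset \<Rightarrow> 'a pbisset \<Rightarrow> (('k, 'a) bimap \<times> ('k, 'a) bimap) set" where
  "homotopy_rel K L X = {(\<alpha>, \<beta>). \<alpha> \<in> rel_maps K L X \<and> \<beta> \<in> rel_maps K L X \<and>
     (\<exists>h. is_homotopy K X h \<alpha> \<beta> \<and> const_on (L \<otimes> \<Delta> 1 1) X h)}"

text \<open>Pointed sets are pairs of a carrier and an element.\<close>

type_synonym 'a pset = "'a set \<times> 'a"

definition pi_class :: "nat \<Rightarrow> nat \<Rightarrow> 'a pbisset \<Rightarrow> (std, 'a) bimap \<Rightarrow> (std, 'a) bimap set" where
  "pi_class m n X \<alpha> = homotopy_rel (\<Delta> m n) (\<delta>\<Delta> m n) X `` {\<alpha>}"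

definition pi_BC :: "nat \<Rightarrow> nat \<Rightarrow> 'a pbisset \<Rightarrow> (std, 'a) bimap set pset" where
  "pi_BC m n X =
     (rel_maps (\<Delta> m n) (\<delta>\<Delta> m n) X // homotopy_rel (\<Delta> m n) (\<delta>\<Delta> m n) X,
      pi_class m n X (const_map (\<Delta> m n) X))"

text \<open>The map induced by \<open>f : X \<rightarrow> Y\<close>; the definite description is meaningful because composition
  with \<open>f\<close> is well defined on classes.\<close>

definition pi_map ::
    "nat \<Rightarrow> nat \<Rightarrow> 'b pbisset \<Rightarrow> ('a, 'b) bimap \<Rightarrow>
     (std, 'a) bimap set \<Rightarrow> (std, 'b) bimap set" where
  "pi_map m n Y f c = (THE d. \<exists>\<alpha>\<in>c. d = pi_class m n Y (bicomp (\<Delta> m n) f \<alpha>))"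


section \<open>Loop spaces\<close>

text \<open>The restriction \<open>Hom K X \<rightarrow> Hom L X\<close> along a subobject \<open>L\<close> of \<open>K\<close>.\<close>

definition restriction ::
    "'k bisset \<Rightarrow> 'k bisset \<Rightarrow> 'a pbisset \<Rightarrow>
     (('k \<times> std, 'a) bimap, ('k \<times> std, 'a) bimap) bimap" where
  "restriction K L X = (\<lambda>m n. \<lambda>f\<in>cells (Hom K X) m n. bicomp (L \<otimes> \<Delta> m n) f (incl (L \<otimes> \<Delta> m n)))"

definition loop :: "'a univ pbisset \<Rightarrow> 'a univ pbisset" where
  "loop X = prelabel Fam
     (fiber (Hom (\<Delta> 1 1) X) (restriction (\<Delta> 1 1) (\<delta>\<^sub>A\<Delta> 1 1) X) (Hom (\<delta>\<^sub>A\<Delta> 1 1) X))"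

definition loop_map ::
    "'a univ pbisset \<Rightarrow> ('a univ, 'b univ) bimap \<Rightarrow> ('a univ, 'b univ) bimap" where
  "loop_map X f = (\<lambda>m n. \<lambda>z\<in>cells (loop X) m n. Fam (bicomp (\<Delta> 1 1 \<otimes> \<Delta> m n) f (un_Fam z)))"

text \<open>The iterated loop spaces of \<open>X\<close> and of maps with source \<open>X\<close>. The zeroth one is \<open>X\<close> itself,
  copied into \<open>'a univ\<close>.\<close>

primrec loops :: "nat \<Rightarrow> 'a pbisset \<Rightarrow> 'a univ pbisset" where
  "loops 0 X = prelabel Atom X"
| "loops (Suc k) X = loop (loops k X)"

primrec loops_map :: "nat \<Rightarrow> 'a pbisset \<Rightarrow> ('a, 'b) bimap \<Rightarrow> ('a univ, 'b univ) bimap" where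
  "loops_map 0 X f = (\<lambda>m n. \<lambda>z\<in>Atom ` cells X m n. Atom (f m n (un_Atom z)))"
| "loops_map (Suc k) X f = loop_map (loops k X) (loops_map k X f)"


section \<open>The connecting map\<close>

text \<open>A map \<open>K \<rightarrow> loop Y\<close> viewed as a map \<open>K \<otimes> \<Delta> 1 1 \<rightarrow> Y\<close>.\<close>

definition adjunct ::
    "'k bisset \<Rightarrow> ('k, 'a univ) bimap \<Rightarrow> ('k \<times> std, 'a univ) bimap" where
  "adjunct K \<alpha> = (\<lambda>k l. \<lambda>(u, v) \<in> cells (K \<otimes> \<Delta> 1 1) k l.
     un_Fam (\<alpha> k l u) k l (v, (op_id k, op_id l)))"

text \<open>\<open>\<alpha>'\<close> is an admissible lift of \<open>\<alpha> : \<Delta> m n \<rightarrow> loop Y\<close> along \<open>p : X \<rightarrow> Y\<close>.\<close>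

definition tau_lift ::
    "nat \<Rightarrow> nat \<Rightarrow> 'a univ pbisset \<Rightarrow> ('a univ, 'b univ) bimap \<Rightarrow>
     (std, 'b univ) bimap \<Rightarrow> (std \<times> std, 'a univ) bimap \<Rightarrow> bool" where
  "tau_lift m n X p \<alpha> \<alpha>' \<longleftrightarrow>
     \<alpha>' \<in> bimaps (\<Delta> m n \<otimes> \<Delta> 1 1) X \<and>
     bicomp (\<Delta> m n \<otimes> \<Delta> 1 1) p \<alpha>' = adjunct (\<Delta> m n) \<alpha> \<and>
     const_on ((\<delta>\<Delta> m n \<otimes> \<Delta> 1 1) \<squnion> (\<Delta> m n \<otimes> \<Lambda> 1 1)) X \<alpha>'"

text \<open>As for \<open>pi_map\<close>, the description is meaningful because the class of \<open>\<gamma>\<close> depends neither on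
  the representative nor on the lift.\<close>

definition tau ::
    "nat \<Rightarrow> nat \<Rightarrow> 'a univ pbisset \<Rightarrow> 'a univ pbisset \<Rightarrow> ('a univ, 'b univ) bimap \<Rightarrow>
     (std, 'b univ) bimap set \<Rightarrow> (std, 'a univ) bimap set" where
  "tau m n F X p c = (THE d. \<exists>\<alpha>\<in>c. \<exists>\<alpha>' \<gamma>. tau_lift m n X p \<alpha> \<alpha>' \<and>
     \<gamma> \<in> rel_maps (\<Delta> m n) (\<delta>\<Delta> m n) F \<and>
     corner (\<Delta> m n) X \<alpha>' = vertex (\<Delta> m n) \<gamma> \<and>
     d = pi_class m n F \<gamma>)"


section \<open>Exact sequences of pointed sets\<close>

definition pointed_map :: "'a pset \<Rightarrow> ('a \<Rightarrow> 'b) \<Rightarrow> 'b pset \<Rightarrow> bool" where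
  "pointed_map A f B \<longleftrightarrow> f ` fst A \<subseteq> fst B \<and> f (snd A) = snd B"

definition exact_at :: "'a pset \<Rightarrow> ('a \<Rightarrow> 'b) \<Rightarrow> 'b pset \<Rightarrow> ('b \<Rightarrow> 'c) \<Rightarrow> 'c pset \<Rightarrow> bool" where
  "exact_at A f B g C \<longleftrightarrow> {b \<in> fst B. g b = snd C} = f ` fst A"

text \<open>The sequence
  \<open>\<dots> \<rightarrow> A (k+1) \<rightarrow> B (k+1) \<rightarrow> C (k+1) \<rightarrow> A k \<rightarrow> B k \<rightarrow> C k \<rightarrow> \<dots> \<rightarrow> A 0 \<rightarrow> B 0 \<rightarrow> C 0\<close>
  with maps \<open>f k : A k \<rightarrow> B k\<close>, \<open>g k : B k \<rightarrow> C k\<close>, \<open>t k : C (k+1) \<rightarrow> A k\<close> is an exact sequence of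
  pointed sets (nothing is required at its right end \<open>C 0\<close>).\<close>

definition long_exact_sequence ::
    "(nat \<Rightarrow> 'a pset) \<Rightarrow> (nat \<Rightarrow> 'a \<Rightarrow> 'b) \<Rightarrow> (nat \<Rightarrow> 'b pset) \<Rightarrow> (nat \<Rightarrow> 'b \<Rightarrow> 'c) \<Rightarrow>
     (nat \<Rightarrow> 'c pset) \<Rightarrow> (nat \<Rightarrow> 'c \<Rightarrow> 'a) \<Rightarrow> bool" where
  "long_exact_sequence A f B g C t \<longleftrightarrow> (\<forall>k.
     snd (A k) \<in> fst (A k) \<and> snd (B k) \<in> fst (B k) \<and> snd (C k) \<in> fst (C k) \<and>
     pointed_map (A k) (f k) (B k) \<and>
     pointed_map (B k) (g k) (C k) \<and>
     pointed_map (C (Suc k)) (t k) (A k) \<and>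
     exact_at (A k) (f k) (B k) (g k) (C k) \<and>
     exact_at (C (Suc k)) (t k) (A k) (f k) (B k) \<and>
     exact_at (B (Suc k)) (g (Suc k)) (C (Suc k)) (t k) (A k))"

end

theory Submission
  imports Defs "HOL-Library.Countable"
begin

text \<open>
  Fibrations enter only through lifting against the pushout product of \<open>\<delta>\<Delta> m n \<subseteq> \<Delta> m n\<close> with
  \<open>\<Lambda> 1 1 \<subseteq> \<Delta> 1 1\<close>. It is the exterior product of two inclusions of simplicial sets, each saying how to
  fill a prism from its top and its sides; filling both prisms one shuffle at a time turns it into a
  finite composite of pushouts of bihorns. Attaching the cells of \<open>K\<close> outside \<open>L\<close> one after the other
  gives lifting against the pushout product of any \<open>L \<subseteq> K\<close> with \<open>\<Lambda> 1 1 \<subseteq> \<Delta> 1 1\<close>. Taking a pushout product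
  with \<open>\<delta>\<^sub>A\<Delta> 1 1 \<subseteq> \<Delta> 1 1\<close> as the inclusion \<open>L \<subseteq> K\<close>, one sees by adjunction that the property passes to loop
  spaces, so it suffices to treat the right end of the sequence. There every claim is one lifting
  problem: against \<open>\<Lambda> 1 1\<close> for the existence of \<open>\<tau>\<close> and exactness at \<open>X\<close>, and against the pushout
  product of \<open>\<Lambda> 1 1\<close> and \<open>\<delta>\<^sub>A\<Delta> 1 1\<close> for homotopy being an equivalence relation, for \<open>\<tau>\<close> being well
  defined, and for exactness at the loop space of \<open>Y\<close>.
\<close>

subsection \<open>Simplicial operators and bisimplicial sets\<close>

text \<open>The notion carried through the loop spaces is \<open>kan_fib\<close> and not
  \<open>fibration\<close>: the latter quantifies over a saturated class in a test type, and passing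
  it to \<open>loop\<close> would need an argument about that whole class, while
  \<open>prism_fib\<close> concerns explicit inclusions and can be transposed directly. The hook
  \<open>\<Lambda> 1 1\<close> is the right horn because a homotopy, like a lift used for \<tau>, is
  prescribed on the hook and read off at the opposite vertex \<open>origin\<close>. That vertex is
  all that \<open>\<delta>\<^sub>A\<Delta> 1 1\<close> adds to the hook, and it is disjoint from it;
  data over \<open>\<delta>\<^sub>A\<Delta> 1 1\<close> are therefore two maps, one over the hook
  and one over \<open>origin\<close>, with no direct condition between them. In each use of
  \<open>lift_square\<close> one square carries the horn to be filled, the other is a loop or
  homotopy parameter, and the result is the filler at the \<open>origin\<close> of the former.
  Fibers and loops commute by an equality of records, not merely up to isomorphism, so the exactness
  statements for one Kan fibration apply verbatim at every level.\<close>

lemma ops_iff: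
  "a \<in> ops m k \<longleftrightarrow> length a = Suc k \<and> (\<forall>i j. i \<le> j \<longrightarrow> j \<le> k \<longrightarrow> a ! i \<le> a ! j) \<and> (\<forall>i\<le>k. a ! i \<le> m)"
  unfolding ops_def sorted_iff_nth_mono subset_iff in_set_conv_nth atMost_iff mem_Collect_eq
  by (metis less_Suc_eq_le)

lemma nth_op_comp: "i < length c \<Longrightarrow> (a \<cdot> c) ! i = a ! (c ! i)"
  by (simp add: op_comp_def)

lemma length_op_comp [simp]: "length (a \<cdot> c) = length c"
  by (simp add: op_comp_def)

lemma op_comp_ops: "a \<in> ops m k \<Longrightarrow> c \<in> ops k l \<Longrightarrow> a \<cdot> c \<in> ops m l"
  by (simp add: ops_iff nth_op_comp)

lemma op_comp_assoc:
  "b \<in> ops m k \<Longrightarrow> c \<in> ops k l \<Longrightarrow> (a \<cdot> b) \<cdot> c = a \<cdot> (b \<cdot> c)"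
  unfolding ops_def op_comp_def by (auto simp: subset_iff)

lemma op_id_left: "c \<in> ops m k \<Longrightarrow> op_id m \<cdot> c = c"
  unfolding ops_def op_comp_def op_id_def
  by (auto intro!: map_idI simp: subset_iff nth_append simp del: upt_Suc)

lemma op_id_right: "length a = Suc k \<Longrightarrow> a \<cdot> op_id k = a"
  unfolding op_comp_def op_id_def by (metis map_nth)

lemma op_id_ops [simp]: "op_id m \<in> ops m m"
  unfolding ops_def op_id_def by (auto simp del: upt_Suc)

lemma ops_length: "a \<in> ops m k \<Longrightarrow> length a = Suc k"
  unfolding ops_def by simp

lemma coface_ops: "0 < m \<Longrightarrow> coface m i \<in> ops m (m - 1)"
  unfolding ops_def coface_def by (auto simp: sorted_iff_nth_mono)

lemma codegen_0_0: "codegen 0 0 = [0, 0]"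
  unfolding codegen_def by simp

lemma coface_1: "coface 1 0 = [1]" "coface 1 1 = [0]" "coface (Suc 0) 0 = [1]"
  "coface (Suc 0) (Suc 0) = [0]"
  unfolding coface_def by simp_all

lemma replicate_ops: "i \<le> m \<Longrightarrow> replicate (Suc k) i \<in> ops m k"
  unfolding ops_def by auto

lemma replicate_op_comp:
  "c \<in> ops k l \<Longrightarrow> replicate (Suc k) i \<cdot> c = replicate (Suc l) i"
  by (rule nth_equalityI) (auto simp: ops_iff nth_op_comp less_Suc_eq_le simp del: replicate_Suc)

lemma ops_0: "c \<in> ops 0 k \<longleftrightarrow> c = replicate (Suc k) 0"
  by (auto simp: ops_iff less_Suc_eq_le simp del: replicate_Suc intro!: nth_equalityI)

lemma set_op_comp: "a \<in> ops m k \<Longrightarrow> c \<in> ops k l \<Longrightarrow> set (a \<cdot> c) \<subseteq> set a"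
  unfolding ops_def op_comp_def by (auto simp: subset_iff less_Suc_eq_le)

lemma cells_Delta: "cells (\<Delta> m n) k l = ops m k \<times> ops n l"
  by (simp add: bisimplex_def box_def simplex_def)

lemma act_Delta: "act (\<Delta> m n) k l a b z = (fst z \<cdot> a, snd z \<cdot> b)"
  by (simp add: bisimplex_def box_def simplex_def case_prod_unfold)

lemma cells_bprod: "cells (K \<otimes> J) k l = cells K k l \<times> cells J k l"
  by (simp add: bprod_def)

lemma act_bprod: "act (K \<otimes> J) k l a b z = (act K k l a b (fst z), act J k l a b (snd z))"
  by (simp add: bprod_def case_prod_unfold)

lemma bisimplicialD:
  assumes "bisimplicial X"
  shows "a \<in> ops m k \<Longrightarrow> b \<in> ops n l \<Longrightarrow> x \<in> cells X m n \<Longrightarrow> act X m n a b x \<in> cells X k l"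
    and "x \<in> cells X m n \<Longrightarrow> act X m n (op_id m) (op_id n) x = x"
    and "a \<in> ops m k \<Longrightarrow> b \<in> ops n l \<Longrightarrow> c \<in> ops k k' \<Longrightarrow> d \<in> ops l l' \<Longrightarrow> x \<in> cells X m n \<Longrightarrow>
      act X k l c d (act X m n a b x) = act X m n (a \<cdot> c) (b \<cdot> d) x"
  using assms unfolding bisimplicial_def by meson+

lemma bisimplicial_Delta: "bisimplicial (\<Delta> m n)"
  unfolding bisimplicial_def
  by (auto simp: cells_Delta act_Delta op_comp_ops op_id_right op_comp_assoc ops_length)

lemma bisimplicial_bprod: "bisimplicial K \<Longrightarrow> bisimplicial J \<Longrightarrow> bisimplicial (K \<otimes> J)"
  unfolding bisimplicial_def by (auto simp: cells_bprod act_bprod)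

lemma base_in_cells: "pointed_bisimplicial X \<Longrightarrow> base X m n \<in> cells X m n"
  unfolding base_def pointed_bisimplicial_def
  by (rule bisimplicialD(1)) (auto intro: replicate_ops simp del: replicate_Suc)

lemma act_base:
  assumes "pointed_bisimplicial X" "a \<in> ops m k" "b \<in> ops n l"
  shows "act X m n a b (base X m n) = base X k l"
proof -
  have "act X m n a b (base X m n)
      = act X 0 0 (replicate (Suc m) 0 \<cdot> a) (replicate (Suc n) 0 \<cdot> b) (pt X)"
    unfolding base_def using assms
    by (intro bisimplicialD(3)) (auto simp: pointed_bisimplicial_def intro: replicate_ops simp del: replicate_Suc)
  then show ?thesis
    using assms by (simp add: base_def replicate_op_comp del: replicate_Suc)
qed

subsection \<open>Maps on subobjects and lifting\<close>

text \<open>A subobject is encoded by its cell sets alone, with the operators of the ambient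
  \<open>D\<close>. Unions, preimages and filtration stages are then plain set expressions.\<close>

definition closed_in :: "('c, 'z) bisset_scheme \<Rightarrow> (nat \<Rightarrow> nat \<Rightarrow> 'c set) \<Rightarrow> bool" where
  "closed_in D S \<longleftrightarrow> (\<forall>m n. S m n \<subseteq> cells D m n) \<and>
     (\<forall>m n k l. \<forall>a\<in>ops m k. \<forall>b\<in>ops n l. \<forall>x\<in>S m n. act D m n a b x \<in> S k l)"

text \<open>Values off \<open>S\<close> are left free, in contrast with \<open>bimaps\<close>:
  restricting a map changes nothing and a composite is a plain lambda term.
  \<open>restrict_bimaps\<close> restores the extensional form where it is wanted.\<close>

definition hom_on ::
    "('c, 'w) bisset_scheme \<Rightarrow> (nat \<Rightarrow> nat \<Rightarrow> 'c set) \<Rightarrow> ('a, 'z) bisset_scheme \<Rightarrow> ('c, 'a) bimap \<Rightarrow> bool" where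
  "hom_on D S X f \<longleftrightarrow> (\<forall>m n. \<forall>x\<in>S m n. f m n x \<in> cells X m n) \<and>
     (\<forall>m n k l. \<forall>a\<in>ops m k. \<forall>b\<in>ops n l. \<forall>x\<in>S m n.
        f k l (act D m n a b x) = act X m n a b (f m n x))"

definition lifts ::
    "('c, 'w) bisset_scheme \<Rightarrow> (nat \<Rightarrow> nat \<Rightarrow> 'c set) \<Rightarrow> (nat \<Rightarrow> nat \<Rightarrow> 'c set) \<Rightarrow>
     ('a, 'y) bisset_scheme \<Rightarrow> ('a, 'b) bimap \<Rightarrow> ('b, 'z) bisset_scheme \<Rightarrow> bool" where
  "lifts D S T X p Y \<longleftrightarrow> (\<forall>u v. hom_on D S X u \<longrightarrow> hom_on D T Y v \<longrightarrow>
     (\<forall>m n. \<forall>x\<in>S m n. p m n (u m n x) = v m n x) \<longrightarrow>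
     (\<exists>w. hom_on D T X w \<and> (\<forall>m n. \<forall>x\<in>S m n. w m n x = u m n x) \<and>
        (\<forall>m n. \<forall>x\<in>T m n. p m n (w m n x) = v m n x)))"

abbreviation bihom :: "('c, 'w) bisset_scheme \<Rightarrow> ('a, 'z) bisset_scheme \<Rightarrow> ('c, 'a) bimap \<Rightarrow> bool" where
  "bihom D X f \<equiv> hom_on D (cells D) X f"

lemma hom_onD:
  assumes "hom_on D S X f"
  shows "x \<in> S m n \<Longrightarrow> f m n x \<in> cells X m n"
    and "a \<in> ops m k \<Longrightarrow> b \<in> ops n l \<Longrightarrow> x \<in> S m n \<Longrightarrow>
      f k l (act D m n a b x) = act X m n a b (f m n x)"
  using assms unfolding hom_on_def by blast+

lemma hom_onI:
  assumes "\<And>m n x. x \<in> S m n \<Longrightarrow> f m n x \<in> cells X m n"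
    and "\<And>m n k l a b x. a \<in> ops m k \<Longrightarrow> b \<in> ops n l \<Longrightarrow> x \<in> S m n \<Longrightarrow>
      f k l (act D m n a b x) = act X m n a b (f m n x)"
  shows "hom_on D S X f"
  using assms unfolding hom_on_def by blast

lemma closed_inD:
  assumes "closed_in D S"
  shows "x \<in> S m n \<Longrightarrow> x \<in> cells D m n"
    and "a \<in> ops m k \<Longrightarrow> b \<in> ops n l \<Longrightarrow> x \<in> S m n \<Longrightarrow> act D m n a b x \<in> S k l"
  using assms unfolding closed_in_def by blast+

lemma closed_inI:
  assumes "\<And>m n x. x \<in> S m n \<Longrightarrow> x \<in> cells D m n"
    and "\<And>m n k l a b x. a \<in> ops m k \<Longrightarrow> b \<in> ops n l \<Longrightarrow> x \<in> S m n \<Longrightarrow> act D m n a b x \<in> S k l"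
  shows "closed_in D S"
  using assms unfolding closed_in_def by blast

lemma closed_in_cells: "bisimplicial D \<Longrightarrow> closed_in D (cells D)"
  by (auto intro!: closed_inI bisimplicialD(1))

lemma hom_on_subset:
  "hom_on D T X f \<Longrightarrow> (\<And>m n. S m n \<subseteq> T m n) \<Longrightarrow> hom_on D S X f"
  unfolding hom_on_def by blast

lemma hom_on_cong:
  assumes "closed_in D S" "\<And>m n x. x \<in> S m n \<Longrightarrow> f m n x = g m n x" "hom_on D S X f"
  shows "hom_on D S X g"
  using assms unfolding hom_on_def closed_in_def by metis

lemma hom_on_comp:
  assumes "hom_on D S B f" "hom_on B T X g" "\<And>m n x. x \<in> S m n \<Longrightarrow> f m n x \<in> T m n"
  shows "hom_on D S X (\<lambda>m n x. g m n (f m n x))"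
  using assms by (auto intro!: hom_onI simp: hom_onD)

lemma liftsD:
  assumes "lifts D S T X p Y" "hom_on D S X u" "hom_on D T Y v"
    "\<And>m n x. x \<in> S m n \<Longrightarrow> p m n (u m n x) = v m n x"
  obtains w where "hom_on D T X w" "\<And>m n x. x \<in> S m n \<Longrightarrow> w m n x = u m n x"
    "\<And>m n x. x \<in> T m n \<Longrightarrow> p m n (w m n x) = v m n x"
proof -
  have "\<exists>w. hom_on D T X w \<and> (\<forall>m n. \<forall>x\<in>S m n. w m n x = u m n x) \<and>
        (\<forall>m n. \<forall>x\<in>T m n. p m n (w m n x) = v m n x)"
    using assms unfolding lifts_def by blast
  then show thesis using that by blast
qed

lemma liftsI:
  assumes "\<And>u v. hom_on D S X u \<Longrightarrow> hom_on D T Y v \<Longrightarrow>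
     (\<And>m n x. x \<in> S m n \<Longrightarrow> p m n (u m n x) = v m n x) \<Longrightarrow>
     \<exists>w. hom_on D T X w \<and> (\<forall>m n. \<forall>x\<in>S m n. w m n x = u m n x) \<and>
        (\<forall>m n. \<forall>x\<in>T m n. p m n (w m n x) = v m n x)"
  shows "lifts D S T X p Y"
  using assms unfolding lifts_def by blast

lemma lifts_refl: "lifts D S S X p Y"
  unfolding lifts_def by blast

lemma lifts_trans:
  assumes ST: "lifts D S T X p Y" and TU: "lifts D T U X p Y"
    and sub: "\<And>m n. S m n \<subseteq> T m n" "\<And>m n. T m n \<subseteq> U m n"
  shows "lifts D S U X p Y"
proof (rule liftsI)
  fix u v
  assume u: "hom_on D S X u" and v: "hom_on D U Y v"
    and uv: "\<And>m n x. x \<in> S m n \<Longrightarrow> p m n (u m n x) = v m n x"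
  obtain w where w: "hom_on D T X w" "\<And>m n x. x \<in> S m n \<Longrightarrow> w m n x = u m n x"
    "\<And>m n x. x \<in> T m n \<Longrightarrow> p m n (w m n x) = v m n x"
    using liftsD[OF ST u hom_on_subset[OF v sub(2)] uv] by blast
  obtain w' where "hom_on D U X w'" "\<And>m n x. x \<in> T m n \<Longrightarrow> w' m n x = w m n x"
    "\<And>m n x. x \<in> U m n \<Longrightarrow> p m n (w' m n x) = v m n x"
    using liftsD[OF TU w(1) v w(3)] by blast
  then show "\<exists>w. hom_on D U X w \<and> (\<forall>m n. \<forall>x\<in>S m n. w m n x = u m n x) \<and>
        (\<forall>m n. \<forall>x\<in>U m n. p m n (w m n x) = v m n x)"
    using w(2) sub by (intro exI[of _ w']) (auto simp: subset_iff)
qed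

lemma lifts_chain:
  assumes "\<And>i. i < N \<Longrightarrow> lifts D (S i) (S (Suc i)) X p Y"
    and "\<And>i m n. S i m n \<subseteq> S (Suc i) m n"
  shows "i \<le> N \<Longrightarrow> lifts D (S 0) (S i) X p Y"
proof (induction i)
  case (Suc i)
  then show ?case
    using lifts_trans[of D "S 0" "S i" X p Y "S (Suc i)"] assms
      lift_Suc_mono_le[of "\<lambda>i. S i _ _" 0 i] by auto
qed (rule lifts_refl)

text \<open>Successive lifts can be chosen to extend each other, and each bidegree is exhausted at
  the finite stage \<open>N m n\<close>, where the value of the limit can be read off.\<close>

lemma lifts_union:
  assumes step: "\<And>i. lifts D (S i) (S (Suc i)) X p Y"
    and sub: "\<And>i m n. S i m n \<subseteq> S (Suc i) m n"
    and cl: "\<And>i. closed_in D (S i)"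
    and bound: "\<And>m n. T m n = S (N m n) m n"
    and T: "\<And>i m n. S i m n \<subseteq> T m n"
  shows "lifts D (S 0) T X p Y"
proof (rule liftsI)
  fix u v
  assume u: "hom_on D (S 0) X u" and v: "hom_on D T Y v"
    and uv: "\<And>m n x. x \<in> S 0 m n \<Longrightarrow> p m n (u m n x) = v m n x"
  define P where "P i w \<longleftrightarrow> hom_on D (S i) X w \<and> (\<forall>m n. \<forall>x\<in>S 0 m n. w m n x = u m n x) \<and>
    (\<forall>m n. \<forall>x\<in>S i m n. p m n (w m n x) = v m n x)" for i w
  have mono: "i \<le> j \<Longrightarrow> S i m n \<subseteq> S j m n" for i j m n
    using lift_Suc_mono_le[of "\<lambda>i. S i m n"] sub by blast
  \<comment> \<open>Dependent choice, because every lift has to extend the one chosen before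
    it.\<close>
  have "\<exists>f. \<forall>i. P i (f i) \<and> (\<forall>m n. \<forall>x\<in>S i m n. f (Suc i) m n x = f i m n x)"
  proof (rule dependent_nat_choice)
    show "\<exists>w. P 0 w" using u uv unfolding P_def by (intro exI[of _ u]) auto
  next
    fix w i assume w: "P i w"
    have w1: "hom_on D (S i) X w" and w2: "\<And>m n x. x \<in> S i m n \<Longrightarrow> p m n (w m n x) = v m n x"
      using w unfolding P_def by auto
    obtain w' where "hom_on D (S (Suc i)) X w'" "\<And>m n x. x \<in> S i m n \<Longrightarrow> w' m n x = w m n x"
      "\<And>m n x. x \<in> S (Suc i) m n \<Longrightarrow> p m n (w' m n x) = v m n x"
      using liftsD[OF step w1 hom_on_subset[OF v T] w2] by blast
    then show "\<exists>w'. P (Suc i) w' \<and> (\<forall>m n. \<forall>x\<in>S i m n. w' m n x = w m n x)"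
      using w mono[of 0 i] unfolding P_def by (intro exI[of _ w']) (auto simp: subset_iff)
  qed
  then obtain f where f: "\<And>i. P i (f i)"
    "\<And>i m n x. x \<in> S i m n \<Longrightarrow> f (Suc i) m n x = f i m n x" by blast
  have coh: "f (i + d) m n x = f i m n x" if "x \<in> S i m n" for i d m n x
  proof (induction d)
    case (Suc d)
    then show ?case using f(2)[of x "i + d" m n] mono[of i "i + d" m n] that by auto
  qed simp
  define w where "w m n x = f (N m n) m n x" for m n x
  have w: "w m n x = f i m n x" if "x \<in> S i m n" for i m n x
    using coh[of x i m n "N m n - i"] coh[of x "N m n" m n "i - N m n"] that T[of i m n]
    unfolding w_def bound by (cases "i \<le> N m n") auto
  have "hom_on D T X w"
  proof (rule hom_onI)
    fix m n x assume "x \<in> T m n"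
    then show "w m n x \<in> cells X m n"
      using f(1) unfolding w_def bound P_def hom_on_def by blast
  next
    fix m n k l a b x assume ab: "a \<in> ops m k" "b \<in> ops n l" and x: "x \<in> T m n"
    let ?i = "N m n"
    \<comment> \<open>Source and image have different bidegrees. Both are evaluated at the stage of
      the source, which is closed under the operators.\<close>
    have x': "x \<in> S ?i m n" using x bound by simp
    have "act D m n a b x \<in> S ?i k l" using closed_inD(2)[OF cl ab x'] .
    then show "w k l (act D m n a b x) = act X m n a b (w m n x)"
      using w[OF x'] w[of "act D m n a b x" ?i k l] f(1)[of ?i] ab x'
      unfolding P_def by (metis hom_onD(2))
  qed
  moreover have "\<forall>m n. \<forall>x\<in>S 0 m n. w m n x = u m n x"
    using w[of _ 0] f(1)[of 0] unfolding P_def by auto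
  moreover have "\<forall>m n. \<forall>x\<in>T m n. p m n (w m n x) = v m n x"
    using f(1) unfolding w_def bound P_def by blast
  ultimately show "\<exists>w. hom_on D T X w \<and> (\<forall>m n. \<forall>x\<in>S 0 m n. w m n x = u m n x) \<and>
        (\<forall>m n. \<forall>x\<in>T m n. p m n (w m n x) = v m n x)" by blast
qed

text \<open>Attaching all the \<open>D i\<close> to \<open>S\<close> along the maps
  \<open>\<sigma> i\<close> is a pushout: by \<open>inj\<close> each new cell has a unique label,
  and the part of \<open>D i\<close> where values are already prescribed is the preimage of
  \<open>S\<close>. Lifts found separately on the \<open>D i\<close> therefore glue.\<close>

lemma lifts_attach:
  fixes \<sigma> :: "'i \<Rightarrow> ('d, 'c) bimap"
  assumes cl: "closed_in B S"
    and \<sigma>: "\<And>i. i \<in> I \<Longrightarrow> bihom (D i) B (\<sigma> i)"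
    and D: "\<And>i. i \<in> I \<Longrightarrow> bisimplicial (D i)"
    and T: "\<And>m n. T m n = S m n \<union> (\<Union>i\<in>I. \<sigma> i m n ` cells (D i) m n)"
    and inj: "\<And>i j m n x y. i \<in> I \<Longrightarrow> j \<in> I \<Longrightarrow> x \<in> cells (D i) m n \<Longrightarrow> y \<in> cells (D j) m n \<Longrightarrow>
      \<sigma> i m n x = \<sigma> j m n y \<Longrightarrow> \<sigma> i m n x \<notin> S m n \<Longrightarrow> i = j \<and> x = y"
    and lift: "\<And>i. i \<in> I \<Longrightarrow>
      lifts (D i) (\<lambda>m n. {x \<in> cells (D i) m n. \<sigma> i m n x \<in> S m n}) (cells (D i)) X p Y"
  shows "lifts B S T X p Y"
proof (rule liftsI)
  fix u v
  assume u: "hom_on B S X u" and v: "hom_on B T Y v"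
    and uv: "\<And>m n x. x \<in> S m n \<Longrightarrow> p m n (u m n x) = v m n x"
  define R where "R i m n = {x \<in> cells (D i) m n. \<sigma> i m n x \<in> S m n}" for i m n
  have "\<exists>W. bihom (D i) X W \<and> (\<forall>m n. \<forall>x\<in>R i m n. W m n x = u m n (\<sigma> i m n x)) \<and>
     (\<forall>m n. \<forall>x\<in>cells (D i) m n. p m n (W m n x) = v m n (\<sigma> i m n x))" if i: "i \<in> I" for i
  proof -
    have 1: "hom_on (D i) (R i) X (\<lambda>m n x. u m n (\<sigma> i m n x))"
      by (rule hom_on_comp[OF hom_on_subset[OF \<sigma>[OF i]] u]) (auto simp: R_def)
    have 2: "bihom (D i) Y (\<lambda>m n x. v m n (\<sigma> i m n x))"
      using i by (intro hom_on_comp[OF \<sigma>[OF i] v]) (auto simp: T)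
    have "p m n (u m n (\<sigma> i m n x)) = v m n (\<sigma> i m n x)" if "x \<in> R i m n" for m n x
      using that uv by (simp add: R_def)
    from liftsD[OF lift[OF i, folded R_def] 1 2 this] show ?thesis by metis
  qed
  then obtain W where W: "\<And>i. i \<in> I \<Longrightarrow> bihom (D i) X (W i)"
    "\<And>i m n x. i \<in> I \<Longrightarrow> x \<in> R i m n \<Longrightarrow> W i m n x = u m n (\<sigma> i m n x)"
    "\<And>i m n x. i \<in> I \<Longrightarrow> x \<in> cells (D i) m n \<Longrightarrow> p m n (W i m n x) = v m n (\<sigma> i m n x)"
    by metis
  \<comment> \<open>The description is consulted only off \<open>S\<close>, where \<open>inj\<close>
    makes it unique. On \<open>S\<close> the given map takes precedence; the chosen
    \<open>W i\<close> agrees with it on \<open>R i\<close>.\<close>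
  define w where "w m n x = (if x \<in> S m n then u m n x else
    (THE z. \<exists>i y. i \<in> I \<and> y \<in> cells (D i) m n \<and> x = \<sigma> i m n y \<and> z = W i m n y))" for m n x
  have wS: "w m n x = u m n x" if "x \<in> S m n" for m n x
    using that by (simp add: w_def)
  have w\<sigma>: "w m n (\<sigma> i m n y) = W i m n y" if i: "i \<in> I" and y: "y \<in> cells (D i) m n" for i m n y
  proof (cases "\<sigma> i m n y \<in> S m n")
    case True
    then show ?thesis using W(2)[OF i] y wS by (simp add: R_def)
  next
    case False
    have "(THE z. \<exists>j y'. j \<in> I \<and> y' \<in> cells (D j) m n \<and> \<sigma> i m n y = \<sigma> j m n y' \<and> z = W j m n y') = W i m n y"
    proof (rule the_equality)
      show "\<exists>j y'. j \<in> I \<and> y' \<in> cells (D j) m n \<and> \<sigma> i m n y = \<sigma> j m n y' \<and> W i m n y = W j m n y'"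
        using i y by blast
    next
      fix z assume "\<exists>j y'. j \<in> I \<and> y' \<in> cells (D j) m n \<and> \<sigma> i m n y = \<sigma> j m n y' \<and> z = W j m n y'"
      then show "z = W i m n y" using inj[OF i _ y] False by blast
    qed
    then show ?thesis using False by (simp add: w_def)
  qed
  have "hom_on B T X w"
  proof (rule hom_onI)
    fix m n x assume "x \<in> T m n"
    then show "w m n x \<in> cells X m n"
      using wS w\<sigma> hom_onD(1)[OF u] hom_onD(1)[OF W(1)] by (auto simp: T)
  next
    fix m n k l a b x assume ab: "a \<in> ops m k" "b \<in> ops n l" and x: "x \<in> T m n"
    show "w k l (act B m n a b x) = act X m n a b (w m n x)"
    proof (cases "x \<in> S m n")
      case True
      then show ?thesis using wS closed_inD(2)[OF cl ab True] hom_onD(2)[OF u ab True] by simp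
    next
      case False
      then obtain i y where i: "i \<in> I" and y: "y \<in> cells (D i) m n" and xy: "x = \<sigma> i m n y"
        using x by (auto simp: T)
      have "act B m n a b x = \<sigma> i k l (act (D i) m n a b y)"
        using hom_onD(2)[OF \<sigma>[OF i] ab y] xy by simp
      then show ?thesis
        using w\<sigma>[OF i] y xy hom_onD(2)[OF W(1)[OF i] ab y] bisimplicialD(1)[OF D[OF i] ab y] by simp
    qed
  qed
  moreover have "p m n (w m n x) = v m n x" if "x \<in> T m n" for m n x
    using that uv wS w\<sigma> W(3) by (auto simp: T)
  ultimately show "\<exists>w. hom_on B T X w \<and> (\<forall>m n. \<forall>x\<in>S m n. w m n x = u m n x) \<and>
        (\<forall>m n. \<forall>x\<in>T m n. p m n (w m n x) = v m n x)"
    using wS by blast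
qed

section \<open>Boundaries, horns and pushout products\<close>

lemma bi_boundary_cells:
  "cells (\<delta>\<Delta> m n) k l =
     {(a, b) \<in> ops m k \<times> ops n l. \<not> {..m} \<subseteq> set a \<or> \<not> {..n} \<subseteq> set b}"
  unfolding bi_boundary_def bunion_def box_def boundary_def face_def simplex_def by auto

text \<open>A simplex lies on a face iff it misses the opposite vertex, so membership in a union of
  faces is the failure to hit all the corresponding vertices. In this form it can be tested on
  images under operators.\<close>

lemma bi_horn_cells:
  "cells (bi_horn m n i j) k l =
     {(a, b) \<in> ops m k \<times> ops n l. \<not> {..m} - {i} \<subseteq> set a \<or> \<not> {..n} - {j} \<subseteq> set b}"
  unfolding bi_horn_def bunion_def box_def horn_def face_def simplex_def by auto

lemma last_horn_cells:
  "cells (\<Lambda> 1 1) k l = {(a, b) \<in> ops 1 k \<times> ops 1 l. 0 \<notin> set a \<or> 0 \<notin> set b}"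
  unfolding last_horn_def bi_horn_cells by (auto simp: le_Suc_eq)

lemma act_bi_horn: "act (bi_horn m n i j) = act (\<Delta> m n)"
  unfolding bi_horn_def bunion_def box_def horn_def face_def simplex_def bisimplex_def by simp

text \<open>The union of \<open>L \<otimes> J\<close> and \<open>K \<otimes> C\<close>, that is, the
  source of the pushout product of the inclusions of \<open>L\<close> in \<open>K\<close> and of
  \<open>C\<close> in \<open>J\<close>.\<close>

definition pushout_prod ::
    "(nat \<Rightarrow> nat \<Rightarrow> 'k set) \<Rightarrow> 'k bisset \<Rightarrow> (nat \<Rightarrow> nat \<Rightarrow> 'j set) \<Rightarrow> 'j bisset \<Rightarrow>
     nat \<Rightarrow> nat \<Rightarrow> ('k \<times> 'j) set" where
  "pushout_prod L K C J = (\<lambda>k l. {(x, y) \<in> cells (K \<otimes> J) k l. x \<in> L k l \<or> y \<in> C k l})"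

abbreviation square :: "std bisset" where
  "square \<equiv> \<Delta> 1 1"

abbreviation hook :: "nat \<Rightarrow> nat \<Rightarrow> std set" where
  "hook \<equiv> cells (\<Lambda> 1 1)"

abbreviation hook_pt :: "nat \<Rightarrow> nat \<Rightarrow> std set" where
  "hook_pt \<equiv> cells (\<delta>\<^sub>A\<Delta> 1 1)"

definition prism_fib :: "('a, 'y) bisset_scheme \<Rightarrow> ('a, 'b) bimap \<Rightarrow> ('b, 'z) bisset_scheme \<Rightarrow> bool" where
  "prism_fib X p Y \<longleftrightarrow> (\<forall>m n. lifts (\<Delta> m n \<otimes> square)
     (pushout_prod (cells (\<delta>\<Delta> m n)) (\<Delta> m n) hook square)
     (cells (\<Delta> m n \<otimes> square)) X p Y)"

text \<open>The successors encode the conditions \<open>1 \<le> m\<close> and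
  \<open>1 \<le> n\<close> on the generating inclusions.\<close>

definition horn_fib :: "('a, 'y) bisset_scheme \<Rightarrow> ('a, 'b) bimap \<Rightarrow> ('b, 'z) bisset_scheme \<Rightarrow> bool" where
  "horn_fib X p Y \<longleftrightarrow> (\<forall>m n i j. i \<le> Suc m \<longrightarrow> j \<le> Suc n \<longrightarrow>
     lifts (\<Delta> (Suc m) (Suc n)) (cells (bi_horn (Suc m) (Suc n) i j)) (cells (\<Delta> (Suc m) (Suc n))) X p Y)"

subsection \<open>The prism decomposition\<close>

text \<open>The shuffles of \<open>\<Delta>\<^sup>m \<times> \<Delta>\<^sup>1\<close> are \<open>(codegen m i, thresh m i)\<close> for \<open>i \<le> m\<close>. The cell \<open>(a, e)\<close> lies on the
  \<open>i\<close>-th one iff \<open>below i a e\<close>, and \<open>prism m i a e\<close> says that it lies on the sides, on the end \<open>1\<close>, or on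
  one of the first \<open>i\<close> shuffles. The \<open>i\<close>-th shuffle meets the previous stage in its \<open>(i + 1)\<close>-st horn.\<close>

definition below :: "nat \<Rightarrow> nat list \<Rightarrow> nat list \<Rightarrow> bool" where
  "below i a e \<longleftrightarrow> (\<forall>t<length a. (e ! t = 0 \<longrightarrow> a ! t \<le> i) \<and> (e ! t = 1 \<longrightarrow> i \<le> a ! t))"

definition prism :: "nat \<Rightarrow> nat \<Rightarrow> nat list \<Rightarrow> nat list \<Rightarrow> bool" where
  "prism m i a e \<longleftrightarrow> \<not> {..m} \<subseteq> set a \<or> 0 \<notin> set e \<or> (\<exists>j<i. below j a e)"

definition thresh :: "nat \<Rightarrow> nat \<Rightarrow> nat list" where
  "thresh m i = map (\<lambda>j. if j \<le> i then 0 else 1) [0..<Suc (Suc m)]"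

lemma nth_codegen: "t \<le> Suc m \<Longrightarrow> codegen m i ! t = (if t \<le> i then t else t - 1)"
  unfolding codegen_def by (simp add: nth_append del: upt_Suc)

lemma nth_thresh: "t \<le> Suc m \<Longrightarrow> thresh m i ! t = (if t \<le> i then 0 else 1)"
  unfolding thresh_def by (simp add: nth_append del: upt_Suc)

lemma codegen_ops: "i \<le> m \<Longrightarrow> codegen m i \<in> ops m (Suc m)"
  by (auto simp: ops_iff nth_codegen) (simp add: codegen_def)

lemma thresh_ops: "thresh m i \<in> ops 1 (Suc m)"
  by (auto simp: ops_iff nth_thresh) (simp add: thresh_def)

lemma in_set_ops: "a \<in> ops m k \<Longrightarrow> s \<in> set a \<longleftrightarrow> (\<exists>t\<le>k. a ! t = s)"
  by (auto simp: in_set_conv_nth ops_iff less_Suc_eq_le)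

lemma prism_coords:
  assumes "z \<in> ops (Suc m) k" "t \<le> k"
  shows "(codegen m i \<cdot> z) ! t = (if z ! t \<le> i then z ! t else z ! t - 1)"
    and "(thresh m i \<cdot> z) ! t = (if z ! t \<le> i then 0 else 1)"
  using assms by (auto simp: ops_iff nth_op_comp nth_codegen nth_thresh)

text \<open>The values of \<open>codegen m i\<close> and \<open>thresh m i\<close> at a vertex add
  up to that vertex, so the two coordinates determine \<open>z\<close>.\<close>

lemma prism_inj:
  assumes z: "z \<in> ops (Suc m) k" and z': "z' \<in> ops (Suc m) k"
    and eq: "codegen m i \<cdot> z = codegen m i \<cdot> z'" "thresh m i \<cdot> z = thresh m i \<cdot> z'"
  shows "z = z'"
proof (rule nth_equalityI)
  show "length z = length z'" using z z' by (simp add: ops_iff)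
  fix t assume "t < length z"
  then have t: "t \<le> k" using z by (simp add: ops_iff)
  have "(codegen m i \<cdot> z) ! t = (codegen m i \<cdot> z') ! t"
    "(thresh m i \<cdot> z) ! t = (thresh m i \<cdot> z') ! t" using eq by simp_all
  then show "z ! t = z' ! t"
    unfolding prism_coords[OF z t] prism_coords[OF z' t]
    by presburger
qed

lemma below_image:
  assumes "z \<in> ops (Suc m) k"
  shows "below i (codegen m i \<cdot> z) (thresh m i \<cdot> z)"
  unfolding below_def
proof (intro allI impI)
  fix t assume "t < length (codegen m i \<cdot> z)"
  then have t: "t \<le> k" using assms by (simp add: ops_iff)
  show "((thresh m i \<cdot> z) ! t = 0 \<longrightarrow> (codegen m i \<cdot> z) ! t \<le> i) \<and>
      ((thresh m i \<cdot> z) ! t = 1 \<longrightarrow> i \<le> (codegen m i \<cdot> z) ! t)"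
    unfolding prism_coords[OF assms t] by auto
qed

lemma below_preimage:
  assumes a: "a \<in> ops m k" and e: "e \<in> ops 1 k" and b: "below i a e"
  obtains z where "z \<in> ops (Suc m) k" "a = codegen m i \<cdot> z" "e = thresh m i \<cdot> z"
proof -
  \<comment> \<open>The only candidate, since the two coordinates of a cell of the
    \<open>i\<close>-th shuffle add up to the cell.\<close>
  define z where "z = map (\<lambda>t. a ! t + e ! t) [0..<Suc k]"
  have nz: "z ! t = a ! t + e ! t" if "t \<le> k" for t
    using that by (simp add: z_def nth_append del: upt_Suc)
  have e1: "e ! t \<le> 1" if "t \<le> k" for t using that e by (simp add: ops_iff)
  have bt: "e ! t = 0 \<and> a ! t \<le> i \<or> e ! t = 1 \<and> i \<le> a ! t" if "t \<le> k" for t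
    using b e1[OF that] that a unfolding below_def by (force simp: ops_iff)
  have z: "z \<in> ops (Suc m) k"
    unfolding ops_iff
  proof (intro conjI allI impI)
    fix s t :: nat assume "s \<le> t" "t \<le> k"
    then have "a ! s \<le> a ! t" "e ! s \<le> e ! t" using a e by (auto simp: ops_iff)
    then show "z ! s \<le> z ! t" using \<open>s \<le> t\<close> \<open>t \<le> k\<close> by (simp add: nz)
  next
    fix t :: nat assume t: "t \<le> k"
    then have "a ! t \<le> m" using a by (simp add: ops_iff)
    then show "z ! t \<le> Suc m" using nz[OF t] e1[OF t] by simp
  qed (simp add: z_def)
  show thesis
  proof (rule that[OF z]; rule nth_equalityI)
    fix t assume "t < length a"
    then have t: "t \<le> k" using a by (simp add: ops_iff)
    show "a ! t = (codegen m i \<cdot> z) ! t"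
      unfolding prism_coords[OF z t] nz[OF t] using bt[OF t] by auto
  next
    fix t assume "t < length e"
    then have t: "t \<le> k" using e by (simp add: ops_iff)
    show "e ! t = (thresh m i \<cdot> z) ! t"
      unfolding prism_coords[OF z t] nz[OF t] using bt[OF t] by auto
  qed (use a e z in \<open>simp_all add: ops_iff\<close>)
qed

text \<open>Each face of the \<open>i\<close>-th shuffle lies on the sides, on the end
  \<open>1\<close> or on the preceding shuffle, except the one opposite to \<open>Suc i\<close>.
  That face leads to the next shuffle, or to the free end \<open>0\<close> if
  \<open>i = m\<close>.\<close>

lemma prism_horn:
  assumes z: "z \<in> ops (Suc m) k" and i: "i \<le> m"
  shows "prism m i (codegen m i \<cdot> z) (thresh m i \<cdot> z) \<longleftrightarrow> \<not> {..Suc m} - {Suc i} \<subseteq> set z"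
    (is "prism m i ?a ?e \<longleftrightarrow> _")
proof
  note co = prism_coords[OF z]
  have a: "?a \<in> ops m k" and e: "?e \<in> ops 1 k"
    using op_comp_ops[OF codegen_ops[OF i] z] op_comp_ops[OF thresh_ops z] by auto
  assume pr: "prism m i ?a ?e"
  show "\<not> {..Suc m} - {Suc i} \<subseteq> set z"
  proof
    assume sub: "{..Suc m} - {Suc i} \<subseteq> set z"
    have hit: "\<exists>t\<le>k. z ! t = s" if "s \<le> Suc m" "s \<noteq> Suc i" for s
      using sub that in_set_ops[OF z, of s] by auto
    \<comment> \<open>At this position the cell has first coordinate \<open>i\<close> and lies over
      the end \<open>0\<close>, which excludes all shuffles before the \<open>i\<close>-th.\<close>
    obtain t where t: "t \<le> k" "z ! t = i" using hit[of i] i by auto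
    have "s \<in> set ?a" if sm: "s \<le> m" for s
    proof (cases "s \<le> i")
      case True
      then obtain t where "t \<le> k" "z ! t = s" using hit[of s] i by auto
      then have "?a ! t = s" "t \<le> k" using co(1)[of t] True by auto
      then show ?thesis using in_set_ops[OF a] by blast
    next
      case False
      then obtain t where "t \<le> k" "z ! t = Suc s" using hit[of "Suc s"] sm by auto
      then have "?a ! t = s" "t \<le> k" using co(1)[of t] False by auto
      then show ?thesis using in_set_ops[OF a] by blast
    qed
    moreover have "?e ! t = 0" using co(2)[of t] t by simp
    then have "0 \<in> set ?e" using in_set_ops[OF e] t(1) by blast
    moreover have "\<not> below j ?a ?e" if "j < i" for j
    proof
      assume "below j ?a ?e"
      then have "?a ! t \<le> j" using \<open>?e ! t = 0\<close> t(1) a unfolding below_def by (simp add: ops_iff)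
      then show False using co(1)[of t] t that by simp
    qed
    ultimately show False using pr unfolding prism_def by auto
  qed
next
  note co = prism_coords[OF z]
  have a: "?a \<in> ops m k" and e: "?e \<in> ops 1 k"
    using op_comp_ops[OF codegen_ops[OF i] z] op_comp_ops[OF thresh_ops z] by auto
  assume "\<not> {..Suc m} - {Suc i} \<subseteq> set z"
  then obtain s where s: "s \<le> Suc m" "s \<noteq> Suc i" "s \<notin> set z" by auto
  have miss: "z ! t \<noteq> s" if "t \<le> k" for t
    using s(3) that in_set_ops[OF z] by blast
  \<comment> \<open>A missed vertex below \<open>i\<close> or above \<open>Suc i\<close> leaves a
    gap at \<open>s\<close> or \<open>s - 1\<close> in the first coordinate. If \<open>i\<close>
    itself is missed, the cell lies on shuffle \<open>i - 1\<close>, or on the end \<open>1\<close>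
    when \<open>i = 0\<close>.\<close>
  consider "s < i" | "s = i" "i = 0" | "s = i" "0 < i" | "Suc i < s" using s(2) by linarith
  then show "prism m i ?a ?e"
  proof cases
    case 1
    have "?a ! t \<noteq> s" if "t \<le> k" for t
      using co(1)[OF that] miss[OF that] 1 by (auto split: if_splits)
    then have "s \<notin> set ?a" using in_set_ops[OF a] by blast
    moreover have "s \<in> {..m}" using 1 i by simp
    ultimately show ?thesis unfolding prism_def by blast
  next
    case 2
    have "?e ! t \<noteq> 0" if "t \<le> k" for t
      using co(2)[OF that] miss[OF that] 2 by (auto split: if_splits)
    then have "0 \<notin> set ?e" using in_set_ops[OF e] by blast
    then show ?thesis unfolding prism_def by auto
  next
    case 3
    have "below (i - 1) ?a ?e" unfolding below_def
    proof (intro allI impI)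
      fix t assume "t < length ?a"
      then have t: "t \<le> k" using a by (simp add: ops_iff)
      show "(?e ! t = 0 \<longrightarrow> ?a ! t \<le> i - 1) \<and> (?e ! t = 1 \<longrightarrow> i - 1 \<le> ?a ! t)"
        unfolding co[OF t] using miss[OF t] 3 by auto
    qed
    then show ?thesis using 3 unfolding prism_def by (metis diff_less zero_less_one)
  next
    case 4
    have "?a ! t \<noteq> s - 1" if "t \<le> k" for t
      using co(1)[OF that] miss[OF that] 4 by (auto split: if_splits)
    then have "s - 1 \<notin> set ?a" using in_set_ops[OF a] by blast
    moreover have "s - 1 \<in> {..m}" using 4 s(1) by auto
    ultimately show ?thesis unfolding prism_def by blast
  qed
qed

text \<open>The index of a shuffle through a given cell is its first coordinate at the last position
  over the end \<open>0\<close>. If there is no such position, the cell lies on the end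
  \<open>1\<close>.\<close>

lemma prism_full:
  assumes a: "a \<in> ops m k" and e: "e \<in> ops 1 k"
  shows "prism m (Suc m) a e"
proof (cases "0 \<in> set e")
  case True
  define T where "T = {t. t \<le> k \<and> e ! t = 0}"
  have "T \<noteq> {}" using True in_set_ops[OF e, of 0] unfolding T_def by blast
  moreover have "finite T" unfolding T_def by simp
  ultimately have M: "Max T \<in> T" "\<And>t. t \<in> T \<Longrightarrow> t \<le> Max T" by auto
  have "below (a ! Max T) a e" unfolding below_def
  proof (intro allI impI conjI)
    fix t assume t: "t < length a" "e ! t = 0"
    then have "t \<in> T" using a unfolding T_def by (auto simp: ops_iff)
    then show "a ! t \<le> a ! Max T" using M a unfolding T_def by (auto simp: ops_iff)
  next
    fix t assume t: "t < length a" "e ! t = 1"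
    then have tk: "t \<le> k" using a by (simp add: ops_iff)
    have "Max T \<le> t"
    proof (rule ccontr)
      assume "\<not> Max T \<le> t"
      moreover have "Max T \<le> k" "e ! Max T = 0" using M(1) unfolding T_def by auto
      ultimately have "e ! t \<le> 0" using e unfolding ops_iff by (metis nle_le)
      then show False using t by simp
    qed
    then show "a ! Max T \<le> a ! t" using a tk by (simp add: ops_iff)
  qed
  moreover have "a ! Max T < Suc m" using M(1) a unfolding T_def ops_iff by (simp add: less_Suc_eq_le T_def)
  ultimately show ?thesis unfolding prism_def by blast
qed (simp add: prism_def)

lemma below_op_comp:
  assumes "below i a e" "a \<in> ops m k" "e \<in> ops 1 k" "c \<in> ops k l"
  shows "below i (a \<cdot> c) (e \<cdot> c)"
  using assms unfolding below_def by (auto simp: ops_iff nth_op_comp less_Suc_eq_le)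

lemma prism_op_comp:
  assumes "prism m i a e" "a \<in> ops m k" "e \<in> ops 1 k" "c \<in> ops k l"
  shows "prism m i (a \<cdot> c) (e \<cdot> c)"
  using assms set_op_comp[of a m k c l] set_op_comp[of e 1 k c l] below_op_comp[of _ a e m k c l]
  unfolding prism_def by blast

lemma prism_Suc: "prism m (Suc i) a e \<longleftrightarrow> prism m i a e \<or> below i a e"
  unfolding prism_def using less_Suc_eq by auto

lemma prism_SucI: "prism m i a e \<Longrightarrow> prism m (Suc i) a e"
  by (simp add: prism_Suc)

text \<open>A lexicographic filtration of the exterior product of the two prism filtrations: the
  rows before \<open>i\<close> are complete, and in row \<open>i\<close> the pairs of shuffles with
  second index below \<open>j\<close> have been attached.\<close>

definition prism_stage ::
    "nat \<Rightarrow> nat \<Rightarrow> nat \<Rightarrow> nat \<Rightarrow> nat \<Rightarrow> nat \<Rightarrow> (std \<times> std) set" where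
  "prism_stage m n i j k l = {((a, b), (e, f)) \<in> cells (\<Delta> m n \<otimes> square) k l.
     prism m i a e \<or> prism n 0 b f \<or> prism m (Suc i) a e \<and> prism n j b f}"

lemma closed_prism_stage: "closed_in (\<Delta> m n \<otimes> square) (prism_stage m n i j)"
proof (rule closed_inI)
  fix M N k l c d x
  assume "c \<in> ops M k" "d \<in> ops N l" "x \<in> prism_stage m n i j M N"
  then show "act (\<Delta> m n \<otimes> square) M N c d x \<in> prism_stage m n i j k l"
    unfolding prism_stage_def
    by (auto simp: cells_bprod act_bprod cells_Delta act_Delta op_comp_ops dest: prism_op_comp)
qed (auto simp: prism_stage_def)

lemma horn_fibD:
  "horn_fib X p Y \<Longrightarrow> i \<le> Suc m \<Longrightarrow> j \<le> Suc n \<Longrightarrow>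
   lifts (\<Delta> (Suc m) (Suc n)) (cells (bi_horn (Suc m) (Suc n) i j)) (cells (\<Delta> (Suc m) (Suc n))) X p Y"
  unfolding horn_fib_def by blast

text \<open>The step attaches a single cell of bidegree \<open>(Suc m, Suc n)\<close>, the product
  of the \<open>i\<close>-th and the \<open>j\<close>-th shuffle, along a bihorn; hence the index
  type \<open>unit\<close>.\<close>

lemma prism_stage_step:
  assumes horn: "horn_fib X p Y" and i: "i \<le> m" and j: "j \<le> n"
  shows "lifts (\<Delta> m n \<otimes> square) (prism_stage m n i j) (prism_stage m n i (Suc j)) X p Y"
proof -
  define \<sigma> :: "unit \<Rightarrow> (std, std \<times> std) bimap" where
    "\<sigma> = (\<lambda>_ k l zw. ((codegen m i \<cdot> fst zw, codegen n j \<cdot> snd zw),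
        (thresh m i \<cdot> fst zw, thresh n j \<cdot> snd zw)))"
  let ?B = "\<Delta> m n \<otimes> square" and ?D = "\<Delta> (Suc m) (Suc n)"
  have im: "\<sigma> u k l zw \<in> cells ?B k l" if "zw \<in> cells ?D k l" for u k l zw
    using that i j unfolding \<sigma>_def
    by (auto simp: cells_bprod cells_Delta intro: op_comp_ops codegen_ops thresh_ops thresh_ops[simplified])
  \<comment> \<open>On the \<open>i\<close>-th shuffle \<open>prism m (Suc i)\<close> always holds,
    so the three disjuncts of the stage reduce to \<open>prism m i\<close> or
    \<open>prism n j\<close>: one horn condition in each direction.\<close>
  have pre: "{x \<in> cells ?D k l. \<sigma> u k l x \<in> prism_stage m n i j k l}
      = cells (bi_horn (Suc m) (Suc n) (Suc i) (Suc j)) k l" for u k l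
  proof -
    have "\<sigma> u k l (z, w) \<in> prism_stage m n i j k l \<longleftrightarrow>
        \<not> {..Suc m} - {Suc i} \<subseteq> set z \<or> \<not> {..Suc n} - {Suc j} \<subseteq> set w"
      if z: "z \<in> ops (Suc m) k" and w: "w \<in> ops (Suc n) l" for z w
    proof -
      have "prism m (Suc i) (codegen m i \<cdot> z) (thresh m i \<cdot> z)"
        using below_image[OF z, of i] by (simp add: prism_Suc)
      moreover have "prism n 0 (codegen n j \<cdot> w) (thresh n j \<cdot> w) \<Longrightarrow>
          prism n j (codegen n j \<cdot> w) (thresh n j \<cdot> w)" unfolding prism_def by blast
      ultimately have "\<sigma> u k l (z, w) \<in> prism_stage m n i j k l \<longleftrightarrow>
          prism m i (codegen m i \<cdot> z) (thresh m i \<cdot> z) \<or> prism n j (codegen n j \<cdot> w) (thresh n j \<cdot> w)"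
        using im[of "(z, w)" k l u] z w unfolding prism_stage_def \<sigma>_def by (auto simp: cells_Delta)
      then show ?thesis using prism_horn[OF z i] prism_horn[OF w j] by simp
    qed
    then show ?thesis unfolding bi_horn_cells cells_Delta by auto
  qed
  show ?thesis
  proof (rule lifts_attach[where I = UNIV and D = "\<lambda>_. ?D" and \<sigma> = \<sigma>])
    show "closed_in ?B (prism_stage m n i j)" by (rule closed_prism_stage)
    show "bisimplicial ?D" by (rule bisimplicial_Delta)
    show "bihom ?D ?B (\<sigma> u)" for u
    proof (rule hom_onI)
      fix M N k l a b x assume "a \<in> ops M k" "b \<in> ops N l" "x \<in> cells ?D M N"
      then show "\<sigma> u k l (act ?D M N a b x) = act ?B M N a b (\<sigma> u M N x)"
        unfolding \<sigma>_def by (auto simp: act_bprod act_Delta cells_Delta op_comp_assoc)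
    qed (rule im)
    show "lifts ?D (\<lambda>k l. {x \<in> cells ?D k l. \<sigma> u k l x \<in> prism_stage m n i j k l}) (cells ?D) X p Y" for u
      unfolding pre using horn_fibD[OF horn] i j by simp
    show "u = u' \<and> x = y" if "x \<in> cells ?D k l" "y \<in> cells ?D k l" "\<sigma> u k l x = \<sigma> u' k l y" for u u' k l x y
      using that prism_inj[of "fst x" m k "fst y" i] prism_inj[of "snd x" n l "snd y" j]
      unfolding \<sigma>_def by (auto simp: cells_Delta)
    show "prism_stage m n i (Suc j) k l = prism_stage m n i j k l \<union> (\<Union>u\<in>UNIV. \<sigma> u k l ` cells ?D k l)" for k l
    proof (intro equalityI subsetI)
      fix x assume x: "x \<in> prism_stage m n i (Suc j) k l"
      obtain a b e f where xe: "x = ((a, b), (e, f))" by (metis prod.collapse)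
      show "x \<in> prism_stage m n i j k l \<union> (\<Union>u\<in>UNIV. \<sigma> u k l ` cells ?D k l)"
      proof (cases "x \<in> prism_stage m n i j k l")
        case False
        with x xe have be: "below i a e" "below j b f" and o: "a \<in> ops m k" "b \<in> ops n l" "e \<in> ops 1 k" "f \<in> ops 1 l"
          unfolding prism_stage_def by (auto simp: prism_Suc cells_bprod cells_Delta)
        obtain z where z: "z \<in> ops (Suc m) k" "a = codegen m i \<cdot> z" "e = thresh m i \<cdot> z"
          using below_preimage[OF o(1,3) be(1)] by blast
        obtain w where w: "w \<in> ops (Suc n) l" "b = codegen n j \<cdot> w" "f = thresh n j \<cdot> w"
          using below_preimage[OF o(2,4) be(2)] by blast
        have "x = \<sigma> () k l (z, w)" unfolding xe \<sigma>_def using z w by simp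
        moreover have "(z, w) \<in> cells ?D k l" using z w by (simp add: cells_Delta)
        ultimately show ?thesis by blast
      qed simp
    next
      fix x assume "x \<in> prism_stage m n i j k l \<union> (\<Union>u\<in>UNIV. \<sigma> u k l ` cells ?D k l)"
      then consider "x \<in> prism_stage m n i j k l"
        | z w where "x = \<sigma> () k l (z, w)" "z \<in> ops (Suc m) k" "w \<in> ops (Suc n) l"
        by (auto simp: cells_Delta)
      then show "x \<in> prism_stage m n i (Suc j) k l"
      proof cases
        case 1 then show ?thesis unfolding prism_stage_def by (auto simp: prism_Suc)
      next
        case 2
        then show ?thesis
          using im[of "(z, w)" k l "()"] below_image[of z m k i] below_image[of w n l j]
          unfolding prism_stage_def \<sigma>_def by (auto simp: prism_Suc cells_Delta)
      qed
    qed
  qed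
qed

lemma horn_fib_imp_prism_fib:
  assumes "horn_fib X p Y"
  shows "prism_fib X p Y"
  unfolding prism_fib_def
proof (intro allI)
  fix m n
  let ?B = "\<Delta> m n \<otimes> square"
  have row: "lifts ?B (prism_stage m n i 0) (prism_stage m n i (Suc n)) X p Y" if "i \<le> m" for i
  proof (rule lifts_chain[where N = "Suc n" and S = "prism_stage m n i"])
    show "lifts ?B (prism_stage m n i j) (prism_stage m n i (Suc j)) X p Y" if "j < Suc n" for j
      using prism_stage_step[OF assms \<open>i \<le> m\<close>, of j n] that by simp
    show "prism_stage m n i j k l \<subseteq> prism_stage m n i (Suc j) k l" for j k l
      unfolding prism_stage_def by (auto simp: prism_Suc)
  qed simp
  \<comment> \<open>The end of a row is the beginning of the next one, because the shuffles of the
    second prism are used up.\<close>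
  have full: "prism_stage m n i (Suc n) = prism_stage m n (Suc i) 0" for i
    unfolding prism_stage_def fun_eq_iff
    by (auto simp: prism_full cells_bprod cells_Delta intro: prism_SucI)
  have "lifts ?B (prism_stage m n 0 0) (prism_stage m n (Suc m) 0) X p Y"
  proof (rule lifts_chain[where N = "Suc m" and S = "\<lambda>i. prism_stage m n i 0"])
    show "lifts ?B (prism_stage m n i 0) (prism_stage m n (Suc i) 0) X p Y" if "i < Suc m" for i
      using row[of i] that by (simp add: full)
    show "prism_stage m n i 0 k l \<subseteq> prism_stage m n (Suc i) 0 k l" for i k l
      unfolding prism_stage_def by (auto simp: prism_Suc)
  qed simp
  \<comment> \<open>With no shuffle attached, \<open>prism\<close> records just a missed vertex or
    the end \<open>1\<close>, which in the two directions give the boundary and the hook.\<close>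
  moreover have "prism_stage m n 0 0 = pushout_prod (cells (\<delta>\<Delta> m n)) (\<Delta> m n) hook square"
    unfolding prism_stage_def pushout_prod_def fun_eq_iff bi_boundary_cells last_horn_cells
    by (auto simp: prism_Suc prism_def[of _ 0] cells_bprod cells_Delta below_def)
  moreover have "prism_stage m n (Suc m) 0 = cells ?B"
    unfolding prism_stage_def fun_eq_iff by (auto simp: prism_full cells_bprod cells_Delta)
  ultimately show "lifts ?B (pushout_prod (cells (\<delta>\<Delta> m n)) (\<Delta> m n) hook square)
      (cells ?B) X p Y" by simp
qed

section \<open>From the definition of fibrations to fillings of bihorns\<close>

lemma bimaps_iff:
  "f \<in> bimaps X Y \<longleftrightarrow> bihom X Y f \<and> (\<forall>m n. f m n \<in> extensional (cells X m n))"
  unfolding bimaps_def hom_on_def PiE_def Pi_def by blast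

lemma bimaps_hom_on: "f \<in> bimaps X Y \<Longrightarrow> bihom X Y f"
  by (simp add: bimaps_iff)

lemma bimaps_eqI:
  assumes "f \<in> bimaps X Y" "g \<in> bimaps X Z" "\<And>m n x. x \<in> cells X m n \<Longrightarrow> f m n x = g m n x"
  shows "f = g"
  using assms unfolding bimaps_iff by (intro ext) (metis extensionalityI)

lemma restrict_bimaps:
  assumes "bisimplicial K" "bihom K X f"
  shows "(\<lambda>m n. restrict (f m n) (cells K m n)) \<in> bimaps K X"
proof -
  have "bihom K X (\<lambda>m n. restrict (f m n) (cells K m n))"
    by (rule hom_on_cong[OF closed_in_cells[OF assms(1)] _ assms(2)]) simp
  then show ?thesis by (simp add: bimaps_iff)
qed

text \<open>\<open>std\<close> is countable, so it is enough to embed the natural numbers: an atom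
  wrapped repeatedly in constant families does this whatever the size of \<open>'a\<close>.\<close>

lemma inj_std_univ: "\<exists>e :: std \<Rightarrow> 'a univ. inj e"
proof -
  define g :: "nat \<Rightarrow> 'a univ" where "g = rec_nat (Atom undefined) (\<lambda>_ r. Fam (\<lambda>_ _ _. r))"
  have "g i = g j \<Longrightarrow> i = j" for i j
  proof (induction i arbitrary: j)
    case 0
    then show ?case by (cases j) (auto simp: g_def)
  next
    case (Suc i)
    then obtain j' where "j = Suc j'" by (cases j) (auto simp: g_def)
    with Suc show ?case by (auto simp: g_def dest: fun_cong)
  qed
  then have "inj g" by (rule injI)
  then have "inj (g \<circ> (to_nat :: std \<Rightarrow> nat))" by (intro inj_compose inj_to_nat)
  then show ?thesis by blast
qed

lemma bi_horn_sub: "cells (bi_horn m n i j) k l \<subseteq> cells (\<Delta> m n) k l"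
  unfolding bi_horn_cells cells_Delta by auto

lemma closed_bi_horn: "closed_in (\<Delta> m n) (cells (bi_horn m n i j))"
proof (rule closed_inI)
  fix M N k l a b x
  assume ab: "a \<in> ops M k" "b \<in> ops N l" and x: "x \<in> cells (bi_horn m n i j) M N"
  show "act (\<Delta> m n) M N a b x \<in> cells (bi_horn m n i j) k l"
    using x op_comp_ops[OF _ ab(1), of "fst x" m] op_comp_ops[OF _ ab(2), of "snd x" n]
      set_op_comp[OF _ ab(1), of "fst x" m] set_op_comp[OF _ ab(2), of "snd x" n]
    unfolding bi_horn_cells act_Delta by auto blast+
qed (use bi_horn_sub in blast)

text \<open>Among the anodyne extensions only the generators are tested. The work lies in carrying a
  lifting problem to the relabelled copy in \<open>'a univ\<close> and its solution back.\<close>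

lemma fibration_imp_horn_fib:
  fixes X :: "('a, 'y) bisset_scheme" and Y :: "('b, 'z) bisset_scheme"
  assumes fib: "fibration X p Y"
  shows "horn_fib X p Y"
  unfolding horn_fib_def
proof (intro allI impI)
  fix m n i j
  assume ij: "i \<le> Suc m" "j \<le> Suc n"
  let ?H = "bi_horn (Suc m) (Suc n) i j" and ?D = "\<Delta> (Suc m) (Suc n)"
  obtain e :: "std \<Rightarrow> 'a univ" where e: "inj e" using inj_std_univ by blast
  define A where "A = relabel e ?H"
  define B where "B = relabel e ?D"
  have "(A, incl A, B) \<in> horn_inclusions"
    unfolding horn_inclusions_def A_def B_def mem_Collect_eq
    by (rule exI[of _ e], rule exI[of _ "Suc m"], rule exI[of _ "Suc n"], rule exI[of _ i], rule exI[of _ j])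
      (use e ij in simp)
  then have "anodyne A (incl A) B"
    unfolding anodyne_def mono_map_def by (auto simp: incl_def inj_on_def intro: saturation.generator)
  then have lift: "has_lifting A (incl A) B X p Y"
    using fib unfolding fibration_def by blast
  have cells_A: "cells A k l = e ` cells ?H k l" and cells_B: "cells B k l = e ` cells ?D k l"
    and act_A: "act A k l a b (e x) = e (act ?D k l a b x)"
    and act_B: "act B k l a b (e x) = e (act ?D k l a b x)" for k l a b x
    using e by (simp_all add: A_def B_def relabel_def act_bi_horn)
  have hom_A: "(\<lambda>k l. \<lambda>z\<in>cells A k l. f k l (inv e z)) \<in> bimaps A Z"
    if f: "hom_on ?D (cells ?H) Z f" for f and Z :: "('c, 'w) bisset_scheme"
  proof -
    have "e (act ?D M N a b x) \<in> cells A k l" "f k l (act ?D M N a b x) = act Z M N a b (f M N x)"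
      if "a \<in> ops M k" "b \<in> ops N l" "x \<in> cells ?H M N" for M N k l a b x
      using that closed_inD(2)[OF closed_bi_horn] hom_onD(2)[OF f] by (simp_all add: cells_A)
    then have "bihom A Z (\<lambda>k l. \<lambda>z\<in>cells A k l. f k l (inv e z))"
      using e hom_onD(1)[OF f] by (intro hom_onI) (auto simp only: cells_A act_A restrict_apply inv_f_f image_iff bex_simps if_True)
    then show ?thesis by (simp add: bimaps_iff)
  qed
  have hom_B: "(\<lambda>k l. \<lambda>z\<in>cells B k l. f k l (inv e z)) \<in> bimaps B Z"
    if f: "bihom ?D Z f" for f and Z :: "('c, 'w) bisset_scheme"
  proof -
    have "e (act ?D M N a b x) \<in> cells B k l" "f k l (act ?D M N a b x) = act Z M N a b (f M N x)"
      if "a \<in> ops M k" "b \<in> ops N l" "x \<in> cells ?D M N" for M N k l a b x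
      using that bisimplicialD(1)[OF bisimplicial_Delta] hom_onD(2)[OF f] by (simp_all add: cells_B)
    then have "bihom B Z (\<lambda>k l. \<lambda>z\<in>cells B k l. f k l (inv e z))"
      using e hom_onD(1)[OF f] by (intro hom_onI) (auto simp only: cells_B act_B restrict_apply inv_f_f image_iff bex_simps if_True)
    then show ?thesis by (simp add: bimaps_iff)
  qed
  show "lifts ?D (cells ?H) (cells ?D) X p Y"
  proof (rule liftsI)
    fix u v
    assume u: "hom_on ?D (cells ?H) X u" and v: "bihom ?D Y v"
      and uv: "\<And>k l x. x \<in> cells ?H k l \<Longrightarrow> p k l (u k l x) = v k l x"
    define u' where "u' = (\<lambda>k l. \<lambda>z\<in>cells A k l. u k l (inv e z))"
    define v' where "v' = (\<lambda>k l. \<lambda>z\<in>cells B k l. v k l (inv e z))"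
    have "z \<in> cells B k l" if "z \<in> cells A k l" for z k l
      using that bi_horn_sub unfolding cells_A cells_B by blast
    then have "bicomp A p u' = bicomp A v' (incl A)"
      unfolding bicomp_def compose_def fun_eq_iff using e
      by (auto simp: u'_def v'_def incl_def cells_A uv)
    then obtain w where w: "w \<in> bimaps B X" "bicomp A w (incl A) = u'" "bicomp B p w = v'"
      using lift hom_A[OF u] hom_B[OF v] unfolding has_lifting_def u'_def v'_def by blast
    have "w k l (e x) = u k l x" if "x \<in> cells ?H k l" for k l x
      using fun_cong[OF fun_cong[OF fun_cong[OF w(2)]], of k l "e x"] that e
      by (simp add: bicomp_def compose_def u'_def incl_def cells_A)
    moreover have "p k l (w k l (e x)) = v k l x" if "x \<in> cells ?D k l" for k l x
      using fun_cong[OF fun_cong[OF fun_cong[OF w(3)]], of k l "e x"] that e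
      by (simp add: bicomp_def compose_def v'_def cells_B)
    moreover have "bihom ?D X (\<lambda>k l x. w k l (e x))"
      using bimaps_hom_on[OF w(1)] unfolding hom_on_def cells_B by (auto simp: act_B[symmetric])
    ultimately show "\<exists>w. bihom ?D X w \<and> (\<forall>k l. \<forall>x\<in>cells ?H k l. w k l x = u k l x) \<and>
      (\<forall>k l. \<forall>x\<in>cells ?D k l. p k l (w k l x) = v k l x)" by blast
  qed
qed

subsection \<open>Attaching cells along skeleta\<close>

text \<open>The factor is \<open>a\<close> followed by the map that closes the gap at
  \<open>i\<close>. As operators are nonempty lists, none into \<open>[0]\<close> misses
  \<open>0\<close>, hence \<open>0 < m\<close>.\<close>

lemma op_factor_coface:
  assumes a: "a \<in> ops m k" and i: "i \<le> m" "i \<notin> set a"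
  obtains a' where "0 < m" "a' \<in> ops (m - 1) k" "a = coface m i \<cdot> a'"
proof -
  define a' where "a' = map (\<lambda>t. if t < i then t else t - 1) a"
  have len: "length a = Suc k" using a by (simp add: ops_iff)
  have ne: "a ! t \<noteq> i" if "t \<le> k" for t using i(2) that len by (metis less_Suc_eq_le nth_mem)
  have m: "0 < m"
  proof (rule ccontr)
    assume "\<not> 0 < m"
    then have "a ! 0 = i" using a i(1) by (simp add: ops_iff)
    then show False using ne[of 0] by simp
  qed
  have na': "a' ! t = (if a ! t < i then a ! t else a ! t - 1)" if "t \<le> k" for t
    using that len by (simp add: a'_def)
  have le: "a' ! t \<le> m - 1" if t: "t \<le> k" for t
  proof -
    have "a ! t \<le> m" using a t by (simp add: ops_iff)
    then show ?thesis using na'[OF t] ne[OF t] i(1) by auto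
  qed
  have "a' \<in> ops (m - 1) k" unfolding ops_iff
  proof (intro conjI allI impI)
    fix s t assume st: "s \<le> t" "t \<le> k"
    then have "a ! s \<le> a ! t" using a by (simp add: ops_iff)
    then show "a' ! s \<le> a' ! t" using na'[of s] na'[of t] st by (auto split: if_splits)
  qed (use len le in \<open>simp_all add: a'_def\<close>)
  moreover have "a = coface m i \<cdot> a'"
  proof (rule nth_equalityI)
    fix t assume "t < length a"
    then have t: "t \<le> k" using len by simp
    have "(coface m i \<cdot> a') ! t = (if a' ! t < i then a' ! t else Suc (a' ! t))"
      using le[OF t] m t len by (simp add: op_comp_def coface_def a'_def)
    then show "a ! t = (coface m i \<cdot> a') ! t"
      using na'[OF t] ne[OF t] by (auto split: if_splits)
  qed (simp add: a'_def)
  ultimately show thesis using that m by blast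
qed

text \<open>Any choice of preimages is automatically monotone. The freedom to prescribe the point
  \<open>t\<close> on the section is what lets \<open>skel_unique\<close> recover an operator
  pointwise from its sections.\<close>

lemma op_section:
  assumes a: "a \<in> ops m k" and surj: "{..m} \<subseteq> set a" and t: "t \<le> k"
  obtains s where "s \<in> ops k m" "a \<cdot> s = op_id m" "s ! (a ! t) = t"
proof -
  define g where "g v = (if v = a ! t then t else (SOME u. u \<le> k \<and> a ! u = v))" for v
  have g: "g v \<le> k \<and> a ! g v = v" if "v \<le> m" for v
  proof (cases "v = a ! t")
    case False
    have "\<exists>u. u \<le> k \<and> a ! u = v" using that surj in_set_ops[OF a, of v] by auto
    from someI_ex[OF this] show ?thesis using False by (simp add: g_def)
  qed (use t in \<open>simp add: g_def\<close>)
  define s where "s = map g [0..<Suc m]"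
  have ns: "s ! v = g v" if "v \<le> m" for v using that by (simp add: s_def nth_append del: upt_Suc)
  have at: "a ! t \<le> m" using a t by (simp add: ops_iff)
  have "s \<in> ops k m" unfolding ops_iff
  proof (intro conjI allI impI)
    fix v w assume vw: "v \<le> w" "w \<le> m"
    show "s ! v \<le> s ! w"
    proof (rule ccontr)
      assume "\<not> s ! v \<le> s ! w"
      then have less: "g w < g v" using ns vw by simp
      then have "a ! g w \<le> a ! g v" using a g[of v] vw unfolding ops_iff by (meson less_imp_le order_trans)
      then have "v = w" using g[of v] g[of w] vw by simp
      then show False using less by simp
    qed
  qed (use g ns in \<open>simp_all add: s_def\<close>)
  moreover have "a \<cdot> s = op_id m"
  proof (rule nth_equalityI)
    fix v assume "v < length (a \<cdot> s)"
    then have v: "v \<le> m" by (simp add: s_def)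
    show "(a \<cdot> s) ! v = op_id m ! v"
      using v ns[OF v] g[OF v] by (simp add: nth_op_comp s_def op_id_def nth_append del: upt_Suc)
  qed (simp add: s_def op_id_def)
  moreover have "s ! (a ! t) = t" using ns[OF at] by (simp add: g_def)
  ultimately show thesis using that by blast
qed

lemma surj_op_id:
  assumes a: "a \<in> ops m m" and surj: "{..m} \<subseteq> set a"
  shows "a = op_id m"
proof -
  have set: "set a = {..m}" and srt: "sorted a" and len: "length a = Suc m"
    using a surj by (auto simp: ops_def)
  then have "distinct a" by (simp add: card_distinct)
  then show ?thesis
    using set srt sorted_distinct_set_unique[of a "[0..<Suc m]"]
    by (simp add: op_id_def atLeast0LessThan lessThan_Suc_atMost del: upt_Suc)
qed

lemma surj_op_le:
  assumes "a \<in> ops m k" "{..m} \<subseteq> set a"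
  shows "m \<le> k"
proof -
  have "card {..m} \<le> card (set a)" using assms(2) by (intro card_mono) auto
  also have "\<dots> \<le> length a" by (rule card_length)
  finally show ?thesis using assms(1) by (simp add: ops_iff)
qed

text \<open>Filtration by total degree relative to \<open>L\<close>. With the strict bound, stage
  \<open>0\<close> is \<open>L\<close> itself and the step from \<open>d\<close> to
  \<open>Suc d\<close> attaches the cells of total degree exactly \<open>d\<close>.\<close>

definition skel :: "('k, 'z) bisset_scheme \<Rightarrow> (nat \<Rightarrow> nat \<Rightarrow> 'k set) \<Rightarrow> nat \<Rightarrow> nat \<Rightarrow> nat \<Rightarrow> 'k set" where
  "skel K L d k l = L k l \<union>
     {act K m n a b y |m n a b y. m + n < d \<and> y \<in> cells K m n \<and> a \<in> ops m k \<and> b \<in> ops n l}"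

lemma skelI:
  "m + n < d \<Longrightarrow> y \<in> cells K m n \<Longrightarrow> a \<in> ops m k \<Longrightarrow> b \<in> ops n l \<Longrightarrow> act K m n a b y \<in> skel K L d k l"
  unfolding skel_def by blast

lemma closed_skel:
  assumes K: "bisimplicial K" and L: "closed_in K L"
  shows "closed_in K (skel K L d)"
proof (rule closed_inI)
  fix m n x assume "x \<in> skel K L d m n"
  then show "x \<in> cells K m n"
    unfolding skel_def using closed_inD(1)[OF L] bisimplicialD(1)[OF K] by blast
next
  fix m n k l a b x assume ab: "a \<in> ops m k" "b \<in> ops n l" and x: "x \<in> skel K L d m n"
  show "act K m n a b x \<in> skel K L d k l"
  proof (cases "x \<in> L m n")
    case True
    then show ?thesis using closed_inD(2)[OF L ab] by (simp add: skel_def)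
  next
    case False
    then obtain m' n' a' b' y where y: "x = act K m' n' a' b' y" "m' + n' < d" "y \<in> cells K m' n'"
      "a' \<in> ops m' m" "b' \<in> ops n' n" using x unfolding skel_def by blast
    have "act K m n a b x = act K m' n' (a' \<cdot> a) (b' \<cdot> b) y"
      using bisimplicialD(3)[OF K y(4,5) ab y(3)] y(1) by simp
    then show ?thesis using skelI[OF y(2,3)] op_comp_ops y(4,5) ab by metis
  qed
qed

lemma skel_Suc:
  "skel K L (Suc d) k l = skel K L d k l \<union>
    {act K m n a b y |m n a b y. m + n = d \<and> y \<in> cells K m n \<and> a \<in> ops m k \<and> b \<in> ops n l}"
  unfolding skel_def less_Suc_eq by blast

text \<open>If both operators are surjective, sections undo them and would bring \<open>x\<close>
  itself into the skeleton. If one misses a vertex, it factors through a coface, hence through a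
  cell of smaller total degree.\<close>

lemma skel_act_iff:
  assumes K: "bisimplicial K" and L: "closed_in K L"
    and x: "x \<in> cells K m n" "x \<notin> skel K L d m n" "m + n = d"
    and ab: "a \<in> ops m k" "b \<in> ops n l"
  shows "act K m n a b x \<in> skel K L d k l \<longleftrightarrow> (a, b) \<in> cells (\<delta>\<Delta> m n) k l"
proof
  assume sk: "act K m n a b x \<in> skel K L d k l"
  show "(a, b) \<in> cells (\<delta>\<Delta> m n) k l"
  proof (rule ccontr)
    assume "(a, b) \<notin> cells (\<delta>\<Delta> m n) k l"
    then have s: "{..m} \<subseteq> set a" "{..n} \<subseteq> set b" using ab by (auto simp: bi_boundary_cells)
    obtain r where r: "r \<in> ops k m" "a \<cdot> r = op_id m" using op_section[OF ab(1) s(1), of 0] by blast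
    obtain q where q: "q \<in> ops l n" "b \<cdot> q = op_id n" using op_section[OF ab(2) s(2), of 0] by blast
    have "act K k l r q (act K m n a b x) = x"
      using bisimplicialD(3)[OF K ab r(1) q(1) x(1)] bisimplicialD(2)[OF K x(1)] r(2) q(2) by simp
    then show False using closed_inD(2)[OF closed_skel[OF K L] r(1) q(1) sk] x(2) by simp
  qed
next
  assume "(a, b) \<in> cells (\<delta>\<Delta> m n) k l"
  then consider i where "i \<le> m" "i \<notin> set a" | i where "i \<le> n" "i \<notin> set b"
    by (auto simp: bi_boundary_cells)
  then show "act K m n a b x \<in> skel K L d k l"
  proof cases
    case 1
    then obtain a' where a': "0 < m" "a' \<in> ops (m - 1) k" "a = coface m i \<cdot> a'"
      using op_factor_coface[OF ab(1)] by blast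
    have "act K m n a b x = act K (m - 1) n a' b (act K m n (coface m i) (op_id n) x)"
      using bisimplicialD(3)[OF K coface_ops[OF a'(1)] op_id_ops a'(2) ab(2) x(1)] a'(3)
        op_id_left[OF ab(2)] by simp
    moreover have "act K m n (coface m i) (op_id n) x \<in> cells K (m - 1) n"
      using bisimplicialD(1)[OF K coface_ops[OF a'(1)] op_id_ops x(1)] .
    ultimately show ?thesis using skelI[OF _ _ a'(2) ab(2), of d _ K L] a'(1) x(3) by simp
  next
    case 2
    then obtain b' where b': "0 < n" "b' \<in> ops (n - 1) l" "b = coface n i \<cdot> b'"
      using op_factor_coface[OF ab(2)] by blast
    have "act K m n a b x = act K m (n - 1) a b' (act K m n (op_id m) (coface n i) x)"
      using bisimplicialD(3)[OF K op_id_ops coface_ops[OF b'(1)] ab(1) b'(2) x(1)] b'(3)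
        op_id_left[OF ab(1)] by simp
    moreover have "act K m n (op_id m) (coface n i) x \<in> cells K m (n - 1)"
      using bisimplicialD(1)[OF K op_id_ops coface_ops[OF b'(1)] x(1)] .
    ultimately show ?thesis using skelI[OF _ _ ab(1) b'(2), of d _ K L] b'(1) x(3) by simp
  qed
qed

text \<open>Eilenberg--Zilber: a cell is a degeneracy of a unique cell outside the skeleton; the operator is
  recovered by testing it against the sections of the other one.\<close>

lemma skel_unique:
  assumes K: "bisimplicial K" and L: "closed_in K L"
    and x: "x \<in> cells K m n" "x \<notin> skel K L d m n" "m + n = d"
    and x': "x' \<in> cells K m' n'" "x' \<notin> skel K L d m' n'" "m' + n' = d"
    and ab: "a \<in> ops m k" "b \<in> ops n l" and ab': "a' \<in> ops m' k" "b' \<in> ops n' l"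
    and eq: "act K m n a b x = act K m' n' a' b' x'" and nin: "act K m n a b x \<notin> skel K L d k l"
  shows "m = m' \<and> n = n' \<and> x = x' \<and> a = a' \<and> b = b'"
proof -
  have s: "{..m} \<subseteq> set a" "{..n} \<subseteq> set b"
    using nin skel_act_iff[OF K L x ab] ab by (auto simp: bi_boundary_cells)
  have main: "x = act K m' n' (a' \<cdot> r) (b' \<cdot> q) x' \<and> {..m'} \<subseteq> set (a' \<cdot> r) \<and> {..n'} \<subseteq> set (b' \<cdot> q)"
    if r: "r \<in> ops k m" "a \<cdot> r = op_id m" and q: "q \<in> ops l n" "b \<cdot> q = op_id n" for r q
  proof -
    have "x = act K k l r q (act K m n a b x)"
      using bisimplicialD(3)[OF K ab r(1) q(1) x(1)] bisimplicialD(2)[OF K x(1)] r(2) q(2) by simp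
    then have e: "x = act K m' n' (a' \<cdot> r) (b' \<cdot> q) x'"
      using bisimplicialD(3)[OF K ab' r(1) q(1) x'(1)] eq by simp
    have o: "a' \<cdot> r \<in> ops m' m" "b' \<cdot> q \<in> ops n' n" using op_comp_ops ab' r q by auto
    show ?thesis using skel_act_iff[OF K L x' o] e x(2) o by (auto simp: bi_boundary_cells)
  qed
  obtain r where r: "r \<in> ops k m" "a \<cdot> r = op_id m" using op_section[OF ab(1) s(1), of 0] by blast
  obtain q where q: "q \<in> ops l n" "b \<cdot> q = op_id n" using op_section[OF ab(2) s(2), of 0] by blast
  \<comment> \<open>Both operators in \<open>main\<close> are surjective, which bounds each index
    separately; the equal sums then force equality.\<close>
  have "m' \<le> m" "n' \<le> n"
    using main[OF r q] surj_op_le op_comp_ops[OF ab'(1) r(1)] op_comp_ops[OF ab'(2) q(1)] by auto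
  then have mn: "m = m'" "n = n'" using x(3) x'(3) by auto
  have ids: "a' \<cdot> r = op_id m \<and> b' \<cdot> q = op_id n"
    if "r \<in> ops k m" "a \<cdot> r = op_id m" "q \<in> ops l n" "b \<cdot> q = op_id n" for r q
    using main[OF that] mn surj_op_id op_comp_ops[OF ab'(1) that(1)] op_comp_ops[OF ab'(2) that(3)] by simp
  have "x = x'" using main[OF r q] ids[OF r q] bisimplicialD(2)[OF K x'(1)] mn by simp
  moreover have "a = a'"
  proof (rule nth_equalityI)
    fix t assume "t < length a"
    then have t: "t \<le> k" using ab by (simp add: ops_iff)
    obtain r where r: "r \<in> ops k m" "a \<cdot> r = op_id m" "r ! (a ! t) = t" using op_section[OF ab(1) s(1) t] .
    have at: "a ! t \<le> m" using ab t by (simp add: ops_iff)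
    have "(a' \<cdot> r) ! (a ! t) = op_id m ! (a ! t)" using ids[OF r(1,2) q] by simp
    then show "a ! t = a' ! t"
      using at r(1,3) by (simp add: nth_op_comp ops_iff op_id_def nth_append del: upt_Suc)
  qed (use ab ab' in \<open>simp add: ops_iff\<close>)
  moreover have "b = b'"
  proof (rule nth_equalityI)
    fix t assume "t < length b"
    then have t: "t \<le> l" using ab by (simp add: ops_iff)
    obtain q where q: "q \<in> ops l n" "b \<cdot> q = op_id n" "q ! (b ! t) = t" using op_section[OF ab(2) s(2) t] .
    have bt: "b ! t \<le> n" using ab t by (simp add: ops_iff)
    have "(b' \<cdot> q) ! (b ! t) = op_id n ! (b ! t)" using ids[OF r q(1,2)] by simp
    then show "b ! t = b' ! t"
      using bt q(1,3) by (simp add: nth_op_comp ops_iff op_id_def nth_append del: upt_Suc)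
  qed (use ab ab' in \<open>simp add: ops_iff\<close>)
  ultimately show ?thesis using mn by simp
qed

lemma closed_pushout_prod:
  assumes "bisimplicial K" "bisimplicial J" "closed_in K L" "closed_in J C"
  shows "closed_in (K \<otimes> J) (pushout_prod L K C J)"
  using assms unfolding pushout_prod_def
  by (auto intro!: closed_inI simp: cells_bprod act_bprod dest: bisimplicialD(1) closed_inD(2))

text \<open>\<open>J\<close> and \<open>C\<close> are carried along while \<open>K\<close> is built
  from \<open>L\<close> by skeleta: each new cell of bidegree \<open>(m, n)\<close> contributes a
  copy of \<open>\<Delta> m n \<otimes> J\<close>, attached along the pushout product of its
  boundary with \<open>C\<close>.\<close>

lemma lifts_cellwise:
  fixes K :: "'k bisset" and J :: "'j bisset"
  assumes K: "bisimplicial K" and J: "bisimplicial J" and L: "closed_in K L" and C: "closed_in J C"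
    and lift: "\<And>m n. lifts (\<Delta> m n \<otimes> J) (pushout_prod (cells (\<delta>\<Delta> m n)) (\<Delta> m n) C J)
      (cells (\<Delta> m n \<otimes> J)) X p Y"
  shows "lifts (K \<otimes> J) (pushout_prod L K C J) (cells (K \<otimes> J)) X p Y"
proof -
  define S where "S d = pushout_prod (skel K L d) K C J" for d
  have "lifts (K \<otimes> J) (S 0) (cells (K \<otimes> J)) X p Y"
  proof (rule lifts_union[where S = S and N = "\<lambda>m n. Suc (m + n)"])
    show cl: "closed_in (K \<otimes> J) (S d)" for d
      unfolding S_def by (intro closed_pushout_prod K J C closed_skel L)
    show "S d m n \<subseteq> S (Suc d) m n" for d m n
      unfolding S_def pushout_prod_def skel_Suc by auto
    show "S d m n \<subseteq> cells (K \<otimes> J) m n" for d m n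
      unfolding S_def pushout_prod_def by auto
    \<comment> \<open>A cell is its own image under the identity operators, so the strict bound
      \<open>Suc (m + n)\<close> captures bidegree \<open>(m, n)\<close>.\<close>
    show "cells (K \<otimes> J) m n = S (Suc (m + n)) m n" for m n
    proof -
      have "x \<in> skel K L (Suc (m + n)) m n" if "x \<in> cells K m n" for x
        using skelI[of m n "Suc (m + n)" x K "op_id m" m "op_id n" n L] that bisimplicialD(2)[OF K that] by simp
      then show ?thesis unfolding S_def pushout_prod_def by (auto simp: cells_bprod)
    qed
    show "lifts (K \<otimes> J) (S d) (S (Suc d)) X p Y" for d
    proof -
      define I where "I = {(m, n, x). m + n = d \<and> x \<in> cells K m n \<and> x \<notin> skel K L d m n}"
      define \<sigma> :: "nat \<times> nat \<times> 'k \<Rightarrow> (std \<times> 'j, 'k \<times> 'j) bimap" where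
        "\<sigma> = (\<lambda>(m, n, x) k l z. (act K m n (fst (fst z)) (snd (fst z)) x, snd z))"
      define D where "D = (\<lambda>(m, n, x :: 'k). \<Delta> m n \<otimes> J)"
      show ?thesis
      proof (rule lifts_attach[where I = I and D = D and \<sigma> = \<sigma>])
        show "closed_in (K \<otimes> J) (S d)" by (rule cl)
        show "bisimplicial (D c)" for c
          unfolding D_def by (auto split: prod.splits intro: bisimplicial_bprod bisimplicial_Delta J)
        show "bihom (D c) (K \<otimes> J) (\<sigma> c)" if "c \<in> I" for c
          using that bisimplicialD[OF K] unfolding I_def D_def \<sigma>_def
          by (auto intro!: hom_onI simp: cells_bprod act_bprod cells_Delta act_Delta)
        show "lifts (D c) (\<lambda>k l. {x \<in> cells (D c) k l. \<sigma> c k l x \<in> S d k l}) (cells (D c)) X p Y"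
          if cI: "c \<in> I" for c
        proof -
          obtain m n x where c: "c = (m, n, x)" and x: "x \<in> cells K m n" "x \<notin> skel K L d m n" "m + n = d"
            using cI by (cases c) (auto simp: I_def)
          have "(\<lambda>k l. {x \<in> cells (D c) k l. \<sigma> c k l x \<in> S d k l}) =
              pushout_prod (cells (\<delta>\<Delta> m n)) (\<Delta> m n) C J"
            unfolding fun_eq_iff c D_def S_def \<sigma>_def pushout_prod_def
            using bisimplicialD(1)[OF K _ _ x(1)]
            by (auto simp: cells_bprod cells_Delta skel_act_iff[OF K L x])
          then show ?thesis using lift[of m n] unfolding c D_def by simp
        qed
        show "c = c' \<and> z = z'"
          if cI: "c \<in> I" and cI': "c' \<in> I" and zz: "z \<in> cells (D c) k l" "z' \<in> cells (D c') k l" "\<sigma> c k l z = \<sigma> c' k l z'"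
            "\<sigma> c k l z \<notin> S d k l" for c c' k l z z'
        proof -
          obtain m n x where c: "c = (m, n, x)" and x: "x \<in> cells K m n" "x \<notin> skel K L d m n" "m + n = d"
            using cI by (cases c) (auto simp: I_def)
          obtain m' n' x' where c': "c' = (m', n', x')"
            and x': "x' \<in> cells K m' n'" "x' \<notin> skel K L d m' n'" "m' + n' = d"
            using cI' by (cases c') (auto simp: I_def)
          obtain a b j where z: "z = ((a, b), j)" by (metis prod.collapse)
          obtain a' b' j' where z': "z' = ((a', b'), j')" by (metis prod.collapse)
          have o: "a \<in> ops m k" "b \<in> ops n l" and j: "j \<in> cells J k l"
            using zz(1) unfolding c D_def z by (auto simp: cells_bprod cells_Delta)
          have o': "a' \<in> ops m' k" "b' \<in> ops n' l"
            using zz(2) unfolding c' D_def z' by (auto simp: cells_bprod cells_Delta)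
          have eq: "act K m n a b x = act K m' n' a' b' x'" "j = j'"
            using zz(3) unfolding c c' z z' \<sigma>_def by auto
          have nin: "act K m n a b x \<notin> skel K L d k l"
            using zz(4) j bisimplicialD(1)[OF K o x(1)]
            unfolding c z \<sigma>_def S_def pushout_prod_def by (auto simp: cells_bprod)
          show ?thesis using skel_unique[OF K L x x' o o' eq(1) nin] eq(2) unfolding c c' z z' by simp
        qed
        show "S (Suc d) k l = S d k l \<union> (\<Union>c\<in>I. \<sigma> c k l ` cells (D c) k l)" for k l
        proof (intro equalityI subsetI)
          fix z assume z: "z \<in> S (Suc d) k l"
          show "z \<in> S d k l \<union> (\<Union>c\<in>I. \<sigma> c k l ` cells (D c) k l)"
          proof (cases "z \<in> S d k l")
            case False
            obtain y j where zy: "z = (y, j)" by fastforce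
            have j: "j \<in> cells J k l" and y: "y \<in> skel K L (Suc d) k l" "y \<notin> skel K L d k l"
              using z False unfolding zy S_def pushout_prod_def by (auto simp: cells_bprod)
            then obtain m n a b x where x: "y = act K m n a b x" "m + n = d" "x \<in> cells K m n"
              "a \<in> ops m k" "b \<in> ops n l" unfolding skel_Suc by blast
            have "x \<notin> skel K L d m n"
              using closed_inD(2)[OF closed_skel[OF K L] x(4,5)] y(2) x(1) by blast
            then have c: "(m, n, x) \<in> I" using x unfolding I_def by simp
            have "z = \<sigma> (m, n, x) k l ((a, b), j)" unfolding zy x(1) \<sigma>_def by simp
            moreover have "((a, b), j) \<in> cells (D (m, n, x)) k l"
              using x j unfolding D_def by (simp add: cells_bprod cells_Delta)
            ultimately show ?thesis using c by blast
          qed simp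
        next
          fix z assume z: "z \<in> S d k l \<union> (\<Union>c\<in>I. \<sigma> c k l ` cells (D c) k l)"
          show "z \<in> S (Suc d) k l"
          proof (cases "z \<in> S d k l")
            case True
            then show ?thesis unfolding S_def pushout_prod_def skel_Suc by auto
          next
            case False
            then obtain m n x a b j where x: "m + n = d" "x \<in> cells K m n" "a \<in> ops m k" "b \<in> ops n l"
              "j \<in> cells J k l" "z = (act K m n a b x, j)"
              using z unfolding I_def D_def \<sigma>_def by (auto simp: cells_bprod cells_Delta)
            then show ?thesis
              using skelI[of m n "Suc d" x K a k b l L] bisimplicialD(1)[OF K x(3,4,2)]
              unfolding S_def pushout_prod_def by (auto simp: cells_bprod)
          qed
        qed
      qed
    qed
  qed
  moreover have "S 0 = pushout_prod L K C J" unfolding S_def skel_def by simp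
  ultimately show ?thesis by simp
qed

lemma closed_last_horn: "closed_in square hook"
  unfolding last_horn_def by (rule closed_bi_horn)

lemma prism_fib_lifts:
  assumes "prism_fib X p Y" "bisimplicial K" "closed_in K L"
  shows "lifts (K \<otimes> square) (pushout_prod L K hook square) (cells (K \<otimes> square)) X p Y"
  using assms(1) unfolding prism_fib_def
  by (intro lifts_cellwise[OF assms(2) bisimplicial_Delta assms(3) closed_last_horn]) blast

(* keeps the subscripts of \<Delta> 1 1 and \<Lambda> 1 1 in the form in which the lemmas below match them *)
declare One_nat_def [simp del]

subsection \<open>The square and its distinguished subobjects\<close>

text \<open>The vertex \<open>(0, 0)\<close> with all its degeneracies. As \<open>coface 1 1\<close>
  picks the vertex \<open>0\<close>, restricting the square to it gives the \<open>corner\<close> in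
  the definitions of homotopy and of \<tau>.\<close>

definition origin :: "nat \<Rightarrow> nat \<Rightarrow> std" where
  "origin k l = (replicate (Suc k) 0, replicate (Suc l) 0)"

lemma origin_cells: "origin k l \<in> cells (\<Delta> m n) k l"
  unfolding origin_def cells_Delta by (simp add: replicate_ops del: replicate_Suc)

lemma act_origin: "a \<in> ops k k' \<Longrightarrow> b \<in> ops l l' \<Longrightarrow> act (\<Delta> m n) k l a b (origin k l) = origin k' l'"
  unfolding origin_def act_Delta by (simp add: replicate_op_comp del: replicate_Suc)

lemma origin_not_last_horn: "origin k l \<notin> hook k l"
  unfolding origin_def last_horn_cells by simp

lemma last_horn_sub: "hook k l \<subseteq> cells square k l"
  unfolding last_horn_cells cells_Delta by auto

lemma ops_1_iff:
  assumes "c \<in> ops 1 k" shows "0 \<notin> set c \<longleftrightarrow> c = replicate (Suc k) 1" "1 \<notin> set c \<longleftrightarrow> c = replicate (Suc k) 0"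
proof -
  have c: "set c \<subseteq> {0, 1}" "length c = Suc k" using assms by (auto simp: ops_def)
  show "0 \<notin> set c \<longleftrightarrow> c = replicate (Suc k) 1"
  proof
    assume "0 \<notin> set c"
    then have "\<forall>y\<in>set c. y = 1" using c(1) by auto
    then show "c = replicate (Suc k) 1" using c(2) by (metis replicate_eqI)
  qed auto
  show "1 \<notin> set c \<longleftrightarrow> c = replicate (Suc k) 0"
  proof
    assume "1 \<notin> set c"
    then have "\<forall>y\<in>set c. y = 0" using c(1) by auto
    then show "c = replicate (Suc k) 0" using c(2) by (metis replicate_eqI)
  qed auto
qed

lemma le_1_iff: "(n::nat) \<le> 1 \<longleftrightarrow> n = 0 \<or> n = 1"
  by auto

text \<open>Three of the four vertices of the square already lie on the hook. The fourth is a
  component of its own by \<open>origin_not_last_horn\<close>.\<close>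

lemma a_boundary_cells: "hook_pt k l = insert (origin k l) (hook k l)"
proof (intro equalityI subsetI)
  fix z assume z: "z \<in> hook_pt k l"
  show "z \<in> insert (origin k l) (hook k l)"
  proof (cases "z \<in> hook k l")
    case False
    with z obtain c d where cd: "z = (c, d)" "c \<in> ops 1 k" "d \<in> ops 1 l"
      "0 \<notin> set c \<or> 1 \<notin> set c" "0 \<notin> set d \<or> 1 \<notin> set d"
      unfolding a_boundary_def bunion_def box_def boundary_def face_def simplex_def
      by (auto simp: le_1_iff)
    with False have "1 \<notin> set c" "1 \<notin> set d" unfolding last_horn_cells by auto
    then show ?thesis using ops_1_iff cd unfolding origin_def by simp
  qed simp
next
  fix z assume "z \<in> insert (origin k l) (hook k l)"
  then show "z \<in> hook_pt k l"
    using replicate_ops[of 0 1]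
    unfolding a_boundary_def bunion_def box_def boundary_def face_def simplex_def origin_def
    by (auto simp: le_1_iff simp del: replicate_Suc)
qed

lemma closed_a_boundary: "closed_in square hook_pt"
proof (rule closed_inI)
  fix m n x assume "x \<in> hook_pt m n"
  then show "x \<in> cells square m n"
    unfolding a_boundary_cells using origin_cells last_horn_sub by blast
next
  fix m n k l a b x assume ab: "a \<in> ops m k" "b \<in> ops n l" and x: "x \<in> hook_pt m n"
  then show "act square m n a b x \<in> hook_pt k l"
    unfolding a_boundary_cells using act_origin[OF ab] closed_inD(2)[OF closed_last_horn ab] by (metis insert_iff)
qed

lemma closed_bi_boundary: "closed_in (\<Delta> m n) (cells (\<delta>\<Delta> m n))"
proof (rule closed_inI)
  fix M N k l a b x
  assume ab: "a \<in> ops M k" "b \<in> ops N l" and x: "x \<in> cells (\<delta>\<Delta> m n) M N"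
  show "act (\<Delta> m n) M N a b x \<in> cells (\<delta>\<Delta> m n) k l"
    using x op_comp_ops[OF _ ab(1), of "fst x" m] op_comp_ops[OF _ ab(2), of "snd x" n]
      set_op_comp[OF _ ab(1), of "fst x" m] set_op_comp[OF _ ab(2), of "snd x" n]
    unfolding bi_boundary_cells act_Delta by auto blast+
qed (auto simp: bi_boundary_cells cells_Delta)

subsection \<open>Kan fibrations\<close>

text \<open>Lifting over a point, written without a target so as to be independent of the type in
  which the point lives; \<open>kan_point\<close> translates.\<close>

definition kan :: "('a, 'z) bisset_scheme \<Rightarrow> bool" where
  "kan X \<longleftrightarrow> (\<forall>m n u. hom_on (\<Delta> m n \<otimes> square)
       (pushout_prod (cells (\<delta>\<Delta> m n)) (\<Delta> m n) hook square) X u \<longrightarrow>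
     (\<exists>w. bihom (\<Delta> m n \<otimes> square) X w \<and>
       (\<forall>k l. \<forall>z\<in>pushout_prod (cells (\<delta>\<Delta> m n)) (\<Delta> m n) hook square k l.
          w k l z = u k l z)))"

lemma lifts_singletons:
  assumes p: "\<And>m n x. x \<in> cells X m n \<Longrightarrow> p m n x \<in> cells Y m n"
    and Y: "\<And>m n. cells Y m n = {c m n}"
      "\<And>m n k l a b. a \<in> ops m k \<Longrightarrow> b \<in> ops n l \<Longrightarrow> act Y m n a b (c m n) = c k l"
  shows "lifts D S T X p Y \<longleftrightarrow>
    (\<forall>u. hom_on D S X u \<longrightarrow> (\<exists>w. hom_on D T X w \<and> (\<forall>m n. \<forall>x\<in>S m n. w m n x = u m n x)))"
    (is "_ \<longleftrightarrow> ?R")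
proof
  assume l: "lifts D S T X p Y"
  show ?R
  proof (intro allI impI)
    fix u assume u: "hom_on D S X u"
    have "hom_on D T Y (\<lambda>m n _. c m n)" using Y by (auto intro!: hom_onI)
    from liftsD[OF l u this] show "\<exists>w. hom_on D T X w \<and> (\<forall>m n. \<forall>x\<in>S m n. w m n x = u m n x)"
      using p hom_onD(1)[OF u] Y(1) by (metis singletonD)
  qed
next
  assume r: ?R
  show "lifts D S T X p Y"
  proof (rule liftsI)
    fix u v assume u: "hom_on D S X u" and v: "hom_on D T Y v"
    obtain w where w: "hom_on D T X w" "\<forall>m n. \<forall>x\<in>S m n. w m n x = u m n x" using r u by blast
    have "p m n (w m n x) = v m n x" if "x \<in> T m n" for m n x
      using p[OF hom_onD(1)[OF w(1) that]] hom_onD(1)[OF v that] Y(1) by simp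
    then show "\<exists>w. hom_on D T X w \<and> (\<forall>m n. \<forall>x\<in>S m n. w m n x = u m n x) \<and>
        (\<forall>m n. \<forall>x\<in>T m n. p m n (w m n x) = v m n x)" using w by blast
  qed
qed

text \<open>One element serves in all bidegrees, with trivial operators. Leaving \<open>c\<close>
  arbitrary provides a point in every type, in particular in a \<open>univ\<close> type to which
  \<open>loop\<close> applies.\<close>

definition point :: "'a \<Rightarrow> 'a pbisset" where
  "point c = \<lparr>cells = \<lambda>_ _. {c}, act = \<lambda>_ _ _ _ x. x, pt = c\<rparr>"

lemma kan_iff_prism_fib:
  assumes "\<And>m n x. x \<in> cells X m n \<Longrightarrow> p m n x \<in> cells Y m n" "\<And>m n. cells Y m n = {c m n}"
      "\<And>m n k l a b. a \<in> ops m k \<Longrightarrow> b \<in> ops n l \<Longrightarrow> act Y m n a b (c m n) = c k l"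
  shows "prism_fib X p Y \<longleftrightarrow> kan X"
  unfolding prism_fib_def kan_def using lifts_singletons[where X = X and p = p and Y = Y and c = c, OF assms] by blast

lemma kan_point: "kan X \<longleftrightarrow> prism_fib X (\<lambda>_ _ _. c) (point c)"
  by (rule kan_iff_prism_fib[symmetric]) (auto simp: point_def)

lemma pointed_point: "pointed_bisimplicial (point c)"
  unfolding pointed_bisimplicial_def bisimplicial_def point_def by simp

text \<open>The invariant of the induction over loop spaces. That the total space and the fiber are
  Kan is derived from it.\<close>

definition kan_fib :: "'a pbisset \<Rightarrow> ('a, 'b) bimap \<Rightarrow> 'b pbisset \<Rightarrow> bool" where
  "kan_fib X p Y \<longleftrightarrow> pointed_bisimplicial X \<and> pointed_bisimplicial Y \<and>
     bihom X Y p \<and> p 0 0 (pt X) = pt Y \<and> prism_fib X p Y \<and> kan Y"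

lemma kan_fibD:
  assumes "kan_fib X p Y"
  shows "pointed_bisimplicial X" "pointed_bisimplicial Y" "bihom X Y p"
    "p 0 0 (pt X) = pt Y" "prism_fib X p Y" "kan Y"
  using assms unfolding kan_fib_def by blast+

lemma kan_singleton: "kan (point c)"
  unfolding kan_def
proof (intro allI impI)
  fix m n u
  let ?S = "pushout_prod (cells (\<delta>\<Delta> m n)) (\<Delta> m n) hook square"
  assume "hom_on (\<Delta> m n \<otimes> square) ?S (point c) u"
  then have "u k l z = c" if "z \<in> ?S k l" for k l z
    using hom_onD(1)[of _ ?S "point c" u z k l] that by (simp add: point_def)
  moreover have "bihom (\<Delta> m n \<otimes> square) (point c) (\<lambda>_ _ _. c)"
    by (rule hom_onI) (simp_all add: point_def)
  ultimately show "\<exists>w. bihom (\<Delta> m n \<otimes> square) (point c) w \<and>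
      (\<forall>k l. \<forall>z\<in>?S k l. w k l z = u k l z)" by (intro exI[of _ "\<lambda>_ _ _. c"]) simp
qed

lemma kan_fib_point: "pointed_bisimplicial X \<Longrightarrow> kan X \<Longrightarrow> kan_fib X (\<lambda>_ _ _. c) (point c)"
  unfolding kan_fib_def kan_point[symmetric] using pointed_point kan_singleton
  by (auto intro!: hom_onI simp: point_def)

lemma hom_on_base: "pointed_bisimplicial X \<Longrightarrow> hom_on K S X (\<lambda>k l _. base X k l)"
  by (rule hom_onI) (metis base_in_cells, metis act_base)

lemma map_base:
  assumes "bihom X Y p" "p 0 0 (pt X) = pt Y" "pointed_bisimplicial X"
  shows "p m n (base X m n) = base Y m n"
proof -
  have "replicate (Suc i) 0 \<in> ops 0 i" for i by (rule replicate_ops) simp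
  then show ?thesis
    using assms hom_onD(2)[OF assms(1)] unfolding base_def pointed_bisimplicial_def by metis
qed

lemma kan_fib_base: "kan_fib X p Y \<Longrightarrow> p m n (base X m n) = base Y m n"
  using map_base kan_fibD by blast

text \<open>Extend the image of the data in \<open>Y\<close> first, then lift this extension along
  \<open>p\<close>.\<close>

lemma kan_fib_total:
  assumes "kan_fib X p Y"
  shows "kan X"
  unfolding kan_def
proof (intro allI impI)
  fix m n u
  let ?S = "pushout_prod (cells (\<delta>\<Delta> m n)) (\<Delta> m n) hook square"
  let ?D = "\<Delta> m n \<otimes> square"
  assume u: "hom_on ?D ?S X u"
  have "hom_on ?D ?S Y (\<lambda>k l z. p k l (u k l z))"
    using u kan_fibD(3)[OF assms] by (rule hom_on_comp) (rule hom_onD(1)[OF u])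
  then obtain v where v: "bihom ?D Y v" "\<forall>k l. \<forall>z\<in>?S k l. v k l z = p k l (u k l z)"
    using kan_fibD(6)[OF assms] unfolding kan_def by blast
  have l: "lifts ?D ?S (cells ?D) X p Y" using kan_fibD(5)[OF assms] unfolding prism_fib_def by blast
  have uv: "p k l (u k l z) = v k l z" if "z \<in> ?S k l" for k l z
    using v(2) that by simp
  obtain w where "bihom ?D X w" "\<And>k l z. z \<in> ?S k l \<Longrightarrow> w k l z = u k l z"
    by (rule liftsD[OF l u v(1) uv]) (assumption | rule that)+
  then show "\<exists>w. bihom ?D X w \<and> (\<forall>k l. \<forall>z\<in>?S k l. w k l z = u k l z)"
    by blast
qed

lemma fiber_simps:
  "cells (fiber X p Y) m n = {x \<in> cells X m n. p m n x = base Y m n}"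
  "act (fiber X p Y) = act X" "pt (fiber X p Y) = pt X" "base (fiber X p Y) m n = base X m n"
  unfolding fiber_def base_def by simp_all

lemma pointed_fiber:
  assumes "kan_fib X p Y"
  shows "pointed_bisimplicial (fiber X p Y)"
proof -
  have X: "bisimplicial X" "pt X \<in> cells X 0 0"
    using kan_fibD(1)[OF assms] unfolding pointed_bisimplicial_def by auto
  have b: "base X 0 0 = pt X"
    using bisimplicialD(2)[OF X] unfolding base_def op_id_def by simp
  have "bisimplicial (fiber X p Y)"
    unfolding bisimplicial_def fiber_simps
    using bisimplicialD[OF X(1)] hom_onD(2)[OF kan_fibD(3)[OF assms]] act_base[OF kan_fibD(2)[OF assms]]
    by auto
  moreover have "p 0 0 (pt X) = base Y 0 0"
    using kan_fib_base[OF assms, of 0 0] b by simp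
  ultimately show ?thesis using X(2) unfolding pointed_bisimplicial_def fiber_simps by simp
qed

text \<open>Lifting over the constant map to the base point keeps the solution in the fiber.\<close>

lemma kan_fiber:
  assumes "kan_fib X p Y"
  shows "kan (fiber X p Y)"
  unfolding kan_def
proof (intro allI impI)
  fix m n u
  let ?S = "pushout_prod (cells (\<delta>\<Delta> m n)) (\<Delta> m n) hook square"
  let ?D = "\<Delta> m n \<otimes> square" and ?F = "fiber X p Y"
  assume u: "hom_on ?D ?S ?F u"
  have uX: "hom_on ?D ?S X u" and uY: "p k l (u k l z) = base Y k l" if "z \<in> ?S k l" for k l z
    using u that unfolding hom_on_def fiber_simps by auto
  have uX: "hom_on ?D ?S X u" using u unfolding hom_on_def fiber_simps by auto
  have v: "bihom ?D Y (\<lambda>k l _. base Y k l)"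
    by (rule hom_on_base[OF kan_fibD(2)[OF assms]])
  have "lifts ?D ?S (cells ?D) X p Y" using kan_fibD(5)[OF assms] unfolding prism_fib_def by blast
  from liftsD[OF this uX v uY] obtain w where w: "bihom ?D X w"
    "\<And>k l z. z \<in> ?S k l \<Longrightarrow> w k l z = u k l z" "\<And>k l z. z \<in> cells ?D k l \<Longrightarrow> p k l (w k l z) = base Y k l"
    by blast
  have "bihom ?D ?F w"
    using w unfolding hom_on_def fiber_simps by auto
  then show "\<exists>w. bihom ?D ?F w \<and> (\<forall>k l. \<forall>z\<in>?S k l. w k l z = u k l z)"
    using w(2) by blast
qed

subsection \<open>Relative lifting problems\<close>

text \<open>Over the hook the data are pulled back from \<open>K\<close>, as befits homotopies,
  which are constant there. \<open>AB\<close> is the gluing condition on the product of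
  \<open>L\<close> with the hook.\<close>

lemma lift_horn:
  fixes K :: "'k bisset"
  assumes p: "prism_fib X p Y" and K: "bisimplicial K" and L: "closed_in K L"
    and A: "bihom K X A"
    and B: "hom_on (K \<otimes> square) (\<lambda>k l. L k l \<times> cells square k l) X B"
    and v: "bihom (K \<otimes> square) Y v"
    and AB: "\<And>k l x j. x \<in> L k l \<Longrightarrow> j \<in> hook k l \<Longrightarrow> B k l (x, j) = A k l x"
    and pA: "\<And>k l x j. x \<in> cells K k l \<Longrightarrow> j \<in> hook k l \<Longrightarrow> p k l (A k l x) = v k l (x, j)"
    and pB: "\<And>k l x j. x \<in> L k l \<Longrightarrow> j \<in> cells square k l \<Longrightarrow> p k l (B k l (x, j)) = v k l (x, j)"
  obtains h where "bihom (K \<otimes> square) X h"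
    "\<And>k l z. z \<in> cells (K \<otimes> square) k l \<Longrightarrow> p k l (h k l z) = v k l z"
    "\<And>k l x j. x \<in> L k l \<Longrightarrow> j \<in> cells square k l \<Longrightarrow> h k l (x, j) = B k l (x, j)"
    "\<And>k l x j. x \<in> cells K k l \<Longrightarrow> j \<in> hook k l \<Longrightarrow> h k l (x, j) = A k l x"
proof -
  let ?S = "pushout_prod L K hook square"
  define u where "u = (\<lambda>k l (x, j). if x \<in> L k l then B k l (x, j) else A k l x)"
  have S: "z \<in> ?S k l \<Longrightarrow> (\<exists>x j. z = (x, j) \<and> x \<in> L k l \<and> j \<in> cells square k l) \<or>
      (\<exists>x j. z = (x, j) \<and> x \<in> cells K k l \<and> x \<notin> L k l \<and> j \<in> hook k l)" for z k l
    unfolding pushout_prod_def by (auto simp: cells_bprod)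
  have u: "hom_on (K \<otimes> square) ?S X u"
  proof (rule hom_onI)
    fix k l z assume "z \<in> ?S k l"
    then show "u k l z \<in> cells X k l"
      using S[of z k l] hom_onD(1)[OF A] hom_onD(1)[OF B] unfolding u_def by auto
  next
    fix m n k l a b z assume ab: "a \<in> ops m k" "b \<in> ops n l" and z: "z \<in> ?S m n"
    from S[OF z] consider x j where "z = (x, j)" "x \<in> L m n" "j \<in> cells square m n"
      | x j where "z = (x, j)" "x \<in> cells K m n" "x \<notin> L m n" "j \<in> hook m n" by blast
    then show "u k l (act (K \<otimes> square) m n a b z) = act X m n a b (u m n z)"
    proof cases
      case 1
      then show ?thesis
        using hom_onD(2)[OF B ab, of "(x, j)"] closed_inD(2)[OF L ab]
        unfolding u_def by (simp add: act_bprod)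
    next
      case 2
      then show ?thesis
        using hom_onD(2)[OF A ab, of x] closed_inD(2)[OF closed_last_horn ab, of j] AB
        unfolding u_def by (simp add: act_bprod)
    qed
  qed
  have uv: "p k l (u k l z) = v k l z" if "z \<in> ?S k l" for k l z
    using S[OF that] pA pB unfolding u_def by auto
  obtain h where h: "bihom (K \<otimes> square) X h"
    "\<And>k l z. z \<in> ?S k l \<Longrightarrow> h k l z = u k l z"
    "\<And>k l z. z \<in> cells (K \<otimes> square) k l \<Longrightarrow> p k l (h k l z) = v k l z"
    using liftsD[OF prism_fib_lifts[OF p K L] u v uv] by blast
  show thesis
  proof (rule that[OF h(1,3)])
    fix k l x j assume "x \<in> L k l" "j \<in> cells square k l"
    then show "h k l (x, j) = B k l (x, j)"
      using h(2)[of "(x, j)" k l] closed_inD(1)[OF L] unfolding u_def pushout_prod_def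
      by (simp add: cells_bprod)
  next
    fix k l x j assume xj: "x \<in> cells K k l" "j \<in> hook k l"
    then have "h k l (x, j) = u k l (x, j)"
      using h(2)[of "(x, j)" k l] last_horn_sub unfolding pushout_prod_def by (auto simp: cells_bprod)
    then show "h k l (x, j) = A k l x" using AB xj unfolding u_def by simp
  qed
qed

definition rel_hom ::
    "'k bisset \<Rightarrow> (nat \<Rightarrow> nat \<Rightarrow> 'k set) \<Rightarrow> 'a pbisset \<Rightarrow> ('k \<times> std, 'a) bimap \<Rightarrow> bool" where
  "rel_hom K L X h \<longleftrightarrow> bihom (K \<otimes> square) X h \<and>
    (\<forall>k l. \<forall>x\<in>L k l. \<forall>j\<in>cells square k l. h k l (x, j) = base X k l)"

lemma rel_homD:
  assumes "rel_hom K L X h"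
  shows "bihom (K \<otimes> square) X h"
    "x \<in> L k l \<Longrightarrow> j \<in> cells square k l \<Longrightarrow> h k l (x, j) = base X k l"
  using assms unfolding rel_hom_def by blast+

lemma lift_horn_rel:
  fixes K :: "'k bisset"
  assumes p: "kan_fib X p Y" and K: "bisimplicial K" and L: "closed_in K L"
    and A: "bihom K X A" and AL: "\<And>k l x. x \<in> L k l \<Longrightarrow> A k l x = base X k l"
    and v: "rel_hom K L Y v"
    and pA: "\<And>k l x j. x \<in> cells K k l \<Longrightarrow> j \<in> hook k l \<Longrightarrow> p k l (A k l x) = v k l (x, j)"
  obtains h where "rel_hom K L X h"
    "\<And>k l z. z \<in> cells (K \<otimes> square) k l \<Longrightarrow> p k l (h k l z) = v k l z"
    "\<And>k l x j. x \<in> cells K k l \<Longrightarrow> j \<in> hook k l \<Longrightarrow> h k l (x, j) = A k l x"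
proof -
  have B: "hom_on (K \<otimes> square) (\<lambda>k l. L k l \<times> cells square k l) X (\<lambda>k l _. base X k l)"
    by (rule hom_on_base[OF kan_fibD(1)[OF p]])
  have pB: "p k l (base X k l) = v k l (x, j)" if "x \<in> L k l" "j \<in> cells square k l" for k l x j
    using rel_homD(2)[OF v that] kan_fib_base[OF p] by simp
  obtain h where "bihom (K \<otimes> square) X h"
    "\<And>k l z. z \<in> cells (K \<otimes> square) k l \<Longrightarrow> p k l (h k l z) = v k l z"
    "\<And>k l x j. x \<in> L k l \<Longrightarrow> j \<in> cells square k l \<Longrightarrow> h k l (x, j) = base X k l"
    "\<And>k l x j. x \<in> cells K k l \<Longrightarrow> j \<in> hook k l \<Longrightarrow> h k l (x, j) = A k l x"
    using lift_horn[OF kan_fibD(5)[OF p] K L A B rel_homD(1)[OF v] AL[symmetric] pA pB] by blast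
  then show thesis using that[of h] by (simp add: rel_hom_def)
qed

text \<open>Lifting against \<open>L \<otimes> square \<otimes> square \<squnion> K \<otimes> \<delta>\<^sub>A\<Delta> 1 1 \<otimes> square \<squnion> K \<otimes> square \<otimes> \<Lambda> 1 1\<close>: the data
  are \<open>A\<close> on the last piece, and \<open>B\<close> and \<open>C\<close> over the two components of \<open>\<delta>\<^sub>A\<Delta> 1 1\<close>.\<close>

lemma lift_square:
  fixes K :: "'k bisset"
  assumes p: "kan_fib X p Y" and K: "bisimplicial K" and L: "closed_in K L"
    and A: "rel_hom K L X A" and B: "rel_hom K L X B" and C: "rel_hom K L X C"
    and v: "bihom ((K \<otimes> square) \<otimes> square) Y v"
    and vL: "\<And>k l x s t. x \<in> L k l \<Longrightarrow> s \<in> cells square k l \<Longrightarrow> t \<in> cells square k l \<Longrightarrow>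
      v k l ((x, s), t) = base Y k l"
    and AB: "\<And>k l x s t. x \<in> cells K k l \<Longrightarrow> s \<in> hook k l \<Longrightarrow> t \<in> hook k l \<Longrightarrow>
      B k l (x, t) = A k l (x, s)"
    and AC: "\<And>k l x t. x \<in> cells K k l \<Longrightarrow> t \<in> hook k l \<Longrightarrow> C k l (x, t) = A k l (x, origin k l)"
    and pA: "\<And>k l x s t. x \<in> cells K k l \<Longrightarrow> s \<in> cells square k l \<Longrightarrow> t \<in> hook k l \<Longrightarrow>
      p k l (A k l (x, s)) = v k l ((x, s), t)"
    and pB: "\<And>k l x s t. x \<in> cells K k l \<Longrightarrow> s \<in> hook k l \<Longrightarrow> t \<in> cells square k l \<Longrightarrow>
      p k l (B k l (x, t)) = v k l ((x, s), t)"
    and pC: "\<And>k l x t. x \<in> cells K k l \<Longrightarrow> t \<in> cells square k l \<Longrightarrow>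
      p k l (C k l (x, t)) = v k l ((x, origin k l), t)"
  obtains H where "bihom ((K \<otimes> square) \<otimes> square) X H"
    "\<And>k l z. z \<in> cells ((K \<otimes> square) \<otimes> square) k l \<Longrightarrow> p k l (H k l z) = v k l z"
    "\<And>k l x s t. x \<in> L k l \<Longrightarrow> s \<in> cells square k l \<Longrightarrow> t \<in> cells square k l \<Longrightarrow>
      H k l ((x, s), t) = base X k l"
    "\<And>k l x s t. x \<in> cells K k l \<Longrightarrow> s \<in> cells square k l \<Longrightarrow> t \<in> hook k l \<Longrightarrow>
      H k l ((x, s), t) = A k l (x, s)"
    "\<And>k l x s t. x \<in> cells K k l \<Longrightarrow> s \<in> hook k l \<Longrightarrow> t \<in> cells square k l \<Longrightarrow>
      H k l ((x, s), t) = B k l (x, t)"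
    "\<And>k l x t. x \<in> cells K k l \<Longrightarrow> t \<in> cells square k l \<Longrightarrow> H k l ((x, origin k l), t) = C k l (x, t)"
proof -
  \<comment> \<open>\<open>lift_horn\<close> is applied with \<open>K \<otimes> square\<close> in
    the role of \<open>K\<close>: the first square is a parameter, the second carries the horn, and
    over \<open>?M\<close> the filler is prescribed on the whole second square.\<close>
  let ?M = "pushout_prod L K hook_pt square"
  let ?K = "K \<otimes> square"
  have X: "pointed_bisimplicial X" using kan_fibD(1)[OF p] .
  have K': "bisimplicial ?K" by (rule bisimplicial_bprod[OF K bisimplicial_Delta])
  have M: "closed_in ?K ?M"
    by (rule closed_pushout_prod[OF K bisimplicial_Delta L closed_a_boundary])
  \<comment> \<open>On \<open>?M\<close> outside \<open>L\<close> the last two cases concern the two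
    disjoint components, so \<open>B\<close> and \<open>C\<close> never have to be compared.\<close>
  define E where "E = (\<lambda>k l ((x, s), t). if x \<in> L k l then base X k l
    else if s \<in> hook k l then B k l (x, t) else C k l (x, t))"
  note BL = rel_homD(2)[OF B] and CL = rel_homD(2)[OF C] and AL = rel_homD(2)[OF A]
  have E1: "E k l ((x, s), t) = base X k l" if "x \<in> L k l" for k l x s t
    using that unfolding E_def by simp
  have E2: "E k l ((x, s), t) = B k l (x, t)" if "s \<in> hook k l" "t \<in> cells square k l" for k l x s t
    using that BL unfolding E_def by simp
  have E3: "E k l ((x, origin k l), t) = C k l (x, t)" if "t \<in> cells square k l" for k l x t
    using that CL origin_not_last_horn unfolding E_def by simp
  have Mc: "z \<in> ?M k l \<Longrightarrow> (\<exists>x s. z = (x, s) \<and> x \<in> L k l \<and> s \<in> cells square k l) \<or>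
      (\<exists>x s. z = (x, s) \<and> x \<in> cells K k l \<and> s \<in> hook k l) \<or>
      (\<exists>x. z = (x, origin k l) \<and> x \<in> cells K k l)" for z k l
    unfolding pushout_prod_def a_boundary_cells by (auto simp: cells_bprod)
  have E: "hom_on (?K \<otimes> square) (\<lambda>k l. ?M k l \<times> cells square k l) X E"
  proof (rule hom_onI)
    fix k l z assume "z \<in> ?M k l \<times> cells square k l"
    then show "E k l z \<in> cells X k l"
      using Mc[of "fst z" k l]
      by (auto simp: E1 E2 E3 cells_bprod base_in_cells[OF X] hom_onD(1)[OF rel_homD(1)[OF B]]
          hom_onD(1)[OF rel_homD(1)[OF C]])
  next
    fix m n k l a b z assume ab: "a \<in> ops m k" "b \<in> ops n l" and z: "z \<in> ?M m n \<times> cells square m n"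
    obtain y t where zy: "z = (y, t)" and y: "y \<in> ?M m n" and t: "t \<in> cells square m n" using z by auto
    have t': "act square m n a b t \<in> cells square k l"
      using bisimplicialD(1)[OF bisimplicial_Delta ab t] .
    from Mc[OF y] consider x s where "y = (x, s)" "x \<in> L m n" "s \<in> cells square m n"
      | x s where "y = (x, s)" "x \<in> cells K m n" "s \<in> hook m n"
      | x where "y = (x, origin m n)" "x \<in> cells K m n" by blast
    then show "E k l (act (?K \<otimes> square) m n a b z) = act X m n a b (E m n z)"
    proof cases
      case 1
      then show ?thesis using closed_inD(2)[OF L ab] act_base[OF X ab] unfolding zy by (simp add: act_bprod E1)
    next
      case 2
      then show ?thesis
        using closed_inD(2)[OF closed_last_horn ab] t t' hom_onD(2)[OF rel_homD(1)[OF B] ab, of "(x, t)"]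
        unfolding zy by (simp add: act_bprod E2 cells_bprod)
    next
      case 3
      then show ?thesis
        using t t' hom_onD(2)[OF rel_homD(1)[OF C] ab, of "(x, t)"]
        unfolding zy by (simp add: act_bprod E3 cells_bprod act_origin[OF ab])
    qed
  qed
  have EA: "E k l (y, t) = A k l y" if y: "y \<in> ?M k l" and t: "t \<in> hook k l" for k l y t
    using Mc[OF y] t subsetD[OF last_horn_sub t] by (auto simp: E1 E2 E3 AL AC intro: AB)
  have pE: "p k l (E k l (y, t)) = v k l (y, t)" if y: "y \<in> ?M k l" and t: "t \<in> cells square k l" for k l y t
    using Mc[OF y] t by (auto simp: E1 E2 E3 pB pC vL kan_fib_base[OF p])
  have pA': "p k l (A k l y) = v k l (y, t)" if "y \<in> cells ?K k l" "t \<in> hook k l" for k l y t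
    using that by (auto simp: cells_bprod pA)
  obtain H where H: "bihom (?K \<otimes> square) X H"
    "\<And>k l z. z \<in> cells (?K \<otimes> square) k l \<Longrightarrow> p k l (H k l z) = v k l z"
    "\<And>k l y t. y \<in> ?M k l \<Longrightarrow> t \<in> cells square k l \<Longrightarrow> H k l (y, t) = E k l (y, t)"
    "\<And>k l y t. y \<in> cells ?K k l \<Longrightarrow> t \<in> hook k l \<Longrightarrow> H k l (y, t) = A k l y"
    using lift_horn[OF kan_fibD(5)[OF p] K' M rel_homD(1)[OF A] E v EA pA' pE] by blast
  show thesis
  proof (rule that[OF H(1,2)])
    fix k l x s t assume "x \<in> L k l" "s \<in> cells square k l" "t \<in> cells square k l"
    moreover from this have "(x, s) \<in> ?M k l"
      using closed_inD(1)[OF L] unfolding pushout_prod_def by (simp add: cells_bprod)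
    ultimately show "H k l ((x, s), t) = base X k l" using H(3) E1 by simp
  next
    fix k l x s t assume "x \<in> cells K k l" "s \<in> cells square k l" "t \<in> hook k l"
    then show "H k l ((x, s), t) = A k l (x, s)" using H(4) by (simp add: cells_bprod)
  next
    fix k l x s t assume "x \<in> cells K k l" "s \<in> hook k l" "t \<in> cells square k l"
    moreover from this have "(x, s) \<in> ?M k l"
      using last_horn_sub[of k l] unfolding pushout_prod_def a_boundary_cells by (auto simp: cells_bprod)
    ultimately show "H k l ((x, s), t) = B k l (x, t)" using H(3) E2 by simp
  next
    fix k l x t assume "x \<in> cells K k l" "t \<in> cells square k l"
    moreover from this have "(x, origin k l) \<in> ?M k l"
      using origin_cells unfolding pushout_prod_def a_boundary_cells by (auto simp: cells_bprod)
    ultimately show "H k l ((x, origin k l), t) = C k l (x, t)" using H(3) E3 by simp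
  qed
qed

subsection \<open>Homotopy\<close>

lemma act_Hom:
  "act (Hom K X) m n a b f k l =
     restrict (\<lambda>z. f k l (fst z, (a \<cdot> fst (snd z), b \<cdot> snd (snd z))))
       (cells (K \<otimes> \<Delta> (length a - 1) (length b - 1)) k l)"
  by (simp add: Hom_def case_prod_unfold)

lemma length_op_id [simp]: "length (op_id m) = Suc m"
  by (simp add: op_id_def)

lemma nth_op_id [simp]: "t \<le> m \<Longrightarrow> op_id m ! t = t"
  by (simp add: op_id_def nth_append del: upt_Suc)

lemma op_comp_replicate: "a \<cdot> replicate j i = replicate j (a ! i)"
  by (simp add: op_comp_def)

lemma restrict_eq_iff: "restrict f A = restrict g A \<longleftrightarrow> (\<forall>x\<in>A. f x = g x)"
  by (metis restrict_apply' restrict_ext)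

lemma cells_point_simplex: "cells (\<Delta> 0 0) k l = {origin k l}"
  unfolding cells_Delta origin_def by (auto simp: ops_0)

lemma corner_iff:
  "corner K X h = vertex K \<beta> \<longleftrightarrow> (\<forall>k l. \<forall>x\<in>cells K k l. h k l (x, origin k l) = \<beta> k l x)"
proof -
  have "corner K X h k l = restrict (\<lambda>z. h k l (fst z, origin k l)) (cells (K \<otimes> \<Delta> 0 0) k l)" for k l
    unfolding corner_def hface_def vface_def act_Hom coface_1
    by (rule ext) (auto simp: restrict_def cells_bprod cells_Delta origin_def op_comp_replicate ops_0
        op_id_left replicate_ops op_comp_ops coface_1 One_nat_def simp del: replicate_Suc)
  then show ?thesis
    unfolding vertex_def fun_eq_iff[of "corner K X h"] fun_eq_iff[of "corner K X h _"]
    by (simp add: restrict_eq_iff cells_bprod cells_point_simplex)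
qed

text \<open>\<open>coface 1 0\<close> picks the vertex \<open>1\<close>, so the two face equations
  prescribe \<open>h\<close> on the two edges that make up the hook.\<close>

lemma is_homotopy_iff:
  assumes h: "h \<in> bimaps (K \<otimes> square) X"
  shows "is_homotopy K X h \<alpha> \<beta> \<longleftrightarrow>
    (\<forall>k l. \<forall>x\<in>cells K k l. (\<forall>j\<in>hook k l. h k l (x, j) = \<alpha> k l x) \<and>
       h k l (x, origin k l) = \<beta> k l x)"
proof -
  have 1: "hface (Hom K X) 1 1 0 h k l = restrict (\<lambda>z. h k l (fst z, (replicate (Suc k) 1, snd (snd z))))
      (cells (K \<otimes> \<Delta> 0 1) k l)" for k l
    unfolding hface_def act_Hom coface_1
    by (rule ext) (auto simp: restrict_def cells_bprod cells_Delta ops_0 op_comp_replicate op_id_left coface_1 One_nat_def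
        simp del: replicate_Suc)
  have 2: "vface (Hom K X) 1 1 0 h k l = restrict (\<lambda>z. h k l (fst z, (fst (snd z), replicate (Suc l) 1)))
      (cells (K \<otimes> \<Delta> 1 0) k l)" for k l
    unfolding vface_def act_Hom coface_1
    by (rule ext) (auto simp: restrict_def cells_bprod cells_Delta ops_0 op_comp_replicate op_id_left coface_1 One_nat_def
        simp del: replicate_Suc)
  have c: "codegen 0 0 = replicate (Suc (Suc 0)) 0" by (simp add: codegen_0_0)
  have 3: "vdegen (Hom K X) 0 0 0 (vertex K \<alpha>) k l = restrict (\<lambda>z. \<alpha> k l (fst z)) (cells (K \<otimes> \<Delta> 0 1) k l)" for k l
    unfolding vdegen_def act_Hom c vertex_def
    by (rule ext) (auto simp: restrict_def cells_bprod cells_Delta ops_0 op_id_left replicate_op_comp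
        replicate_ops One_nat_def simp del: replicate_Suc)
  have 4: "hdegen (Hom K X) 0 0 0 (vertex K \<alpha>) k l = restrict (\<lambda>z. \<alpha> k l (fst z)) (cells (K \<otimes> \<Delta> 1 0) k l)" for k l
    unfolding hdegen_def act_Hom c vertex_def
    by (rule ext) (auto simp: restrict_def cells_bprod cells_Delta ops_0 op_id_left replicate_op_comp
        replicate_ops One_nat_def simp del: replicate_Suc)
  have r: "replicate (Suc k) 1 \<in> ops 1 k" for k by (rule replicate_ops) simp
  have e1: "hface (Hom K X) 1 1 0 h = vdegen (Hom K X) 0 0 0 (vertex K \<alpha>) \<longleftrightarrow>
      (\<forall>k l. \<forall>x\<in>cells K k l. \<forall>d\<in>ops 1 l. h k l (x, (replicate (Suc k) 1, d)) = \<alpha> k l x)"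
    unfolding fun_eq_iff[of "hface _ _ _ _ _"] fun_eq_iff[of "hface _ _ _ _ _ _"] 1 3 restrict_eq_iff
    by (auto simp: cells_bprod cells_Delta ops_0 simp del: replicate_Suc)
  have e2: "vface (Hom K X) 1 1 0 h = hdegen (Hom K X) 0 0 0 (vertex K \<alpha>) \<longleftrightarrow>
      (\<forall>k l. \<forall>x\<in>cells K k l. \<forall>c\<in>ops 1 k. h k l (x, (c, replicate (Suc l) 1)) = \<alpha> k l x)"
    unfolding fun_eq_iff[of "vface _ _ _ _ _"] fun_eq_iff[of "vface _ _ _ _ _ _"] 2 4 restrict_eq_iff
    by (auto simp: cells_bprod cells_Delta ops_0 simp del: replicate_Suc)
  have "hook k l = Pair (replicate (Suc k) 1) ` ops 1 l \<union> (\<lambda>c. (c, replicate (Suc l) 1)) ` ops 1 k" for k l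
    unfolding last_horn_cells using r ops_1_iff(1) by (auto simp del: replicate_Suc)
  then have ball: "(\<forall>j\<in>hook k l. P j) \<longleftrightarrow> (\<forall>d\<in>ops 1 l. P (replicate (Suc k) 1, d)) \<and>
      (\<forall>c\<in>ops 1 k. P (c, replicate (Suc l) 1))" for P k l
    by (simp add: ball_Un)
  show ?thesis
    unfolding is_homotopy_def corner_iff e1 e2 ball using h by auto
qed

lemma rel_maps_iff:
  "\<alpha> \<in> rel_maps K L X \<longleftrightarrow> \<alpha> \<in> bimaps K X \<and> (\<forall>k l. \<forall>x\<in>cells L k l. \<alpha> k l x = base X k l)"
  unfolding rel_maps_def const_on_def by blast

lemma rel_mapsD:
  assumes "\<alpha> \<in> rel_maps K L X"
  shows "bihom K X \<alpha>" "x \<in> cells L k l \<Longrightarrow> \<alpha> k l x = base X k l"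
  using assms unfolding rel_maps_iff bimaps_iff by blast+

lemma homotopy_relI:
  assumes K: "bisimplicial K" and L: "closed_in K (cells L)"
    and \<alpha>: "\<alpha> \<in> rel_maps K L X" and \<beta>: "\<beta> \<in> rel_maps K L X" and h: "rel_hom K (cells L) X h"
    and hor: "\<And>k l x j. x \<in> cells K k l \<Longrightarrow> j \<in> hook k l \<Longrightarrow> h k l (x, j) = \<alpha> k l x"
    and ori: "\<And>k l x. x \<in> cells K k l \<Longrightarrow> h k l (x, origin k l) = \<beta> k l x"
  shows "(\<alpha>, \<beta>) \<in> homotopy_rel K L X"
proof -
  let ?h = "\<lambda>m n. restrict (h m n) (cells (K \<otimes> square) m n)"
  have h': "?h \<in> bimaps (K \<otimes> square) X"
    by (rule restrict_bimaps[OF bisimplicial_bprod[OF K bisimplicial_Delta] rel_homD(1)[OF h]])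
  have "is_homotopy K X ?h \<alpha> \<beta>"
    unfolding is_homotopy_iff[OF h'] using last_horn_sub
    by (auto simp: cells_bprod hor ori origin_cells)
  moreover have "const_on (L \<otimes> square) X ?h"
    unfolding const_on_def using rel_homD(2)[OF h] closed_inD(1)[OF L] by (auto simp: cells_bprod)
  ultimately show ?thesis using \<alpha> \<beta> unfolding homotopy_rel_def by blast
qed

lemma homotopy_relD:
  assumes "(\<alpha>, \<beta>) \<in> homotopy_rel K L X"
  obtains h where "\<alpha> \<in> rel_maps K L X" "\<beta> \<in> rel_maps K L X" "rel_hom K (cells L) X h"
    "\<And>k l x j. x \<in> cells K k l \<Longrightarrow> j \<in> hook k l \<Longrightarrow> h k l (x, j) = \<alpha> k l x"
    "\<And>k l x. x \<in> cells K k l \<Longrightarrow> h k l (x, origin k l) = \<beta> k l x"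
proof -
  obtain h where h: "\<alpha> \<in> rel_maps K L X" "\<beta> \<in> rel_maps K L X"
    "is_homotopy K X h \<alpha> \<beta>" "const_on (L \<otimes> square) X h"
    using assms unfolding homotopy_rel_def by blast
  have b: "h \<in> bimaps (K \<otimes> square) X" using h(3) unfolding is_homotopy_def by blast
  have "rel_hom K (cells L) X h"
    using bimaps_hom_on[OF b] h(4) unfolding rel_hom_def const_on_def by (simp add: cells_bprod)
  then show thesis using that[OF h(1,2)] h(3) unfolding is_homotopy_iff[OF b] by blast
qed

lemma rel_hom_fst:
  assumes "\<alpha> \<in> rel_maps K L X"
  shows "rel_hom K (cells L) X (\<lambda>k l z. \<alpha> k l (fst z))"
  unfolding rel_hom_def using rel_mapsD[OF assms]
  by (auto intro!: hom_onI simp: cells_bprod act_bprod hom_onD)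

lemma homotopy_refl:
  assumes "bisimplicial K" "closed_in K (cells L)" "\<alpha> \<in> rel_maps K L X"
  shows "(\<alpha>, \<alpha>) \<in> homotopy_rel K L X"
  by (rule homotopy_relI[OF assms(1,2,3,3) rel_hom_fst[OF assms(3)]]) simp_all

lemma rel_hom_origin:
  assumes H: "bihom ((K \<otimes> square) \<otimes> square) X H"
    and HL: "\<And>k l x s t. x \<in> L k l \<Longrightarrow> s \<in> cells square k l \<Longrightarrow> t \<in> cells square k l \<Longrightarrow>
      H k l ((x, s), t) = base X k l"
  shows "rel_hom K L X (\<lambda>k l z. H k l (z, origin k l))"
  unfolding rel_hom_def
proof (intro conjI allI ballI hom_onI)
  fix m n k l a b z assume ab: "a \<in> ops m k" "b \<in> ops n l" and z: "z \<in> cells (K \<otimes> square) m n"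
  then show "H k l (act (K \<otimes> square) m n a b z, origin k l) = act X m n a b (H m n (z, origin m n))"
    using hom_onD(2)[OF H ab, of "(z, origin m n)"]
    by (simp add: cells_bprod act_bprod act_origin[OF ab] origin_cells)
qed (simp_all add: HL origin_cells hom_onD(1)[OF H] cells_bprod)

text \<open>Two homotopies starting at \<open>\<alpha>\<close>, placed over the two components of \<open>\<delta>\<^sub>A\<Delta> 1 1\<close>, are joined by a
  filler that is \<open>\<alpha>\<close> on the horn; its corner is the homotopy from \<open>\<beta>\<close> to \<open>\<gamma>\<close>.\<close>

lemma homotopy_euclid:
  fixes K :: "'k bisset"
  assumes K: "bisimplicial K" and L: "closed_in K (cells L)" and X: "pointed_bisimplicial X" "kan X"
    and \<beta>: "(\<alpha>, \<beta>) \<in> homotopy_rel K L X" and \<gamma>: "(\<alpha>, \<gamma>) \<in> homotopy_rel K L X"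
  shows "(\<beta>, \<gamma>) \<in> homotopy_rel K L X"
proof -
  obtain h where h: "\<alpha> \<in> rel_maps K L X" "\<beta> \<in> rel_maps K L X" "rel_hom K (cells L) X h"
    "\<And>k l x j. x \<in> cells K k l \<Longrightarrow> j \<in> hook k l \<Longrightarrow> h k l (x, j) = \<alpha> k l x"
    "\<And>k l x. x \<in> cells K k l \<Longrightarrow> h k l (x, origin k l) = \<beta> k l x" using homotopy_relD[OF \<beta>] by metis
  obtain g where g: "\<gamma> \<in> rel_maps K L X" "rel_hom K (cells L) X g"
    "\<And>k l x j. x \<in> cells K k l \<Longrightarrow> j \<in> hook k l \<Longrightarrow> g k l (x, j) = \<alpha> k l x"
    "\<And>k l x. x \<in> cells K k l \<Longrightarrow> g k l (x, origin k l) = \<gamma> k l x" using homotopy_relD[OF \<gamma>] by metis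
  \<comment> \<open>An absolute filling problem in a Kan object is a lifting problem over a
    point.\<close>
  have fib: "kan_fib X (\<lambda>_ _ _. ()) (point ())" by (rule kan_fib_point[OF X])
  have v: "bihom ((K \<otimes> square) \<otimes> square) (point ()) (\<lambda>_ _ _. ())"
    by (rule hom_onI) (simp_all add: point_def)
  obtain H where H: "bihom ((K \<otimes> square) \<otimes> square) X H"
    and HL: "\<And>k l x s t. x \<in> cells L k l \<Longrightarrow> s \<in> cells square k l \<Longrightarrow> t \<in> cells square k l \<Longrightarrow>
      H k l ((x, s), t) = base X k l"
    and Hs: "\<And>k l x s t. x \<in> cells K k l \<Longrightarrow> s \<in> hook k l \<Longrightarrow> t \<in> cells square k l \<Longrightarrow>
      H k l ((x, s), t) = h k l (x, t)"
    and Ho: "\<And>k l x t. x \<in> cells K k l \<Longrightarrow> t \<in> cells square k l \<Longrightarrow> H k l ((x, origin k l), t) = g k l (x, t)"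
    by (rule lift_square[OF fib K L rel_hom_fst[OF h(1)] h(3) g(2) v]) (simp_all add: h g point_def)
  show ?thesis
    by (rule homotopy_relI[OF K L h(2) g(1) rel_hom_origin[OF H HL]])
      (simp_all add: Hs Ho h g origin_cells)
qed

text \<open>Reflexivity and the Euclidean property give symmetry, and with symmetry the Euclidean
  property becomes transitivity.\<close>

lemma homotopy_equiv:
  fixes K :: "'k bisset"
  assumes K: "bisimplicial K" and L: "closed_in K (cells L)" and X: "pointed_bisimplicial X" "kan X"
  shows "equiv (rel_maps K L X) (homotopy_rel K L X)"
proof (rule equivI)
  have sub: "homotopy_rel K L X \<subseteq> rel_maps K L X \<times> rel_maps K L X"
    unfolding homotopy_rel_def by blast
  then show "homotopy_rel K L X \<subseteq> rel_maps K L X \<times> rel_maps K L X" .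
  show "refl_on (rel_maps K L X) (homotopy_rel K L X)"
    using homotopy_refl[OF K L] by (auto intro: refl_onI)
  show s: "sym (homotopy_rel K L X)"
  proof (rule symI)
    fix \<alpha> \<beta> assume ab: "(\<alpha>, \<beta>) \<in> homotopy_rel K L X"
    then have "(\<alpha>, \<alpha>) \<in> homotopy_rel K L X" using homotopy_refl[OF K L] sub by blast
    then show "(\<beta>, \<alpha>) \<in> homotopy_rel K L X" using homotopy_euclid[OF K L X ab] by blast
  qed
  show "trans (homotopy_rel K L X)"
  proof (rule transI)
    fix \<alpha> \<beta> \<gamma> assume "(\<alpha>, \<beta>) \<in> homotopy_rel K L X" and bc: "(\<beta>, \<gamma>) \<in> homotopy_rel K L X"
    then have "(\<beta>, \<alpha>) \<in> homotopy_rel K L X" using s by (blast dest: symD)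
    then show "(\<alpha>, \<gamma>) \<in> homotopy_rel K L X" using homotopy_euclid[OF K L X _ bc] by blast
  qed
qed

subsection \<open>Loop spaces\<close>

lemma loop_cells:
  "cells (loop X) m n = Fam ` {f \<in> bimaps (square \<otimes> \<Delta> m n) X.
     \<forall>k l. \<forall>v\<in>hook_pt k l. \<forall>c\<in>cells (\<Delta> m n) k l. f k l (v, c) = base X k l}"
proof -
  have b: "base (Hom K X) m n k l = restrict (\<lambda>z. base X k l) (cells (K \<otimes> \<Delta> m n) k l)"
    for K :: "std bisset" and k l
    unfolding base_def[of "Hom K X"] act_Hom
    by (rule ext) (auto simp: Hom_def const_map_def restrict_def cells_bprod cells_Delta replicate_op_comp
        replicate_ops simp del: replicate_Suc)
  have "restriction square (\<delta>\<^sub>A\<Delta> 1 1) X m n f = base (Hom (\<delta>\<^sub>A\<Delta> 1 1) X) m n \<longleftrightarrow>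
     (\<forall>k l. \<forall>v\<in>hook_pt k l. \<forall>c\<in>cells (\<Delta> m n) k l. f k l (v, c) = base X k l)"
    if "f \<in> bimaps (square \<otimes> \<Delta> m n) X" for f
    unfolding fun_eq_iff[of "restriction _ _ _ _ _ _"] fun_eq_iff[of "restriction _ _ _ _ _ _ _"] b
    using that
    by (simp add: restriction_def Hom_def bicomp_def compose_def restrict_eq_iff incl_def cells_bprod)
  then show ?thesis
    unfolding loop_def prelabel_def relabel_def fiber_def bisset.defs pbisset.defs by (auto simp: Hom_def)
qed

lemma inj_Fam: "inj Fam"
  by (rule injI) simp

lemma act_loop:
  "act (loop X) m n a b (Fam f) = Fam (act (Hom square X) m n a b f)"
  unfolding loop_def prelabel_def relabel_def fiber_def bisset.defs pbisset.defs
  by (simp add: inv_f_f[OF inj_Fam])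

lemma pt_loop: "pt (loop X) = Fam (const_map (square \<otimes> \<Delta> 0 0) X)"
  unfolding loop_def prelabel_def relabel_def fiber_def bisset.defs pbisset.defs by (simp add: Hom_def)

lemma base_loop: "base (loop X) m n = Fam (const_map (square \<otimes> \<Delta> m n) X)"
proof -
  have "act (Hom square X) 0 0 (replicate (Suc m) 0) (replicate (Suc n) 0)
      (const_map (square \<otimes> \<Delta> 0 0) X) k l = const_map (square \<otimes> \<Delta> m n) X k l" for k l
    unfolding act_Hom
    by (rule ext) (auto simp: const_map_def restrict_def cells_bprod cells_Delta replicate_op_comp
        replicate_ops simp del: replicate_Suc)
  then show ?thesis unfolding base_def pt_loop act_loop by (simp add: fun_eq_iff)
qed

text \<open>Unlike \<open>adjunct\<close>, \<open>ev\<close> makes sense for maps defined on a subobject only.\<close>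

definition ev :: "('k, 'a univ) bimap \<Rightarrow> ('k \<times> std, 'a univ) bimap" where
  "ev \<alpha> k l z = un_Fam (\<alpha> k l (fst z)) k l (snd z, (op_id k, op_id l))"

text \<open>The inverse of the transposition \<open>ev\<close>: \<open>u\<close> is sent to its
  characteristic map followed by \<open>g\<close>, with the factors in the order used by
  \<open>loop\<close> and cut down to an extensional function.\<close>

definition cur ::
    "('k, 'z) bisset_scheme \<Rightarrow> ('k \<times> std, 'a univ) bimap \<Rightarrow> ('k, 'a univ) bimap" where
  "cur K g k l u = Fam (\<lambda>k' l'. restrict
     (\<lambda>z. g k' l' (act K k l (fst (snd z)) (snd (snd z)) u, fst z)) (cells (square \<otimes> \<Delta> k l) k' l'))"

lemma loop_cellD:
  assumes "x \<in> cells (loop X) m n"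
  shows "x = Fam (un_Fam x)" "un_Fam x \<in> bimaps (square \<otimes> \<Delta> m n) X"
    "v \<in> hook_pt k l \<Longrightarrow> c \<in> ops m k \<Longrightarrow> d \<in> ops n l \<Longrightarrow> un_Fam x k l (v, (c, d)) = base X k l"
  using assms unfolding loop_cells by (auto simp: cells_Delta)

lemma un_Fam_act_loop:
  assumes "x \<in> cells (loop X) m n" "a \<in> ops m k" "b \<in> ops n l"
    "v \<in> cells square k' l'" "c \<in> ops k k'" "d \<in> ops l l'"
  shows "un_Fam (act (loop X) m n a b x) k' l' (v, (c, d)) = un_Fam x k' l' (v, (a \<cdot> c, b \<cdot> d))"
proof -
  have "un_Fam (act (loop X) m n a b x) = act (Hom square X) m n a b (un_Fam x)"
    using act_loop loop_cellD(1)[OF assms(1)] by (metis univ.sel(2))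
  then show ?thesis
    using assms(2-) ops_length[OF assms(2)] ops_length[OF assms(3)]
    by (simp add: act_Hom cells_bprod cells_Delta)
qed

lemma act_un_Fam:
  assumes "x \<in> cells (loop X) m n" "a \<in> ops k k'" "b \<in> ops l l'"
    "v \<in> cells square k l" "c \<in> ops m k" "d \<in> ops n l"
  shows "un_Fam x k' l' (act square k l a b v, (c \<cdot> a, d \<cdot> b)) = act X k l a b (un_Fam x k l (v, (c, d)))"
  using hom_onD(2)[OF bimaps_hom_on[OF loop_cellD(2)[OF assms(1)]] assms(2,3), of "(v, (c, d))"] assms(4-)
  by (simp add: act_bprod cells_bprod cells_Delta act_Delta)

text \<open>An operator of the loop space moves into the simplex coordinate by
  \<open>un_Fam_act_loop\<close>. Since evaluation takes place at the identities, naturality of the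
  family itself (\<open>act_un_Fam\<close>) turns it into an operator of \<open>X\<close>.\<close>

lemma ev_hom:
  assumes "hom_on K S (loop X) \<alpha>"
  shows "hom_on (K \<otimes> square) (\<lambda>k l. S k l \<times> cells square k l) X (ev \<alpha>)"
proof (rule hom_onI)
  fix k l z assume "z \<in> S k l \<times> cells square k l"
  then obtain u v where z: "z = (u, v)" "u \<in> S k l" "v \<in> cells square k l" by auto
  show "ev \<alpha> k l z \<in> cells X k l"
    unfolding ev_def using z
      hom_onD(1)[OF bimaps_hom_on[OF loop_cellD(2)[OF hom_onD(1)[OF assms z(2)]]], of "(v, (op_id k, op_id l))"]
    by (simp add: cells_bprod cells_Delta)
next
  fix k l k' l' a b z assume ab: "a \<in> ops k k'" "b \<in> ops l l'" and "z \<in> S k l \<times> cells square k l"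
  then obtain u v where z: "z = (u, v)" "u \<in> S k l" "v \<in> cells square k l" by auto
  note x = hom_onD(1)[OF assms z(2)]
  have v': "act square k l a b v \<in> cells square k' l'"
    by (rule bisimplicialD(1)[OF bisimplicial_Delta ab z(3)])
  show "ev \<alpha> k' l' (act (K \<otimes> square) k l a b z) = act X k l a b (ev \<alpha> k l z)"
    using un_Fam_act_loop[OF x ab v' op_id_ops op_id_ops] act_un_Fam[OF x ab z(3) op_id_ops op_id_ops]
      hom_onD(2)[OF assms ab z(2)]
    by (simp add: ev_def z(1) act_bprod op_id_left[OF ab(1)] op_id_left[OF ab(2)]
        op_id_right[OF ops_length[OF ab(1)]] op_id_right[OF ops_length[OF ab(2)]])
qed

lemma ev_base:
  assumes "hom_on K S (loop X) \<alpha>" "u \<in> S k l" "v \<in> hook_pt k l"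
  shows "ev \<alpha> k l (u, v) = base X k l"
  unfolding ev_def using loop_cellD(3)[OF hom_onD(1)[OF assms(1,2)] assms(3)] by simp

lemma ev_cur:
  assumes "bisimplicial K" "u \<in> cells K k l" "v \<in> cells square k l"
  shows "ev (cur K g) k l (u, v) = g k l (u, v)"
  using assms bisimplicialD(2)[OF assms(1,2)] by (simp add: ev_def cur_def cells_bprod cells_Delta)

text \<open>A Yoneda argument: the value of the family of \<open>u\<close> at \<open>(c, d)\<close>
  is the value, at the identities, of the family of the cell \<open>act K k l c d u\<close>.\<close>

lemma cur_ev:
  assumes "hom_on K S (loop X) \<alpha>" "u \<in> S k l"
  shows "\<alpha> k l u = cur K (ev \<alpha>) k l u"
proof -
  note x = hom_onD(1)[OF assms]
  have "un_Fam (\<alpha> k l u) k' l' = restrict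
     (\<lambda>z. ev \<alpha> k' l' (act K k l (fst (snd z)) (snd (snd z)) u, fst z)) (cells (square \<otimes> \<Delta> k l) k' l')" for k' l'
  proof (rule extensionalityI[where A = "cells (square \<otimes> \<Delta> k l) k' l'"])
    show "un_Fam (\<alpha> k l u) k' l' \<in> extensional (cells (square \<otimes> \<Delta> k l) k' l')"
      using loop_cellD(2)[OF x] unfolding bimaps_iff by blast
    fix z assume z: "z \<in> cells (square \<otimes> \<Delta> k l) k' l'"
    then obtain v c d where zv: "z = (v, (c, d))" and v: "v \<in> cells square k' l'"
      and cd: "c \<in> ops k k'" "d \<in> ops l l'" by (auto simp: cells_bprod cells_Delta)
    show "un_Fam (\<alpha> k l u) k' l' z = restrict
     (\<lambda>z. ev \<alpha> k' l' (act K k l (fst (snd z)) (snd (snd z)) u, fst z)) (cells (square \<otimes> \<Delta> k l) k' l') z"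
      using z un_Fam_act_loop[OF x cd v op_id_ops op_id_ops] hom_onD(2)[OF assms(1) cd assms(2)]
      by (simp add: zv ev_def op_id_right[OF ops_length[OF cd(1)]] op_id_right[OF ops_length[OF cd(2)]])
  qed simp
  then have "un_Fam (\<alpha> k l u) = (\<lambda>k' l'. restrict
     (\<lambda>z. ev \<alpha> k' l' (act K k l (fst (snd z)) (snd (snd z)) u, fst z)) (cells (square \<otimes> \<Delta> k l) k' l'))"
    by (simp add: fun_eq_iff)
  then show ?thesis using loop_cellD(1)[OF x] by (simp add: cur_def)
qed

lemma ev_eqI:
  assumes K: "closed_in K S" and \<alpha>: "hom_on K S (loop X) \<alpha>" and \<beta>: "hom_on K S (loop X) \<beta>"
    and u: "u \<in> S k l"
    and eq: "\<And>k l u v. u \<in> S k l \<Longrightarrow> v \<in> cells square k l \<Longrightarrow> ev \<alpha> k l (u, v) = ev \<beta> k l (u, v)"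
  shows "\<alpha> k l u = \<beta> k l u"
proof -
  have "cur K (ev \<alpha>) k l u = cur K (ev \<beta>) k l u"
    unfolding cur_def using closed_inD(2)[OF K _ _ u]
    by (auto simp: fun_eq_iff restrict_def cells_bprod cells_Delta[of k l] intro!: eq)
  then show ?thesis using cur_ev[OF \<alpha> u] cur_ev[OF \<beta> u] by simp
qed

lemma cur_hom:
  assumes K: "bisimplicial K" and S: "closed_in K S"
    and g: "hom_on (K \<otimes> square) (\<lambda>k l. S k l \<times> cells square k l) X g"
    and gb: "\<And>k l u v. u \<in> S k l \<Longrightarrow> v \<in> hook_pt k l \<Longrightarrow> g k l (u, v) = base X k l"
  shows "hom_on K S (loop X) (cur K g)"
proof (rule hom_onI)
  fix k l u assume u: "u \<in> S k l"
  let ?f = "\<lambda>k' l'. restrict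
     (\<lambda>z. g k' l' (act K k l (fst (snd z)) (snd (snd z)) u, fst z)) (cells (square \<otimes> \<Delta> k l) k' l')"
  have "bihom (square \<otimes> \<Delta> k l) X
     (\<lambda>k' l' z. g k' l' (act K k l (fst (snd z)) (snd (snd z)) u, fst z))"
  proof (rule hom_onI)
    fix k' l' z assume "z \<in> cells (square \<otimes> \<Delta> k l) k' l'"
    then show "g k' l' (act K k l (fst (snd z)) (snd (snd z)) u, fst z) \<in> cells X k' l'"
      using closed_inD(2)[OF S _ _ u] by (auto intro!: hom_onD(1)[OF g] simp: cells_bprod cells_Delta[of k l])
  next
    fix m n k' l' a b z assume ab: "a \<in> ops m k'" "b \<in> ops n l'" and "z \<in> cells (square \<otimes> \<Delta> k l) m n"
    then obtain v c d where z: "z = (v, (c, d))" and v: "v \<in> cells square m n"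
      and cd: "c \<in> ops k m" "d \<in> ops l n" by (auto simp: cells_bprod cells_Delta)
    show "g k' l' (act K k l (fst (snd (act (square \<otimes> \<Delta> k l) m n a b z)))
          (snd (snd (act (square \<otimes> \<Delta> k l) m n a b z))) u, fst (act (square \<otimes> \<Delta> k l) m n a b z)) =
        act X m n a b (g m n (act K k l (fst (snd z)) (snd (snd z)) u, fst z))"
      using hom_onD(2)[OF g ab, of "(act K k l c d u, v)"] v closed_inD(2)[OF S cd u]
        bisimplicialD(3)[OF K cd ab closed_inD(1)[OF S u]]
      by (simp add: z act_bprod act_Delta[of k l])
  qed
  then have f: "?f \<in> bimaps (square \<otimes> \<Delta> k l) X"
    by (rule restrict_bimaps[OF bisimplicial_bprod[OF bisimplicial_Delta bisimplicial_Delta]])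
  moreover have "?f k' l' (v, c) = base X k' l'"
    if "v \<in> hook_pt k' l'" "c \<in> cells (\<Delta> k l) k' l'" for k' l' v c
    using that closed_inD(2)[OF S _ _ u] closed_inD(1)[OF closed_a_boundary that(1)]
    by (auto simp: cells_bprod cells_Delta[of k l] gb)
  ultimately show "cur K g k l u \<in> cells (loop X) k l"
    unfolding cur_def loop_cells by blast
next
  fix k l k' l' a b u assume ab: "a \<in> ops k k'" "b \<in> ops l l'" and u: "u \<in> S k l"
  show "cur K g k' l' (act K k l a b u) = act (loop X) k l a b (cur K g k l u)"
    unfolding cur_def act_loop
    using ops_length[OF ab(1)] ops_length[OF ab(2)]
    by (auto simp: fun_eq_iff act_Hom restrict_def cells_bprod cells_Delta op_comp_ops[OF ab(1)] op_comp_ops[OF ab(2)]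
        bisimplicialD(3)[OF K ab _ _ closed_inD(1)[OF S u]])
qed

section \<open>Loop spaces as pointed bisimplicial sets, and the maps between them\<close>

lemma loop_eqI:
  assumes x: "x \<in> cells (loop X) m n" and y: "y \<in> cells (loop Y) m n"
    and eq: "\<And>k l v c d. v \<in> cells square k l \<Longrightarrow> c \<in> ops m k \<Longrightarrow> d \<in> ops n l \<Longrightarrow>
      un_Fam x k l (v, (c, d)) = un_Fam y k l (v, (c, d))"
  shows "x = y"
proof -
  have "un_Fam x = un_Fam y"
    by (rule bimaps_eqI[OF loop_cellD(2)[OF x] loop_cellD(2)[OF y]])
      (auto simp: cells_bprod cells_Delta[of m n] eq)
  then show ?thesis using loop_cellD(1)[OF x] loop_cellD(1)[OF y] by simp
qed

lemma bisimplicial_loop: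
  assumes X: "pointed_bisimplicial X"
  shows "pointed_bisimplicial (loop X)"
proof -
  have in_loop: "act (loop X) m n a b x \<in> cells (loop X) k l"
    if x: "x \<in> cells (loop X) m n" and ab: "a \<in> ops m k" "b \<in> ops n l" for m n k l a b x
  proof -
    \<comment> \<open>With its factors exchanged, \<open>x\<close> is a map on
      \<open>\<Delta> m n \<otimes> square\<close>, and its image under the operators
      \<open>a\<close>, \<open>b\<close> is the transpose of that map at the cell
      \<open>(a, b)\<close>. Membership then comes from \<open>cur_hom\<close>.\<close>
    let ?g = "\<lambda>k' l' (z :: std \<times> std). un_Fam x k' l' (snd z, fst z)"
    have g: "hom_on (\<Delta> m n \<otimes> square) (\<lambda>k l. cells (\<Delta> m n) k l \<times> cells square k l) X ?g"
    proof (rule hom_onI)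
      fix k l z assume "z \<in> cells (\<Delta> m n) k l \<times> cells square k l"
      then show "?g k l z \<in> cells X k l"
        using hom_onD(1)[OF bimaps_hom_on[OF loop_cellD(2)[OF x]], of "(snd z, fst z)"]
        by (auto simp: cells_bprod)
    next
      fix k l k' l' a b z assume "a \<in> ops k k'" "b \<in> ops l l'" "z \<in> cells (\<Delta> m n) k l \<times> cells square k l"
      then show "?g k' l' (act (\<Delta> m n \<otimes> square) k l a b z) = act X k l a b (?g k l z)"
        using act_un_Fam[OF x] by (auto simp: act_bprod act_Delta[of m n] cells_Delta[of m n])
    qed
    have c: "bihom (\<Delta> m n) (loop X) (cur (\<Delta> m n) ?g)"
      by (rule cur_hom[OF bisimplicial_Delta closed_in_cells[OF bisimplicial_Delta] g])
        (auto simp: loop_cellD(3)[OF x] cells_Delta)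
    have "act (Hom square X) m n a b (un_Fam x) = un_Fam (cur (\<Delta> m n) ?g k l (a, b))"
      using ops_length[OF ab(1)] ops_length[OF ab(2)]
      by (auto simp: fun_eq_iff cur_def act_Hom act_Delta)
    moreover have "act (loop X) m n a b x = Fam (act (Hom square X) m n a b (un_Fam x))"
      using act_loop[of X m n a b "un_Fam x"] loop_cellD(1)[OF x] by simp
    ultimately have "act (loop X) m n a b x = cur (\<Delta> m n) ?g k l (a, b)"
      by (simp add: cur_def)
    then show ?thesis using hom_onD(1)[OF c, of "(a, b)" k l] ab by (simp add: cells_Delta)
  qed
  have "bisimplicial (loop X)" unfolding bisimplicial_def
  proof (intro conjI allI ballI)
    fix m n x assume x: "x \<in> cells (loop X) m n"
    show "act (loop X) m n (op_id m) (op_id n) x = x"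
      by (rule loop_eqI[OF in_loop[OF x op_id_ops op_id_ops] x])
        (simp add: un_Fam_act_loop[OF x op_id_ops op_id_ops] op_id_left)
  next
    fix m n k l k' l' a b c d x
    assume ab: "a \<in> ops m k" "b \<in> ops n l" and cd: "c \<in> ops k k'" "d \<in> ops l l'"
      and x: "x \<in> cells (loop X) m n"
    have o: "a \<cdot> c \<in> ops m k'" "b \<cdot> d \<in> ops n l'" using ab cd by (auto intro: op_comp_ops)
    show "act (loop X) k l c d (act (loop X) m n a b x) = act (loop X) m n (a \<cdot> c) (b \<cdot> d) x"
      by (rule loop_eqI[OF in_loop[OF in_loop[OF x ab] cd] in_loop[OF x o]])
        (simp add: un_Fam_act_loop[OF in_loop[OF x ab] cd] un_Fam_act_loop[OF x ab]
          un_Fam_act_loop[OF x o] op_comp_ops[OF cd(1)] op_comp_ops[OF cd(2)]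
          op_comp_assoc[OF cd(1)] op_comp_assoc[OF cd(2)])
  qed (rule in_loop)
  moreover have "pt (loop X) \<in> cells (loop X) 0 0"
  proof -
    have "const_map (square \<otimes> \<Delta> 0 0) X \<in> bimaps (square \<otimes> \<Delta> 0 0) X"
      unfolding const_map_def
      by (rule restrict_bimaps[OF bisimplicial_bprod[OF bisimplicial_Delta bisimplicial_Delta] hom_on_base[OF X]])
    then show ?thesis
      unfolding pt_loop loop_cells const_map_def using closed_inD(1)[OF closed_a_boundary]
      by (auto simp: cells_bprod)
  qed
  ultimately show ?thesis unfolding pointed_bisimplicial_def by blast
qed

lemma un_Fam_loop_map:
  assumes "x \<in> cells (loop X) m n" "v \<in> cells square k l" "c \<in> ops m k" "d \<in> ops n l"
  shows "un_Fam (loop_map X p m n x) k l (v, (c, d)) = p k l (un_Fam x k l (v, (c, d)))"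
  using assms by (simp add: loop_map_def bicomp_def compose_def cells_bprod cells_Delta)

lemma ev_loop_map:
  assumes "hom_on K S (loop X) \<alpha>" "u \<in> S k l" "v \<in> cells square k l"
  shows "ev (\<lambda>k l x. loop_map X p k l (\<alpha> k l x)) k l (u, v) = p k l (ev \<alpha> k l (u, v))"
  using un_Fam_loop_map[OF hom_onD(1)[OF assms(1,2)] assms(3) op_id_ops op_id_ops] by (simp add: ev_def)

lemma loop_cellI:
  assumes "f \<in> bimaps (square \<otimes> \<Delta> m n) X"
    "\<And>k l v c d. v \<in> hook_pt k l \<Longrightarrow> c \<in> ops m k \<Longrightarrow> d \<in> ops n l \<Longrightarrow> f k l (v, (c, d)) = base X k l"
  shows "Fam f \<in> cells (loop X) m n"
  using assms unfolding loop_cells by (auto simp: cells_Delta)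

lemma loop_map_hom:
  assumes X: "pointed_bisimplicial X" and Y: "pointed_bisimplicial Y"
    and p: "bihom X Y p" and pb: "\<And>m n. p m n (base X m n) = base Y m n"
  shows "bihom (loop X) (loop Y) (loop_map X p)"
proof -
  have in_loop: "loop_map X p m n x \<in> cells (loop Y) m n" if x: "x \<in> cells (loop X) m n" for m n x
  proof -
    have "bihom (square \<otimes> \<Delta> m n) Y (\<lambda>k l z. p k l (un_Fam x k l z))"
      by (rule hom_on_comp[OF bimaps_hom_on[OF loop_cellD(2)[OF x]] p])
        (rule hom_onD(1)[OF bimaps_hom_on[OF loop_cellD(2)[OF x]]])
    then have "bicomp (square \<otimes> \<Delta> m n) p (un_Fam x) \<in> bimaps (square \<otimes> \<Delta> m n) Y"
      unfolding bicomp_def compose_def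
      by (rule restrict_bimaps[OF bisimplicial_bprod[OF bisimplicial_Delta bisimplicial_Delta]])
    moreover have "bicomp (square \<otimes> \<Delta> m n) p (un_Fam x) k l (v, (c, d)) = base Y k l"
      if "v \<in> hook_pt k l" "c \<in> ops m k" "d \<in> ops n l" for k l v c d
      using loop_cellD(3)[OF x that] that closed_inD(1)[OF closed_a_boundary that(1)]
      by (simp add: bicomp_def compose_def cells_bprod cells_Delta[of m n] pb)
    ultimately have "Fam (bicomp (square \<otimes> \<Delta> m n) p (un_Fam x)) \<in> cells (loop Y) m n"
      by (rule loop_cellI)
    then show ?thesis using x by (simp add: loop_map_def)
  qed
  note bX = bisimplicial_loop[OF X, unfolded pointed_bisimplicial_def, THEN conjunct1]
  note bY = bisimplicial_loop[OF Y, unfolded pointed_bisimplicial_def, THEN conjunct1]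
  show ?thesis
  proof (rule hom_onI)
    fix m n k l a b x assume ab: "a \<in> ops m k" "b \<in> ops n l" and x: "x \<in> cells (loop X) m n"
    note x' = bisimplicialD(1)[OF bX ab x]
    show "loop_map X p k l (act (loop X) m n a b x) = act (loop Y) m n a b (loop_map X p m n x)"
      by (rule loop_eqI[OF in_loop[OF x'] bisimplicialD(1)[OF bY ab in_loop[OF x]]])
        (simp add: un_Fam_loop_map[OF x'] un_Fam_loop_map[OF x] un_Fam_act_loop[OF x ab]
          un_Fam_act_loop[OF in_loop[OF x] ab] op_comp_ops[OF ab(1)] op_comp_ops[OF ab(2)])
  qed (rule in_loop)
qed

text \<open>Transposition adds a second square to the lifting problem. Exchanging the two squares
  makes the loop coordinate part of the parameter space and leaves the hook in the last factor,
  where \<open>prism_fib_lifts\<close> applies.\<close>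

lemma prism_fib_loop:
  assumes X: "pointed_bisimplicial X" and Y: "pointed_bisimplicial Y"
    and p: "bihom X Y p" and pb: "\<And>m n. p m n (base X m n) = base Y m n"
    and fib: "prism_fib X p Y"
  shows "prism_fib (loop X) (loop_map X p) (loop Y)"
  unfolding prism_fib_def
proof (intro allI liftsI)
  fix m n u v
  let ?K = "\<Delta> m n" and ?J = "square :: std bisset"
  let ?S = "pushout_prod (cells (\<delta>\<Delta> m n)) ?K hook ?J"
  assume u: "hom_on (?K \<otimes> ?J) ?S (loop X) u" and v: "bihom (?K \<otimes> ?J) (loop Y) v"
    and uv: "\<And>k l x. x \<in> ?S k l \<Longrightarrow> loop_map X p k l (u k l x) = v k l x"
  let ?K' = "?K \<otimes> ?J"
  let ?L' = "pushout_prod (cells (\<delta>\<Delta> m n)) ?K hook_pt ?J"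
  let ?S' = "pushout_prod ?L' ?K' hook ?J"
  have K: "bisimplicial ?K" and J: "bisimplicial ?J" by (rule bisimplicial_Delta)+
  have KJ: "bisimplicial (?K \<otimes> ?J)" by (rule bisimplicial_bprod[OF K J])
  have S: "closed_in (?K \<otimes> ?J) ?S" by (rule closed_pushout_prod[OF K J closed_bi_boundary closed_last_horn])
  have L': "closed_in ?K' ?L'" by (rule closed_pushout_prod[OF K J closed_bi_boundary closed_a_boundary])
  \<comment> \<open>A solution must be constant over \<open>hook_pt\<close> in the loop coordinate
    to come from a map into \<open>loop X\<close>, so this is added to the prescribed data. On the
    overlap the two prescriptions agree by \<open>ev_base\<close>.\<close>
  define u' where "u' = (\<lambda>k l ((x, t), j). if t \<in> hook_pt k l then base X k l else ev u k l ((x, j), t))"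
  define v' where "v' = (\<lambda>k l ((x, t), j). ev v k l ((x, j), t))"
  have S': "((x, t), j) \<in> ?S' k l \<longleftrightarrow> x \<in> cells ?K k l \<and> t \<in> cells ?J k l \<and> j \<in> cells ?J k l \<and>
      (t \<in> hook_pt k l \<or> (x, j) \<in> ?S k l)" for x t j k l
    unfolding pushout_prod_def by (auto simp: cells_bprod)
  have u'1: "u' k l ((x, t), j) = ev u k l ((x, j), t)" if "(x, j) \<in> ?S k l" for k l x t j
    using that ev_base[OF u that] by (simp add: u'_def)
  have u'2: "u' k l ((x, t), j) = base X k l" if "t \<in> hook_pt k l" for k l x t j
    using that by (simp add: u'_def)
  have hu': "hom_on (?K' \<otimes> ?J) ?S' X u'"
  proof (rule hom_onI)
    fix k l z assume "z \<in> ?S' k l"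
    moreover obtain x t j where "z = ((x, t), j)" by (metis surj_pair)
    ultimately show "u' k l z \<in> cells X k l"
      using base_in_cells[OF X] hom_onD(1)[OF ev_hom[OF u], of "((x, j), t)" k l]
      by (auto simp: S' u'1 u'2)
  next
    fix k l k' l' a b z assume ab: "a \<in> ops k k'" "b \<in> ops l l'" and z: "z \<in> ?S' k l"
    obtain x t j where zx: "z = ((x, t), j)" by (metis surj_pair)
    show "u' k' l' (act (?K' \<otimes> ?J) k l a b z) = act X k l a b (u' k l z)"
    proof (cases "t \<in> hook_pt k l")
      case True
      then show ?thesis
        using closed_inD(2)[OF closed_a_boundary ab True] act_base[OF X ab] by (simp add: zx act_bprod u'2)
    next
      case False
      then have xj: "(x, j) \<in> ?S k l" and t: "t \<in> cells ?J k l" using z by (auto simp: zx S')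
      have "(act ?K k l a b x, act ?J k l a b j) \<in> ?S k' l'"
        using closed_inD(2)[OF S ab xj] by (simp add: act_bprod)
      then show ?thesis
        using hom_onD(2)[OF ev_hom[OF u] ab, of "((x, j), t)"] xj t by (simp add: zx act_bprod u'1)
    qed
  qed
  have hv': "bihom (?K' \<otimes> ?J) Y v'"
  proof (rule hom_onI)
    fix k l z assume "z \<in> cells (?K' \<otimes> ?J) k l"
    then show "v' k l z \<in> cells Y k l"
      using hom_onD(1)[OF ev_hom[OF v], of "((fst (fst z), snd z), snd (fst z))" k l]
      by (auto simp: v'_def cells_bprod)
  next
    fix k l k' l' a b z assume ab: "a \<in> ops k k'" "b \<in> ops l l'" and "z \<in> cells (?K' \<otimes> ?J) k l"
    then show "v' k' l' (act (?K' \<otimes> ?J) k l a b z) = act Y k l a b (v' k l z)"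
      using hom_onD(2)[OF ev_hom[OF v] ab, of "((fst (fst z), snd z), snd (fst z))"]
      by (auto simp: v'_def cells_bprod act_bprod)
  qed
  have uv': "p k l (u' k l z) = v' k l z" if z: "z \<in> ?S' k l" for k l z
  proof -
    obtain x t j where zx: "z = ((x, t), j)" by (metis surj_pair)
    have t: "t \<in> cells ?J k l" and xj: "(x, j) \<in> cells (?K \<otimes> ?J) k l" using z by (auto simp: zx S' cells_bprod)
    show ?thesis
    proof (cases "t \<in> hook_pt k l")
      case True
      then show ?thesis using ev_base[OF v xj True] by (simp add: zx u'2 v'_def pb)
    next
      case False
      then have xj: "(x, j) \<in> ?S k l" using z by (simp add: zx S')
      then show ?thesis
        using ev_loop_map[OF u xj t, of p] uv[OF xj] by (simp add: zx u'1 v'_def ev_def)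
    qed
  qed
  obtain w where w: "bihom (?K' \<otimes> ?J) X w"
    "\<And>k l z. z \<in> ?S' k l \<Longrightarrow> w k l z = u' k l z"
    "\<And>k l z. z \<in> cells (?K' \<otimes> ?J) k l \<Longrightarrow> p k l (w k l z) = v' k l z"
    by (rule liftsD[OF prism_fib_lifts[OF fib KJ L'] hu' hv' uv']) (assumption | rule that)+
  \<comment> \<open>The squares are exchanged back, so that the loop coordinate is again the last
    one, as \<open>cur\<close> expects.\<close>
  define g where "g = (\<lambda>k l ((x, j), t). w k l ((x, t), j))"
  have g: "hom_on ((?K \<otimes> ?J) \<otimes> ?J) (\<lambda>k l. cells (?K \<otimes> ?J) k l \<times> cells ?J k l) X g"
  proof (rule hom_onI)
    fix k l z assume "z \<in> cells (?K \<otimes> ?J) k l \<times> cells ?J k l"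
    then show "g k l z \<in> cells X k l"
      using hom_onD(1)[OF w(1), of "((fst (fst z), snd z), snd (fst z))" k l]
      by (auto simp: g_def cells_bprod)
  next
    fix k l k' l' a b z assume ab: "a \<in> ops k k'" "b \<in> ops l l'" and "z \<in> cells (?K \<otimes> ?J) k l \<times> cells ?J k l"
    then show "g k' l' (act ((?K \<otimes> ?J) \<otimes> ?J) k l a b z) = act X k l a b (g k l z)"
      using hom_onD(2)[OF w(1) ab, of "((fst (fst z), snd z), snd (fst z))"]
      by (auto simp: g_def cells_bprod act_bprod)
  qed
  have gb: "g k l (y, t) = base X k l" if "y \<in> cells (?K \<otimes> ?J) k l" "t \<in> hook_pt k l" for k l y t
    using that closed_inD(1)[OF closed_a_boundary that(2)] w(2)[of "((fst y, t), snd y)" k l]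
    by (auto simp: g_def S' u'2 cells_bprod)
  have c: "bihom (?K \<otimes> ?J) (loop X) (cur (?K \<otimes> ?J) g)"
    by (rule cur_hom[OF KJ closed_in_cells[OF KJ] g gb])
  have evc: "ev (cur (?K \<otimes> ?J) g) k l (y, t) = g k l (y, t)" if "y \<in> cells (?K \<otimes> ?J) k l" "t \<in> cells ?J k l" for k l y t
    by (rule ev_cur[OF KJ that])
  have SK: "?S k l \<subseteq> cells (?K \<otimes> ?J) k l" for k l using closed_inD(1)[OF S] by blast
  have "cur (?K \<otimes> ?J) g k l y = u k l y" if y: "y \<in> ?S k l" for k l y
  proof (rule ev_eqI[OF S hom_on_subset[OF c SK] u y])
    fix k l y t assume y: "y \<in> ?S k l" and t: "t \<in> cells ?J k l"
    obtain x j where yx: "y = (x, j)" by (metis surj_pair)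
    have "((x, t), j) \<in> ?S' k l" using y t closed_inD(1)[OF S y] by (auto simp: yx S' cells_bprod)
    then show "ev (cur (?K \<otimes> ?J) g) k l (y, t) = ev u k l (y, t)"
      using w(2) y evc[OF closed_inD(1)[OF S y] t] by (simp add: yx g_def u'1)
  qed
  moreover have "loop_map X p k l (cur (?K \<otimes> ?J) g k l y) = v k l y" if y: "y \<in> cells (?K \<otimes> ?J) k l" for k l y
  proof (rule ev_eqI[OF closed_in_cells[OF KJ] _ v y])
    show "bihom (?K \<otimes> ?J) (loop Y) (\<lambda>k l y. loop_map X p k l (cur (?K \<otimes> ?J) g k l y))"
      by (rule hom_on_comp[OF c loop_map_hom[OF X Y p pb]]) (rule hom_onD(1)[OF c])
    fix k l y t assume y: "y \<in> cells (?K \<otimes> ?J) k l" and t: "t \<in> cells ?J k l"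
    show "ev (\<lambda>k l y. loop_map X p k l (cur (?K \<otimes> ?J) g k l y)) k l (y, t) = ev v k l (y, t)"
      using ev_loop_map[OF c y t, of p] evc[OF y t] w(3)[of "((fst y, t), snd y)" k l] y t
      by (auto simp: g_def v'_def cells_bprod)
  qed
  ultimately show "\<exists>w. bihom (?K \<otimes> ?J) (loop X) w \<and> (\<forall>k l. \<forall>x\<in>?S k l. w k l x = u k l x) \<and>
      (\<forall>k l. \<forall>x\<in>cells (?K \<otimes> ?J) k l. loop_map X p k l (w k l x) = v k l x)"
    using c by blast
qed

text \<open>Being Kan is a property of the map to a point, and the loop space of a point is a point.\<close>

lemma kan_loop:
  fixes X :: "'a univ pbisset"
  assumes X: "pointed_bisimplicial X" and kan: "kan X"
  shows "kan (loop X)"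
proof -
  \<comment> \<open>\<open>loop\<close> accepts only objects with cells in a \<open>univ\<close>
    type, so the point is placed there; the choice of the atom is immaterial.\<close>
  let ?c = "Atom undefined :: 'a univ"
  let ?p = "\<lambda>(_ :: nat) (_ :: nat) (_ :: 'a univ). ?c"
  note fib = kan_fibD[OF kan_fib_point[OF X kan, of ?c]]
  have P: "pointed_bisimplicial (loop (point ?c))" by (rule bisimplicial_loop[OF pointed_point])
  have b: "?c = base (point ?c) m n" for m n by (simp add: base_def point_def)
  have hom: "bihom (loop X) (loop (point ?c)) (loop_map X ?p)"
    by (rule loop_map_hom[OF X pointed_point fib(3) b])
  have "x = y" if x: "x \<in> cells (loop (point ?c)) m n" and y: "y \<in> cells (loop (point ?c)) m n" for x y m n
  proof (rule loop_eqI[OF x y])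
    have "un_Fam z k l (v, (c, d)) = ?c"
      if "z \<in> cells (loop (point ?c)) m n" "v \<in> cells square k l" "c \<in> ops m k" "d \<in> ops n l" for z k l v c d
      using hom_onD(1)[OF bimaps_hom_on[OF loop_cellD(2)[OF that(1)]], of "(v, (c, d))" k l] that(2-)
      by (simp add: cells_bprod cells_Delta point_def)
    then show "un_Fam x k l (v, (c, d)) = un_Fam y k l (v, (c, d))"
      if "v \<in> cells square k l" "c \<in> ops m k" "d \<in> ops n l" for k l v c d
      using that x y by simp
  qed
  then have "cells (loop (point ?c)) m n = {base (loop (point ?c)) m n}" for m n
    using base_in_cells[OF P] by blast
  then show ?thesis
    using prism_fib_loop[OF X pointed_point fib(3) b fib(5)]
      kan_iff_prism_fib[of "loop X" "loop_map X ?p" "loop (point ?c)", OF hom_onD(1)[OF hom]] act_base[OF P]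
    by metis
qed

lemma kan_fib_loop:
  assumes fib: "kan_fib X p Y"
  shows "kan_fib (loop X) (loop_map X p) (loop Y)"
proof -
  note f = kan_fibD[OF fib] and b = kan_fib_base[OF fib]
  have X: "pointed_bisimplicial (loop X)" and Y: "pointed_bisimplicial (loop Y)"
    using f bisimplicial_loop by blast+
  have hom: "bihom (loop X) (loop Y) (loop_map X p)"
    by (rule loop_map_hom[OF f(1-3) b])
  have ptX: "pt (loop X) \<in> cells (loop X) 0 0" and ptY: "pt (loop Y) \<in> cells (loop Y) 0 0"
    using X Y unfolding pointed_bisimplicial_def by blast+
  have "loop_map X p 0 0 (pt (loop X)) = pt (loop Y)"
  proof (rule loop_eqI[OF hom_onD(1)[OF hom ptX] ptY])
    fix k l v c d assume vcd: "v \<in> cells square k l" "c \<in> ops 0 k" "d \<in> ops 0 l"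
    show "un_Fam (loop_map X p 0 0 (pt (loop X))) k l (v, (c, d)) = un_Fam (pt (loop Y)) k l (v, (c, d))"
      unfolding un_Fam_loop_map[OF ptX vcd] using vcd b
      by (simp add: pt_loop const_map_def cells_bprod cells_Delta)
  qed
  then show ?thesis
    unfolding kan_fib_def
    using X Y hom prism_fib_loop[OF f(1-3) b f(5)] kan_loop[OF f(2,6)] by blast
qed

section \<open>Compatibility of loops with fibers and inclusions\<close>

lemma bimaps_fiber_iff:
  "f \<in> bimaps D (fiber X p Y) \<longleftrightarrow>
    f \<in> bimaps D X \<and> (\<forall>m n. \<forall>x\<in>cells D m n. p m n (f m n x) = base Y m n)"
  unfolding bimaps_iff hom_on_def fiber_simps by blast

lemma restrict_family_eq_iff:
  "(\<lambda>k l. restrict (f k l) (A k l)) = (\<lambda>k l. restrict (g k l) (A k l)) \<longleftrightarrow>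
    (\<forall>k l. \<forall>x\<in>A k l. f k l x = g k l x)"
  unfolding restrict_eq_iff[symmetric] by (simp add: fun_eq_iff)

text \<open>Both sides consist of the same families: constant on \<open>hook_pt\<close>, with values
  in \<open>X\<close> that \<open>p\<close> sends to the base point. Literal equality spares any
  transport along isomorphisms in the iteration.\<close>

lemma fiber_loop:
  fixes X :: "'a univ pbisset" and Y :: "'b univ pbisset"
  shows "fiber (loop X) (loop_map X p) (loop Y) = loop (fiber X p Y)"
proof -
  have "cells (fiber (loop X) (loop_map X p) (loop Y)) m n = cells (loop (fiber X p Y)) m n" for m n
  proof -
    have "loop_map X p m n (Fam f) = base (loop Y) m n \<longleftrightarrow>
        (\<forall>k l. \<forall>x\<in>cells (square \<otimes> \<Delta> m n) k l. p k l (f k l x) = base Y k l)"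
      if "Fam f \<in> cells (loop X) m n" for f
      unfolding base_loop using that
      by (simp add: loop_map_def bicomp_def compose_def const_map_def restrict_family_eq_iff)
    then show ?thesis
      unfolding fiber_simps(1) loop_cells bimaps_fiber_iff fiber_simps(4) by blast
  qed
  moreover have "act (fiber (loop X) (loop_map X p) (loop Y)) = act (loop (fiber X p Y))"
    unfolding fiber_simps(2) loop_def prelabel_def relabel_def bisset.defs pbisset.defs by (simp add: fiber_def Hom_def)
  moreover have "pt (fiber (loop X) (loop_map X p) (loop Y)) = pt (loop (fiber X p Y))"
    unfolding fiber_simps(3) pt_loop const_map_def fiber_simps(4) ..
  ultimately show ?thesis
    by (intro pbisset.equality) (auto simp: fun_eq_iff)
qed

lemma loop_map_incl: "loop_map F (incl F) = incl (loop F)"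
proof (intro ext)
  fix m n x
  show "loop_map F (incl F) m n x = incl (loop F) m n x"
  proof (cases "x \<in> cells (loop F) m n")
    case True
    let ?D = "square \<otimes> \<Delta> m n"
    have b: "un_Fam x \<in> bimaps ?D F" by (rule loop_cellD(2)[OF True])
    have "bicomp ?D (incl F) (un_Fam x) k l = un_Fam x k l" for k l
    proof (rule extensionalityI[where A = "cells ?D k l"])
      show "un_Fam x k l \<in> extensional (cells ?D k l)" using b unfolding bimaps_iff by blast
    qed (use hom_onD(1)[OF bimaps_hom_on[OF b]] in \<open>simp_all add: bicomp_def compose_def incl_def\<close>)
    then have "bicomp ?D (incl F) (un_Fam x) = un_Fam x" by (simp add: fun_eq_iff)
    then show ?thesis using True loop_cellD(1)[OF True] by (simp add: loop_map_def incl_def)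
  qed (simp add: loop_map_def incl_def)
qed

subsection \<open>Exactness\<close>

lemma const_map_rel:
  assumes "bisimplicial K" "closed_in K (cells L)" "pointed_bisimplicial X"
  shows "const_map K X \<in> rel_maps K L X"
  unfolding rel_maps_iff const_map_def
  using restrict_bimaps[OF assms(1) hom_on_base[OF assms(3)]] closed_inD(1)[OF assms(2)] by simp

lemma restrict_rel_maps:
  assumes "bisimplicial K" "closed_in K (cells L)" "bihom K X f"
    "\<And>k l x. x \<in> cells L k l \<Longrightarrow> f k l x = base X k l"
  shows "(\<lambda>k l. restrict (f k l) (cells K k l)) \<in> rel_maps K L X"
  unfolding rel_maps_iff using restrict_bimaps[OF assms(1,3)] closed_inD(1)[OF assms(2)] assms(4) by simp

lemma bicomp_rel_maps:
  assumes "bisimplicial K" "closed_in K (cells L)" "bihom X Y f"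
    "\<And>m n. f m n (base X m n) = base Y m n" "\<alpha> \<in> rel_maps K L X"
  shows "bicomp K f \<alpha> \<in> rel_maps K L Y"
  unfolding bicomp_def compose_def
  using rel_mapsD[OF assms(5)]
  by (intro restrict_rel_maps[OF assms(1,2)] hom_on_comp[OF _ assms(3)])
    (auto simp: assms(4) dest: hom_onD(1))

lemma bicomp_homotopy:
  assumes K: "bisimplicial K" and L: "closed_in K (cells L)" and f: "bihom X Y f"
    and fb: "\<And>m n. f m n (base X m n) = base Y m n" and ab: "(\<alpha>, \<beta>) \<in> homotopy_rel K L X"
  shows "(bicomp K f \<alpha>, bicomp K f \<beta>) \<in> homotopy_rel K L Y"
proof -
  obtain h where h: "\<alpha> \<in> rel_maps K L X" "\<beta> \<in> rel_maps K L X" "rel_hom K (cells L) X h"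
    "\<And>k l x j. x \<in> cells K k l \<Longrightarrow> j \<in> hook k l \<Longrightarrow> h k l (x, j) = \<alpha> k l x"
    "\<And>k l x. x \<in> cells K k l \<Longrightarrow> h k l (x, origin k l) = \<beta> k l x"
    using homotopy_relD[OF ab] by metis
  have "rel_hom K (cells L) Y (\<lambda>k l z. f k l (h k l z))"
    unfolding rel_hom_def using rel_homD[OF h(3)]
    by (auto intro!: hom_on_comp[OF _ f] simp: fb dest: hom_onD(1))
  then show ?thesis
    by (rule homotopy_relI[OF K L bicomp_rel_maps[OF K L f fb h(1)] bicomp_rel_maps[OF K L f fb h(2)]])
      (simp_all add: h bicomp_def compose_def)
qed

section \<open>Homotopy classes and induced maps\<close>

abbreviation spheroids :: "nat \<Rightarrow> nat \<Rightarrow> 'a pbisset \<Rightarrow> (std, 'a) bimap set" where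
  "spheroids m n \<equiv> rel_maps (\<Delta> m n) (\<delta>\<Delta> m n)"

abbreviation spheroid_homotopy ::
    "nat \<Rightarrow> nat \<Rightarrow> 'a pbisset \<Rightarrow> ((std, 'a) bimap \<times> (std, 'a) bimap) set" where
  "spheroid_homotopy m n \<equiv> homotopy_rel (\<Delta> m n) (\<delta>\<Delta> m n)"

lemma pi_BC_carrier:
  "c \<in> fst (pi_BC m n X) \<longleftrightarrow> (\<exists>\<alpha>\<in>spheroids m n X. c = pi_class m n X \<alpha>)"
  unfolding pi_BC_def pi_class_def quotient_def by auto

lemma pi_class_eq_iff:
  assumes X: "pointed_bisimplicial X" "kan X"
    and "\<alpha> \<in> spheroids m n X" "\<beta> \<in> spheroids m n X"
  shows "pi_class m n X \<alpha> = pi_class m n X \<beta> \<longleftrightarrow> (\<alpha>, \<beta>) \<in> spheroid_homotopy m n X"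
  unfolding pi_class_def
  by (rule eq_equiv_class_iff[OF homotopy_equiv[OF bisimplicial_Delta closed_bi_boundary X] assms(3,4)])

lemma pi_class_self:
  "\<alpha> \<in> spheroids m n X \<Longrightarrow> \<alpha> \<in> pi_class m n X \<alpha>"
  unfolding pi_class_def using homotopy_refl[OF bisimplicial_Delta closed_bi_boundary] by blast

lemma pi_map_class:
  assumes X: "pointed_bisimplicial X" "kan X" and Y: "pointed_bisimplicial Y" "kan Y"
    and f: "bihom X Y f" and fb: "\<And>m n. f m n (base X m n) = base Y m n"
    and \<alpha>: "\<alpha> \<in> spheroids m n X"
  shows "pi_map m n Y f (pi_class m n X \<alpha>) = pi_class m n Y (bicomp (\<Delta> m n) f \<alpha>)"
  unfolding pi_map_def
proof (rule the_equality)
  show "\<exists>\<beta>\<in>pi_class m n X \<alpha>. pi_class m n Y (bicomp (\<Delta> m n) f \<alpha>) = pi_class m n Y (bicomp (\<Delta> m n) f \<beta>)"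
    using pi_class_self[OF \<alpha>] by blast
  fix d assume "\<exists>\<beta>\<in>pi_class m n X \<alpha>. d = pi_class m n Y (bicomp (\<Delta> m n) f \<beta>)"
  then obtain \<beta> where \<beta>: "(\<alpha>, \<beta>) \<in> spheroid_homotopy m n X"
    and d: "d = pi_class m n Y (bicomp (\<Delta> m n) f \<beta>)" unfolding pi_class_def by blast
  have "\<beta> \<in> spheroids m n X" using \<beta> unfolding homotopy_rel_def by blast
  then show "d = pi_class m n Y (bicomp (\<Delta> m n) f \<alpha>)"
    unfolding d
    using pi_class_eq_iff[OF Y bicomp_rel_maps bicomp_rel_maps] bicomp_homotopy[OF _ _ f fb \<beta>]
      bisimplicial_Delta closed_bi_boundary f fb \<alpha> by metis
qed

lemma rel_maps_fiber:
  "\<gamma> \<in> rel_maps K L (fiber X p Y) \<longleftrightarrow>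
     \<gamma> \<in> rel_maps K L X \<and> (\<forall>k l. \<forall>x\<in>cells K k l. p k l (\<gamma> k l x) = base Y k l)"
  unfolding rel_maps_iff bimaps_fiber_iff fiber_simps by blast

lemma bicomp_incl:
  assumes "\<gamma> \<in> rel_maps K L F"
  shows "bicomp K (incl F) \<gamma> = \<gamma>"
proof (intro ext)
  fix k l x
  have "\<gamma> k l \<in> extensional (cells K k l)" using assms unfolding rel_maps_iff bimaps_iff by blast
  then show "bicomp K (incl F) \<gamma> k l x = \<gamma> k l x"
    using hom_onD(1)[OF rel_mapsD(1)[OF assms], of x k l]
    by (cases "x \<in> cells K k l") (auto simp: bicomp_def compose_def incl_def extensional_def)
qed

lemma hom_on_incl_fiber: "bihom (fiber X p Y) X (incl (fiber X p Y))"
  if "kan_fib X p Y"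
proof -
  have F: "bisimplicial (fiber X p Y)" using pointed_fiber[OF that] unfolding pointed_bisimplicial_def by blast
  show ?thesis
    by (rule hom_onI) (use bisimplicialD(1)[OF F] in \<open>simp_all add: incl_def\<close>, simp_all add: fiber_simps)
qed

section \<open>Transposition of relative maps, and the connecting map\<close>

lemma ev_restrict:
  "u \<in> cells K k l \<Longrightarrow> ev (\<lambda>k l. restrict (\<alpha> k l) (cells K k l)) k l (u, v) = ev \<alpha> k l (u, v)"
  by (simp add: ev_def)

lemma adjunct_eq: "adjunct K \<alpha> k l = restrict (ev \<alpha> k l) (cells (K \<otimes> square) k l)"
  unfolding adjunct_def ev_def by (simp add: case_prod_unfold)

lemma ev_base_loop:
  assumes "\<alpha> k l u = base (loop X) k l" "v \<in> cells square k l"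
  shows "ev \<alpha> k l (u, v) = base X k l"
  using assms by (simp add: ev_def base_loop const_map_def cells_bprod cells_Delta)

lemma rel_hom_ev:
  assumes "\<alpha> \<in> rel_maps K L (loop X)"
  shows "rel_hom K (cells L) X (ev \<alpha>)"
proof -
  have "cells (K \<otimes> square) = (\<lambda>k l. cells K k l \<times> cells square k l)" by (simp add: fun_eq_iff cells_bprod)
  then show ?thesis
    unfolding rel_hom_def using ev_hom[OF rel_mapsD(1)[OF assms]] ev_base_loop[of \<alpha>] rel_mapsD(2)[OF assms]
    by simp
qed

lemma rel_maps_cur:
  assumes K: "bisimplicial K" and L: "closed_in K (cells L)" and g: "rel_hom K (cells L) X g"
    and gb: "\<And>k l u v. u \<in> cells K k l \<Longrightarrow> v \<in> hook_pt k l \<Longrightarrow> g k l (u, v) = base X k l"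
  shows "(\<lambda>k l. restrict (cur K g k l) (cells K k l)) \<in> rel_maps K L (loop X)"
proof (rule restrict_rel_maps[OF K L])
  have "cells (K \<otimes> square) = (\<lambda>k l. cells K k l \<times> cells square k l)" by (simp add: fun_eq_iff cells_bprod)
  then have g': "hom_on (K \<otimes> square) (\<lambda>k l. cells K k l \<times> cells square k l) X g"
    using rel_homD(1)[OF g] by simp
  show "bihom K (loop X) (cur K g)"
    by (rule cur_hom[OF K closed_in_cells[OF K] g' gb])
next
  fix k l x assume x: "x \<in> cells L k l"
  show "cur K g k l x = base (loop X) k l"
    unfolding cur_def base_loop const_map_def using closed_inD(2)[OF L _ _ x] rel_homD(2)[OF g]
    by (auto simp: fun_eq_iff restrict_def cells_bprod cells_Delta[of k l])
qed

lemma last_horn_a_boundary: "j \<in> hook k l \<Longrightarrow> j \<in> hook_pt k l"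
  "origin k l \<in> hook_pt k l"
  by (simp_all add: a_boundary_cells)

lemma last_horn_square: "j \<in> hook k l \<Longrightarrow> j \<in> cells square k l"
  using last_horn_sub by blast

text \<open>The witnesses in the description of \<open>tau\<close> for one representative. By
  \<open>tau_rel_exists\<close> and \<open>tau_rel_unique\<close> this relation induces a function
  on classes.\<close>

definition tau_rel ::
    "nat \<Rightarrow> nat \<Rightarrow> 'a univ pbisset \<Rightarrow> ('a univ, 'b univ) bimap \<Rightarrow> 'b univ pbisset \<Rightarrow>
     (std, 'b univ) bimap \<Rightarrow> (std \<times> std, 'a univ) bimap \<Rightarrow> (std, 'a univ) bimap \<Rightarrow> bool" where
  "tau_rel m n X p Y \<alpha> \<alpha>' \<gamma> \<longleftrightarrow> tau_lift m n X p \<alpha> \<alpha>' \<and>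
     \<gamma> \<in> spheroids m n (fiber X p Y) \<and> corner (\<Delta> m n) X \<alpha>' = vertex (\<Delta> m n) \<gamma>"

lemma tau_relD:
  assumes "tau_rel m n X p Y \<alpha> \<alpha>' \<gamma>"
  shows "\<gamma> \<in> spheroids m n (fiber X p Y)"
    "rel_hom (\<Delta> m n) (cells (\<delta>\<Delta> m n)) X \<alpha>'"
    "x \<in> cells (\<Delta> m n) k l \<Longrightarrow> j \<in> cells square k l \<Longrightarrow> p k l (\<alpha>' k l (x, j)) = ev \<alpha> k l (x, j)"
    "x \<in> cells (\<Delta> m n) k l \<Longrightarrow> j \<in> hook k l \<Longrightarrow> \<alpha>' k l (x, j) = base X k l"
    "x \<in> cells (\<Delta> m n) k l \<Longrightarrow> \<alpha>' k l (x, origin k l) = \<gamma> k l x"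
proof -
  let ?K = "\<Delta> m n"
  have l: "\<alpha>' \<in> bimaps (?K \<otimes> square) X" "bicomp (?K \<otimes> square) p \<alpha>' = adjunct ?K \<alpha>"
    "const_on ((\<delta>\<Delta> m n \<otimes> square) \<squnion> (?K \<otimes> \<Lambda> 1 1)) X \<alpha>'" and c: "corner ?K X \<alpha>' = vertex ?K \<gamma>"
    using assms unfolding tau_rel_def tau_lift_def by auto
  show "\<gamma> \<in> rel_maps ?K (\<delta>\<Delta> m n) (fiber X p Y)" using assms unfolding tau_rel_def by blast
  show "rel_hom ?K (cells (\<delta>\<Delta> m n)) X \<alpha>'"
    using bimaps_hom_on[OF l(1)] l(3) unfolding rel_hom_def const_on_def bunion_def by (simp add: cells_bprod)
  show "p k l (\<alpha>' k l (x, j)) = ev \<alpha> k l (x, j)" if "x \<in> cells ?K k l" "j \<in> cells square k l"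
    using fun_cong[OF fun_cong[OF fun_cong[OF l(2)]], of k l "(x, j)"] that
    by (simp add: adjunct_eq bicomp_def compose_def cells_bprod)
  show "\<alpha>' k l (x, j) = base X k l" if "x \<in> cells ?K k l" "j \<in> hook k l"
    using l(3) that unfolding const_on_def bunion_def by (simp add: cells_bprod)
  show "\<alpha>' k l (x, origin k l) = \<gamma> k l x" if "x \<in> cells ?K k l"
    using c that unfolding corner_iff by blast
qed

lemma tau_relI:
  assumes \<gamma>: "\<gamma> \<in> spheroids m n (fiber X p Y)"
    and h: "rel_hom (\<Delta> m n) (cells (\<delta>\<Delta> m n)) X h"
    and ph: "\<And>k l x j. x \<in> cells (\<Delta> m n) k l \<Longrightarrow> j \<in> cells square k l \<Longrightarrow> p k l (h k l (x, j)) = ev \<alpha> k l (x, j)"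
    and hor: "\<And>k l x j. x \<in> cells (\<Delta> m n) k l \<Longrightarrow> j \<in> hook k l \<Longrightarrow> h k l (x, j) = base X k l"
    and ori: "\<And>k l x. x \<in> cells (\<Delta> m n) k l \<Longrightarrow> h k l (x, origin k l) = \<gamma> k l x"
  shows "tau_rel m n X p Y \<alpha> (\<lambda>k l. restrict (h k l) (cells (\<Delta> m n \<otimes> square) k l)) \<gamma>"
proof -
  let ?K = "\<Delta> m n"
  let ?h = "\<lambda>k l. restrict (h k l) (cells (?K \<otimes> square) k l)"
  have "?h \<in> bimaps (?K \<otimes> square) X"
    by (rule restrict_bimaps[OF bisimplicial_bprod[OF bisimplicial_Delta bisimplicial_Delta] rel_homD(1)[OF h]])
  moreover have "bicomp (?K \<otimes> square) p ?h = adjunct ?K \<alpha>"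
    by (intro ext) (auto simp: adjunct_eq bicomp_def compose_def cells_bprod ph restrict_def)
  moreover have "const_on ((\<delta>\<Delta> m n \<otimes> square) \<squnion> (?K \<otimes> \<Lambda> 1 1)) X ?h"
    unfolding const_on_def bunion_def
    using closed_inD(1)[OF closed_bi_boundary]
    by (auto simp: cells_bprod hor rel_homD(2)[OF h] last_horn_square)
  moreover have "corner ?K X ?h = vertex ?K \<gamma>"
    unfolding corner_iff by (simp add: cells_bprod origin_cells ori)
  ultimately show ?thesis using \<gamma> unfolding tau_rel_def tau_lift_def by blast
qed

lemma rel_map_origin:
  assumes h: "rel_hom K (cells L) X h" and K: "bisimplicial K" and L: "closed_in K (cells L)"
  shows "(\<lambda>k l. \<lambda>x\<in>cells K k l. h k l (x, origin k l)) \<in> rel_maps K L X"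
proof (rule restrict_rel_maps[OF K L])
  show "bihom K X (\<lambda>k l x. h k l (x, origin k l))"
  proof (rule hom_onI)
    fix m n k l a b x assume ab: "a \<in> ops m k" "b \<in> ops n l" and x: "x \<in> cells K m n"
    show "h k l (act K m n a b x, origin k l) = act X m n a b (h m n (x, origin m n))"
      using hom_onD(2)[OF rel_homD(1)[OF h] ab, of "(x, origin m n)"] x
      by (simp add: cells_bprod act_bprod origin_cells act_origin[OF ab])
  qed (rule hom_onD(1)[OF rel_homD(1)[OF h]], simp add: cells_bprod origin_cells)
qed (rule rel_homD(2)[OF h], simp_all add: origin_cells)

text \<open>The transpose of \<alpha> is lifted starting from the constant map on the hook. The
  corner of the lift lies in the fiber because loops are constant at \<open>origin\<close>.\<close>

lemma tau_rel_exists: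
  fixes X :: "'a univ pbisset" and Y :: "'b univ pbisset"
  assumes fib: "kan_fib X p Y" and \<alpha>: "\<alpha> \<in> spheroids m n (loop Y)"
  obtains \<alpha>' \<gamma> where "tau_rel m n X p Y \<alpha> \<alpha>' \<gamma>"
proof -
  let ?K = "\<Delta> m n" and ?L = "\<delta>\<Delta> m n"
  note K = bisimplicial_Delta[of m n] and L = closed_bi_boundary[of m n]
  have pA: "p k l (base X k l) = ev \<alpha> k l (x, j)" if "x \<in> cells ?K k l" "j \<in> hook k l" for k l x j
    using ev_base[OF rel_mapsD(1)[OF \<alpha>] that(1) last_horn_a_boundary(1)[OF that(2)]] kan_fib_base[OF fib] by simp
  obtain h where h: "rel_hom ?K (cells ?L) X h"
    "\<And>k l z. z \<in> cells (?K \<otimes> square) k l \<Longrightarrow> p k l (h k l z) = ev \<alpha> k l z"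
    "\<And>k l x j. x \<in> cells ?K k l \<Longrightarrow> j \<in> hook k l \<Longrightarrow> h k l (x, j) = base X k l"
    by (rule lift_horn_rel[OF fib K L hom_on_base[OF kan_fibD(1)[OF fib]] refl rel_hom_ev[OF \<alpha>] pA]) (assumption | rule that)+
  have "p k l (h k l (x, origin k l)) = base Y k l" if "x \<in> cells ?K k l" for k l x
    using h(2)[of "(x, origin k l)" k l] that ev_base[OF rel_mapsD(1)[OF \<alpha>] that last_horn_a_boundary(2)]
    by (simp add: cells_bprod origin_cells)
  then have \<gamma>: "(\<lambda>k l. \<lambda>x\<in>cells ?K k l. h k l (x, origin k l)) \<in> rel_maps ?K ?L (fiber X p Y)"
    unfolding rel_maps_fiber using rel_map_origin[OF h(1) K L] by simp
  show thesis
    by (rule that, rule tau_relI[OF \<gamma> h(1)]) (simp_all add: h cells_bprod)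
qed

text \<open>One filler handles the change of representative and the change of lift. It lies over the
  transpose of a homotopy from \<alpha> to \<beta>, with \<open>\<alpha>'\<close> over the hook and
  \<open>\<beta>'\<close> over the \<open>origin\<close> of the homotopy square. At the
  \<open>origin\<close> of the loop square it is a homotopy from \<gamma> to \<delta>, and it stays
  in the fiber since loops are constant there.\<close>

lemma tau_rel_unique:
  fixes X :: "'a univ pbisset" and Y :: "'b univ pbisset"
  assumes fib: "kan_fib X p Y" and ab: "(\<alpha>, \<beta>) \<in> spheroid_homotopy m n (loop Y)"
    and \<alpha>: "tau_rel m n X p Y \<alpha> \<alpha>' \<gamma>" and \<beta>: "tau_rel m n X p Y \<beta> \<beta>' \<delta>"
  shows "(\<gamma>, \<delta>) \<in> spheroid_homotopy m n (fiber X p Y)"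
proof -
  let ?K = "\<Delta> m n" and ?L = "\<delta>\<Delta> m n"
  note K = bisimplicial_Delta[of m n] and L = closed_bi_boundary[of m n]
  note a = tau_relD[OF \<alpha>] and b = tau_relD[OF \<beta>]
  have X: "pointed_bisimplicial X" using kan_fibD(1)[OF fib] .
  obtain G where G: "rel_hom ?K (cells ?L) (loop Y) G"
    "\<And>k l x j. x \<in> cells ?K k l \<Longrightarrow> j \<in> hook k l \<Longrightarrow> G k l (x, j) = \<alpha> k l x"
    "\<And>k l x. x \<in> cells ?K k l \<Longrightarrow> G k l (x, origin k l) = \<beta> k l x"
    using homotopy_relD[OF ab] by metis
  have G\<alpha>: "ev G k l ((x, s), t) = ev \<alpha> k l (x, t)" if "x \<in> cells ?K k l" "s \<in> hook k l" for k l x s t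
    using G(2)[OF that] by (simp add: ev_def)
  have G\<beta>: "ev G k l ((x, origin k l), t) = ev \<beta> k l (x, t)" if "x \<in> cells ?K k l" for k l x t
    using G(3)[OF that] by (simp add: ev_def)
  have Gb: "ev G k l ((x, s), t) = base Y k l"
    if "x \<in> cells ?K k l" "s \<in> cells square k l" "t \<in> hook_pt k l" for k l x s t
    using ev_base[OF rel_homD(1)[OF G(1)] _ that(3), of "(x, s)"] that by (simp add: cells_bprod)
  have eq: "cells ((?K \<otimes> square) \<otimes> square) = (\<lambda>k l. cells (?K \<otimes> square) k l \<times> cells square k l)"
    by (simp add: fun_eq_iff cells_bprod[of "?K \<otimes> square"])
  have v: "bihom ((?K \<otimes> square) \<otimes> square) Y (ev G)"
    unfolding eq by (rule ev_hom[OF rel_homD(1)[OF G(1)]])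
  have A: "rel_hom ?K (cells ?L) X (\<lambda>k l _. base X k l)"
    unfolding rel_hom_def using hom_on_base[OF X] by blast
  obtain H where H: "bihom ((?K \<otimes> square) \<otimes> square) X H"
    and pH: "\<And>k l z. z \<in> cells ((?K \<otimes> square) \<otimes> square) k l \<Longrightarrow> p k l (H k l z) = ev G k l z"
    and HL: "\<And>k l x s t. x \<in> cells ?L k l \<Longrightarrow> s \<in> cells square k l \<Longrightarrow> t \<in> cells square k l \<Longrightarrow>
      H k l ((x, s), t) = base X k l"
    and Hs: "\<And>k l x s t. x \<in> cells ?K k l \<Longrightarrow> s \<in> hook k l \<Longrightarrow> t \<in> cells square k l \<Longrightarrow>
      H k l ((x, s), t) = \<alpha>' k l (x, t)"
    and Ho: "\<And>k l x t. x \<in> cells ?K k l \<Longrightarrow> t \<in> cells square k l \<Longrightarrow> H k l ((x, origin k l), t) = \<beta>' k l (x, t)"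
    by (rule lift_square[OF fib K L A a(2) b(2) v])
      (simp_all add: a b G\<alpha> G\<beta> Gb kan_fib_base[OF fib] last_horn_a_boundary last_horn_square
        ev_base_loop rel_homD(2)[OF G(1)])
  let ?g = "\<lambda>k l z. H k l (z, origin k l)"
  have g: "rel_hom ?K (cells ?L) X ?g" by (rule rel_hom_origin[OF H HL])
  have "p k l (?g k l z) = base Y k l" if "z \<in> cells (?K \<otimes> square) k l" for k l z
    using pH[of "(z, origin k l)" k l] that Gb[of "fst z" k l "snd z" "origin k l"]
    by (auto simp: cells_bprod origin_cells last_horn_a_boundary)
  then have gF: "rel_hom ?K (cells ?L) (fiber X p Y) ?g"
    using g unfolding rel_hom_def hom_on_def fiber_simps by auto
  show ?thesis
    by (rule homotopy_relI[OF K L a(1) b(1) gF]) (simp_all add: Hs Ho a b origin_cells)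
qed

lemma tau_class:
  fixes X :: "'a univ pbisset" and Y :: "'b univ pbisset"
  assumes fib: "kan_fib X p Y" and \<alpha>: "\<alpha> \<in> spheroids m n (loop Y)"
    and t: "tau_rel m n X p Y \<alpha> \<alpha>' \<gamma>"
  shows "tau m n (fiber X p Y) X p (pi_class m n (loop Y) \<alpha>) = pi_class m n (fiber X p Y) \<gamma>"
  unfolding tau_def
proof (rule the_equality)
  show "\<exists>\<alpha>\<in>pi_class m n (loop Y) \<alpha>. \<exists>\<alpha>' \<gamma>'. tau_lift m n X p \<alpha> \<alpha>' \<and>
      \<gamma>' \<in> spheroids m n (fiber X p Y) \<and> corner (\<Delta> m n) X \<alpha>' = vertex (\<Delta> m n) \<gamma>' \<and>
      pi_class m n (fiber X p Y) \<gamma> = pi_class m n (fiber X p Y) \<gamma>'"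
    using pi_class_self[OF \<alpha>] t unfolding tau_rel_def by blast
next
  fix d assume "\<exists>\<alpha>\<in>pi_class m n (loop Y) \<alpha>. \<exists>\<alpha>' \<gamma>'. tau_lift m n X p \<alpha> \<alpha>' \<and>
      \<gamma>' \<in> spheroids m n (fiber X p Y) \<and> corner (\<Delta> m n) X \<alpha>' = vertex (\<Delta> m n) \<gamma>' \<and>
      d = pi_class m n (fiber X p Y) \<gamma>'"
  then obtain \<beta> \<beta>' \<delta> where b: "(\<alpha>, \<beta>) \<in> spheroid_homotopy m n (loop Y)"
    "tau_rel m n X p Y \<beta> \<beta>' \<delta>" "d = pi_class m n (fiber X p Y) \<delta>"
    unfolding tau_rel_def pi_class_def by blast
  have "(\<gamma>, \<delta>) \<in> spheroid_homotopy m n (fiber X p Y)"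
    by (rule tau_rel_unique[OF fib b(1) t b(2)])
  then show "d = pi_class m n (fiber X p Y) \<gamma>"
    unfolding b(3) using pi_class_eq_iff[OF pointed_fiber[OF fib] kan_fiber[OF fib] tau_relD(1)[OF t] tau_relD(1)[OF b(2)]]
    by simp
qed

section \<open>Pointed maps and exactness for one Kan fibration in a fixed bidegree\<close>

locale kan_fibration =
  fixes X :: "'a univ pbisset" and Y :: "'b univ pbisset" and p :: "('a univ, 'b univ) bimap"
    and m n :: nat
  assumes fib: "kan_fib X p Y"
begin

abbreviation (input) "K \<equiv> \<Delta> m n"
abbreviation (input) "L \<equiv> \<delta>\<Delta> m n"
abbreviation (input) "F \<equiv> fiber X p Y"
abbreviation (input) "c\<^sub>0 Z \<equiv> const_map K Z"

lemmas K_bis = bisimplicial_Delta[of m n] and L_cl = closed_bi_boundary[of m n]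
lemmas X_kan = kan_fibD(1)[OF fib] kan_fib_total[OF fib]
lemmas Y_kan = kan_fibD(2)[OF fib] kan_fibD(6)[OF fib]
lemmas F_kan = pointed_fiber[OF fib] kan_fiber[OF fib]
lemmas loopX_kan = bisimplicial_loop[OF X_kan(1)] kan_loop[OF X_kan]
lemmas loopY_kan = bisimplicial_loop[OF Y_kan(1)] kan_loop[OF Y_kan]
lemmas p_base = kan_fib_base[OF fib]
lemmas loop_p_base = kan_fib_base[OF kan_fib_loop[OF fib]]
lemmas p_hom = kan_fibD(3)[OF fib]
lemmas loop_p_hom = kan_fibD(3)[OF kan_fib_loop[OF fib]]

lemma base_class: "pointed_bisimplicial Z \<Longrightarrow> snd (pi_BC m n Z) \<in> fst (pi_BC m n Z)"
  unfolding pi_BC_carrier using const_map_rel[OF K_bis L_cl] by (force simp: pi_BC_def)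

lemma snd_pi_BC: "snd (pi_BC m n Z) = pi_class m n Z (c\<^sub>0 Z)"
  by (simp add: pi_BC_def)

lemma bicomp_const:
  assumes "\<And>k l. f k l (base Z k l) = base Z' k l"
  shows "bicomp K f (c\<^sub>0 Z) = c\<^sub>0 Z'"
  unfolding bicomp_def compose_def const_map_def by (auto simp: assms fun_eq_iff)

lemma pointed_map_pi:
  assumes "pointed_bisimplicial Z" "kan Z" "pointed_bisimplicial Z'" "kan Z'"
    "bihom Z Z' f" "\<And>k l. f k l (base Z k l) = base Z' k l"
  shows "pointed_map (pi_BC m n Z) (pi_map m n Z' f) (pi_BC m n Z')"
  unfolding pointed_map_def
proof
  show "pi_map m n Z' f ` fst (pi_BC m n Z) \<subseteq> fst (pi_BC m n Z')"
  proof (rule image_subsetI)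
    fix c assume "c \<in> fst (pi_BC m n Z)"
    then obtain \<alpha> where \<alpha>: "\<alpha> \<in> rel_maps K L Z" "c = pi_class m n Z \<alpha>" unfolding pi_BC_carrier by blast
    show "pi_map m n Z' f c \<in> fst (pi_BC m n Z')"
      unfolding \<alpha>(2) pi_map_class[OF assms \<alpha>(1)] pi_BC_carrier
      using bicomp_rel_maps[OF K_bis L_cl assms(5,6) \<alpha>(1)] by blast
  qed
  show "pi_map m n Z' f (snd (pi_BC m n Z)) = snd (pi_BC m n Z')"
    unfolding snd_pi_BC pi_map_class[OF assms const_map_rel[OF K_bis L_cl assms(1)]] bicomp_const[where f = f and Z = Z and Z' = Z', OF assms(6)] ..
qed

lemma incl_base: "incl F k l (base F k l) = base X k l"
  using base_in_cells[OF F_kan(1)] by (simp add: incl_def fiber_simps(4))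

lemma pi_map_incl:
  assumes "\<gamma> \<in> rel_maps K L F"
  shows "pi_map m n X (incl F) (pi_class m n F \<gamma>) = pi_class m n X \<gamma>"
  unfolding pi_map_class[OF F_kan X_kan hom_on_incl_fiber[OF fib] incl_base assms] bicomp_incl[OF assms] ..

text \<open>Homotopy lifting: a homotopy from the image of \<alpha> to the constant map is lifted
  starting at \<alpha> and ends in the fiber. The other inclusion already holds for representatives,
  as \<open>p\<close> is constant on the fiber.\<close>

lemma exact_at_total:
  "exact_at (pi_BC m n F) (pi_map m n X (incl F)) (pi_BC m n X) (pi_map m n Y p) (pi_BC m n Y)"
  unfolding exact_at_def
proof (intro equalityI subsetI)
  fix b assume "b \<in> {b \<in> fst (pi_BC m n X). pi_map m n Y p b = snd (pi_BC m n Y)}"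
  then obtain \<alpha> where \<alpha>: "\<alpha> \<in> rel_maps K L X" "b = pi_class m n X \<alpha>"
    and "pi_map m n Y p b = pi_class m n Y (c\<^sub>0 Y)" unfolding pi_BC_carrier snd_pi_BC by blast
  then have "(bicomp K p \<alpha>, c\<^sub>0 Y) \<in> homotopy_rel K L Y"
    using pi_map_class[OF X_kan Y_kan p_hom p_base \<alpha>(1)] bicomp_rel_maps[OF K_bis L_cl p_hom p_base \<alpha>(1)]
      pi_class_eq_iff[OF Y_kan _ const_map_rel[OF K_bis L_cl Y_kan(1)]] by simp
  then obtain h where h: "rel_hom K (cells L) Y h"
    "\<And>k l x j. x \<in> cells K k l \<Longrightarrow> j \<in> hook k l \<Longrightarrow> h k l (x, j) = bicomp K p \<alpha> k l x"
    "\<And>k l x. x \<in> cells K k l \<Longrightarrow> h k l (x, origin k l) = c\<^sub>0 Y k l x"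
    by (rule homotopy_relD) (assumption | rule that)+
  have pA: "p k l (\<alpha> k l x) = h k l (x, j)" if "x \<in> cells K k l" "j \<in> hook k l" for k l x j
    using h(2)[OF that] that by (simp add: bicomp_def compose_def)
  obtain g where g: "rel_hom K (cells L) X g"
    "\<And>k l z. z \<in> cells (K \<otimes> square) k l \<Longrightarrow> p k l (g k l z) = h k l z"
    "\<And>k l x j. x \<in> cells K k l \<Longrightarrow> j \<in> hook k l \<Longrightarrow> g k l (x, j) = \<alpha> k l x"
    by (rule lift_horn_rel[OF fib K_bis L_cl rel_mapsD[OF \<alpha>(1)] h(1) pA]) (assumption | rule that)+
  let ?\<gamma> = "\<lambda>k l. \<lambda>x\<in>cells K k l. g k l (x, origin k l)"
  have \<gamma>X: "?\<gamma> \<in> rel_maps K L X" by (rule rel_map_origin[OF g(1) K_bis L_cl])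
  have \<gamma>: "?\<gamma> \<in> rel_maps K L F"
    unfolding rel_maps_fiber using \<gamma>X by (simp add: g(2) h(3) cells_bprod origin_cells const_map_def)
  have "(\<alpha>, ?\<gamma>) \<in> homotopy_rel K L X"
    by (rule homotopy_relI[OF K_bis L_cl \<alpha>(1) \<gamma>X g(1,3)]) simp_all
  then have "b = pi_map m n X (incl F) (pi_class m n F ?\<gamma>)"
    unfolding pi_map_incl[OF \<gamma>] \<alpha>(2) pi_class_eq_iff[OF X_kan \<alpha>(1) \<gamma>X] .
  then show "b \<in> pi_map m n X (incl F) ` fst (pi_BC m n F)"
    unfolding image_iff bex_simps using \<gamma> pi_BC_carrier by blast
next
  fix b assume "b \<in> pi_map m n X (incl F) ` fst (pi_BC m n F)"
  then obtain \<gamma> where \<gamma>F: "\<gamma> \<in> rel_maps K L F" "b = pi_map m n X (incl F) (pi_class m n F \<gamma>)"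
    by (auto simp: pi_BC_carrier)
  note \<gamma> = \<gamma>F(1) \<gamma>F(2)[unfolded pi_map_incl[OF \<gamma>F(1)]]
  have \<gamma>X: "\<gamma> \<in> rel_maps K L X" and p\<gamma>: "\<And>k l x. x \<in> cells K k l \<Longrightarrow> p k l (\<gamma> k l x) = base Y k l"
    using \<gamma>(1) unfolding rel_maps_fiber by blast+
  have "bicomp K p \<gamma> = c\<^sub>0 Y" by (auto simp: fun_eq_iff bicomp_def compose_def const_map_def p\<gamma>)
  then show "b \<in> {b \<in> fst (pi_BC m n X). pi_map m n Y p b = snd (pi_BC m n Y)}"
    unfolding \<gamma>(2) snd_pi_BC mem_Collect_eq pi_map_class[OF X_kan Y_kan p_hom p_base \<gamma>X] pi_BC_carrier using \<gamma>X by auto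
qed

text \<open>A homotopy in \<open>X\<close> from the constant map to \<gamma> is sent by
  \<open>p\<close> to a map that is constant on \<open>hook_pt\<close>, hence to the transpose of a
  map into \<open>loop Y\<close>, of which the homotopy itself is an admissible lift. Conversely, an
  admissible lift is a homotopy of this kind.\<close>

lemma exact_at_fiber:
  "exact_at (pi_BC m n (loop Y)) (tau m n F X p) (pi_BC m n F) (pi_map m n X (incl F)) (pi_BC m n X)"
  unfolding exact_at_def
proof (intro equalityI subsetI)
  fix b assume "b \<in> {b \<in> fst (pi_BC m n F). pi_map m n X (incl F) b = snd (pi_BC m n X)}"
  then obtain \<gamma> where \<gamma>: "\<gamma> \<in> rel_maps K L F" "b = pi_class m n F \<gamma>"
    and "pi_class m n X (c\<^sub>0 X) = pi_class m n X \<gamma>"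
    unfolding pi_BC_carrier snd_pi_BC using pi_map_incl by auto
  moreover have \<gamma>X: "\<gamma> \<in> rel_maps K L X" and p\<gamma>: "\<And>k l x. x \<in> cells K k l \<Longrightarrow> p k l (\<gamma> k l x) = base Y k l"
    using \<gamma>(1) unfolding rel_maps_fiber by blast+
  ultimately have "(c\<^sub>0 X, \<gamma>) \<in> homotopy_rel K L X"
    using pi_class_eq_iff[OF X_kan const_map_rel[OF K_bis L_cl X_kan(1)] \<gamma>X] by simp
  then obtain h where h: "rel_hom K (cells L) X h"
    "\<And>k l x j. x \<in> cells K k l \<Longrightarrow> j \<in> hook k l \<Longrightarrow> h k l (x, j) = c\<^sub>0 X k l x"
    "\<And>k l x. x \<in> cells K k l \<Longrightarrow> h k l (x, origin k l) = \<gamma> k l x"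
    by (rule homotopy_relD) (assumption | rule that)+
  let ?g = "\<lambda>k l z. p k l (h k l z)"
  have g: "rel_hom K (cells L) Y ?g"
    unfolding rel_hom_def using rel_homD[OF h(1)] hom_on_comp[OF rel_homD(1)[OF h(1)] p_hom]
    by (auto simp: p_base dest: hom_onD(1))
  have gb: "?g k l (u, v) = base Y k l" if "u \<in> cells K k l" "v \<in> hook_pt k l" for k l u v
    using that unfolding a_boundary_cells by (auto simp: h p\<gamma> const_map_def p_base)
  let ?\<alpha> = "\<lambda>k l. restrict (cur K ?g k l) (cells K k l)"
  have \<alpha>: "?\<alpha> \<in> rel_maps K L (loop Y)" by (rule rel_maps_cur[OF K_bis L_cl g gb])
  have "tau_rel m n X p Y ?\<alpha> (\<lambda>k l. restrict (h k l) (cells (K \<otimes> square) k l)) \<gamma>"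
    by (rule tau_relI[OF \<gamma>(1) h(1)]) (simp_all add: ev_restrict ev_cur[OF K_bis] h const_map_def)
  then have "b = tau m n F X p (pi_class m n (loop Y) ?\<alpha>)"
    unfolding \<gamma>(2) by (rule tau_class[OF fib \<alpha>, symmetric])
  then show "b \<in> tau m n F X p ` fst (pi_BC m n (loop Y))"
    unfolding image_iff using \<alpha> pi_BC_carrier by blast
next
  fix b assume "b \<in> tau m n F X p ` fst (pi_BC m n (loop Y))"
  then obtain \<alpha> where \<alpha>: "\<alpha> \<in> rel_maps K L (loop Y)" and b: "b = tau m n F X p (pi_class m n (loop Y) \<alpha>)"
    by (auto simp: pi_BC_carrier)
  obtain \<alpha>' \<gamma> where t: "tau_rel m n X p Y \<alpha> \<alpha>' \<gamma>" using tau_rel_exists[OF fib \<alpha>] .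
  note a = tau_relD[OF t]
  have \<gamma>X: "\<gamma> \<in> rel_maps K L X" using a(1) unfolding rel_maps_fiber by blast
  have "(c\<^sub>0 X, \<gamma>) \<in> homotopy_rel K L X"
    by (rule homotopy_relI[OF K_bis L_cl const_map_rel[OF K_bis L_cl X_kan(1)] \<gamma>X a(2)]) (simp_all add: a const_map_def)
  then show "b \<in> {b \<in> fst (pi_BC m n F). pi_map m n X (incl F) b = snd (pi_BC m n X)}"
    unfolding b tau_class[OF fib \<alpha> t] snd_pi_BC mem_Collect_eq pi_map_incl[OF a(1)] pi_BC_carrier
    using a(1) pi_class_eq_iff[OF X_kan const_map_rel[OF K_bis L_cl X_kan(1)] \<gamma>X] by auto
qed

text \<open>If \<tau> is trivial on \<alpha>, an admissible lift and a homotopy \<open>g\<close> in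
  the fiber from its corner to the constant map are combined in one filler; here the first square is
  the loop direction and the second the homotopy direction. Its restriction to the second
  \<open>origin\<close> is the lift corrected to be constant on \<open>hook_pt\<close>. It is
  therefore the transpose of a map into \<open>loop X\<close> whose image is \<alpha> itself, not
  merely a homotopic map.\<close>

lemma exact_at_loop:
  "exact_at (pi_BC m n (loop X)) (pi_map m n (loop Y) (loop_map X p)) (pi_BC m n (loop Y))
     (tau m n F X p) (pi_BC m n F)"
  unfolding exact_at_def
proof (intro equalityI subsetI)
  fix b assume "b \<in> {b \<in> fst (pi_BC m n (loop Y)). tau m n F X p b = snd (pi_BC m n F)}"
  then obtain \<alpha> where \<alpha>: "\<alpha> \<in> rel_maps K L (loop Y)" and b: "b = pi_class m n (loop Y) \<alpha>"
    and tb: "tau m n F X p (pi_class m n (loop Y) \<alpha>) = pi_class m n F (c\<^sub>0 F)"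
    unfolding pi_BC_carrier snd_pi_BC by blast
  obtain \<alpha>' \<gamma> where t: "tau_rel m n X p Y \<alpha> \<alpha>' \<gamma>" using tau_rel_exists[OF fib \<alpha>] .
  note a = tau_relD[OF t]
  have "(\<gamma>, c\<^sub>0 F) \<in> homotopy_rel K L F"
    using tb pi_class_eq_iff[OF F_kan a(1) const_map_rel[OF K_bis L_cl F_kan(1)]] unfolding tau_class[OF fib \<alpha> t] by simp
  then obtain g where g: "rel_hom K (cells L) F g"
    "\<And>k l x j. x \<in> cells K k l \<Longrightarrow> j \<in> hook k l \<Longrightarrow> g k l (x, j) = \<gamma> k l x"
    "\<And>k l x. x \<in> cells K k l \<Longrightarrow> g k l (x, origin k l) = c\<^sub>0 F k l x"
    by (rule homotopy_relD) (assumption | rule that)+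
  have gX: "rel_hom K (cells L) X g" and pg: "\<And>k l z. z \<in> cells (K \<otimes> square) k l \<Longrightarrow> p k l (g k l z) = base Y k l"
    using g(1) unfolding rel_hom_def hom_on_def fiber_simps by auto
  have A0: "rel_hom K (cells L) X (\<lambda>k l _. base X k l)"
    unfolding rel_hom_def using hom_on_base[OF X_kan(1)] by blast
  have evb: "ev \<alpha> k l (x, s) = base Y k l" if "x \<in> cells K k l" "s \<in> hook_pt k l" for k l x s
    by (rule ev_base[OF rel_mapsD(1)[OF \<alpha>] that])
  \<comment> \<open>The image in \<open>Y\<close> does not move in the second square; this fits the
    data over \<open>origin\<close>, because \<open>g\<close> stays in the fiber.\<close>
  have v: "bihom ((K \<otimes> square) \<otimes> square) Y (\<lambda>k l z. ev \<alpha> k l (fst z))"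
  proof (rule hom_on_comp[OF _ rel_homD(1)[OF rel_hom_ev[OF \<alpha>]]])
    show "bihom ((K \<otimes> square) \<otimes> square) (K \<otimes> square) (\<lambda>_ _. fst)"
      by (rule hom_onI) (auto simp: cells_bprod[of "K \<otimes> square"] act_bprod[of "K \<otimes> square"])
  qed (auto simp: cells_bprod[of "K \<otimes> square"])
  obtain H where H: "bihom ((K \<otimes> square) \<otimes> square) X H"
    and pH: "\<And>k l z. z \<in> cells ((K \<otimes> square) \<otimes> square) k l \<Longrightarrow> p k l (H k l z) = ev \<alpha> k l (fst z)"
    and HL: "\<And>k l x s t. x \<in> cells L k l \<Longrightarrow> s \<in> cells square k l \<Longrightarrow> t \<in> cells square k l \<Longrightarrow>
      H k l ((x, s), t) = base X k l"
    and Hs: "\<And>k l x s t. x \<in> cells K k l \<Longrightarrow> s \<in> hook k l \<Longrightarrow> t \<in> cells square k l \<Longrightarrow>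
      H k l ((x, s), t) = base X k l"
    and Ho: "\<And>k l x t. x \<in> cells K k l \<Longrightarrow> t \<in> cells square k l \<Longrightarrow> H k l ((x, origin k l), t) = g k l (x, t)"
    by (rule lift_square[OF fib K_bis L_cl a(2) A0 gX v])
      (simp_all add: a g pg p_base evb last_horn_a_boundary cells_bprod
        rel_homD(2)[OF rel_hom_ev[OF \<alpha>]])
  let ?f = "\<lambda>k l z. H k l (z, origin k l)"
  have f: "rel_hom K (cells L) X ?f" by (rule rel_hom_origin[OF H HL])
  have fb: "?f k l (u, v) = base X k l" if "u \<in> cells K k l" "v \<in> hook_pt k l" for k l u v
    using that unfolding a_boundary_cells by (auto simp: Hs Ho g const_map_def origin_cells fiber_simps)
  let ?\<beta> = "\<lambda>k l. restrict (cur K ?f k l) (cells K k l)"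
  have \<beta>: "?\<beta> \<in> rel_maps K L (loop X)" by (rule rel_maps_cur[OF K_bis L_cl f fb])
  have "bicomp K (loop_map X p) ?\<beta> = \<alpha>"
  proof (rule bimaps_eqI)
    show m\<beta>: "bicomp K (loop_map X p) ?\<beta> \<in> bimaps K (loop Y)"
      using bicomp_rel_maps[OF K_bis L_cl loop_p_hom loop_p_base \<beta>] unfolding rel_maps_iff by blast
    show m\<alpha>: "\<alpha> \<in> bimaps K (loop Y)" using \<alpha> unfolding rel_maps_iff by blast
    fix k l u assume u: "u \<in> cells K k l"
    show "bicomp K (loop_map X p) ?\<beta> k l u = \<alpha> k l u"
    proof (rule ev_eqI[OF closed_in_cells[OF K_bis] bimaps_hom_on[OF m\<beta>] bimaps_hom_on[OF m\<alpha>] u])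
      fix k l u v assume u: "u \<in> cells K k l" and v: "v \<in> cells square k l"
      have "ev (bicomp K (loop_map X p) ?\<beta>) k l (u, v) = ev (\<lambda>k l x. loop_map X p k l (?\<beta> k l x)) k l (u, v)"
        using u by (simp add: ev_def bicomp_def compose_def)
      also have "\<dots> = p k l (ev ?\<beta> k l (u, v))"
        by (rule ev_loop_map[OF rel_mapsD(1)[OF \<beta>] u v])
      also have "\<dots> = ev \<alpha> k l (u, v)"
        using u v by (simp add: ev_restrict ev_cur[OF K_bis] pH cells_bprod origin_cells)
      finally show "ev (bicomp K (loop_map X p) ?\<beta>) k l (u, v) = ev \<alpha> k l (u, v)" .
    qed
  qed
  then have "b = pi_map m n (loop Y) (loop_map X p) (pi_class m n (loop X) ?\<beta>)"
    unfolding b pi_map_class[OF loopX_kan loopY_kan loop_p_hom loop_p_base \<beta>] by simp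
  then show "b \<in> pi_map m n (loop Y) (loop_map X p) ` fst (pi_BC m n (loop X))"
    unfolding image_iff using \<beta> pi_BC_carrier by blast
next
  fix b assume "b \<in> pi_map m n (loop Y) (loop_map X p) ` fst (pi_BC m n (loop X))"
  then obtain \<beta> where \<beta>: "\<beta> \<in> rel_maps K L (loop X)"
    and b: "b = pi_map m n (loop Y) (loop_map X p) (pi_class m n (loop X) \<beta>)"
    by (auto simp: pi_BC_carrier)
  let ?\<alpha> = "bicomp K (loop_map X p) \<beta>"
  have \<alpha>: "?\<alpha> \<in> rel_maps K L (loop Y)" by (rule bicomp_rel_maps[OF K_bis L_cl loop_p_hom loop_p_base \<beta>])
  have ev\<alpha>: "ev ?\<alpha> k l (u, v) = p k l (ev \<beta> k l (u, v))" if u: "u \<in> cells K k l" and v: "v \<in> cells square k l" for k l u v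
    using ev_loop_map[OF rel_mapsD(1)[OF \<beta>] u v, of p] u by (simp add: ev_def bicomp_def compose_def)
  \<comment> \<open>The transpose of a map into \<open>loop X\<close> is itself an admissible lift
    of its image, and its corner is constant.\<close>
  have "tau_rel m n X p Y ?\<alpha> (\<lambda>k l. restrict (ev \<beta> k l) (cells (K \<otimes> square) k l)) (c\<^sub>0 F)"
    by (rule tau_relI[OF const_map_rel[OF K_bis L_cl F_kan(1)] rel_hom_ev[OF \<beta>]])
      (simp_all add: ev\<alpha> ev_base[OF rel_mapsD(1)[OF \<beta>]] last_horn_a_boundary const_map_def fiber_simps)
  then have "tau m n F X p (pi_class m n (loop Y) ?\<alpha>) = pi_class m n F (c\<^sub>0 F)"
    by (rule tau_class[OF fib \<alpha>])
  then show "b \<in> {b \<in> fst (pi_BC m n (loop Y)). tau m n F X p b = snd (pi_BC m n F)}"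
    unfolding b pi_map_class[OF loopX_kan loopY_kan loop_p_hom loop_p_base \<beta>] snd_pi_BC mem_Collect_eq pi_BC_carrier using \<alpha> by blast
qed

text \<open>Both parts are read off from exactness: images under \<open>tau\<close> are classes of
  \<open>F\<close> by \<open>exact_at_fiber\<close>, and the base class of \<open>loop Y\<close>
  comes from that of \<open>loop X\<close>, so \<open>exact_at_loop\<close> sends it to the base
  class.\<close>

lemma pointed_map_tau: "pointed_map (pi_BC m n (loop Y)) (tau m n F X p) (pi_BC m n F)"
  unfolding pointed_map_def
proof
  show "tau m n F X p ` fst (pi_BC m n (loop Y)) \<subseteq> fst (pi_BC m n F)"
    using exact_at_fiber unfolding exact_at_def by blast
  have "snd (pi_BC m n (loop Y)) = pi_map m n (loop Y) (loop_map X p) (snd (pi_BC m n (loop X)))"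
    using pointed_map_pi[OF loopX_kan loopY_kan loop_p_hom loop_p_base] unfolding pointed_map_def by simp
  then have "snd (pi_BC m n (loop Y)) \<in> pi_map m n (loop Y) (loop_map X p) ` fst (pi_BC m n (loop X))"
    using base_class[OF loopX_kan(1)] by blast
  then show "tau m n F X p (snd (pi_BC m n (loop Y))) = snd (pi_BC m n F)"
    using exact_at_loop unfolding exact_at_def by blast
qed

lemma exact_step:
  "snd (pi_BC m n F) \<in> fst (pi_BC m n F)" "snd (pi_BC m n X) \<in> fst (pi_BC m n X)"
  "snd (pi_BC m n Y) \<in> fst (pi_BC m n Y)"
  "pointed_map (pi_BC m n F) (pi_map m n X (incl F)) (pi_BC m n X)"
  "pointed_map (pi_BC m n X) (pi_map m n Y p) (pi_BC m n Y)"
  using base_class F_kan(1) X_kan(1) Y_kan(1) pointed_map_pi[OF F_kan X_kan hom_on_incl_fiber[OF fib] incl_base]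
    pointed_map_pi[OF X_kan Y_kan p_hom p_base] by blast+

end

subsection \<open>Iterated loop spaces\<close>

lemma prelabel_simps:
  "cells (prelabel e X) m n = e ` cells X m n"
  "pt (prelabel e X) = e (pt X)"
  "inj e \<Longrightarrow> act (prelabel e X) m n a b (e x) = e (act X m n a b x)"
  "inj e \<Longrightarrow> base (prelabel e X) m n = e (base X m n)"
  unfolding prelabel_def relabel_def bisset.defs pbisset.defs base_def by simp_all

text \<open>Serves level zero of the sequence, which is the given one copied along
  \<open>Atom\<close>. Two separate injections are allowed so that \<open>kan_prelabel\<close> can
  leave the point unchanged.\<close>

lemma lifts_prelabel:
  assumes l: "lifts D S T X p Y" and e: "inj e" and e': "inj e'"
    and p': "\<And>m n x. x \<in> cells X m n \<Longrightarrow> p' m n (e x) = e' (p m n x)"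
  shows "lifts D S T (prelabel e X) p' (prelabel e' Y)"
proof (rule liftsI)
  fix u v
  assume u: "hom_on D S (prelabel e X) u" and v: "hom_on D T (prelabel e' Y) v"
    and uv: "\<And>m n x. x \<in> S m n \<Longrightarrow> p' m n (u m n x) = v m n x"
  have un: "hom_on D R Z (\<lambda>m n x. inv f (h m n x))" if h: "hom_on D R (prelabel f Z) h" and f: "inj f"
    for R f h and Z :: "'z pbisset"
  proof (rule hom_onI)
    fix m n x assume "x \<in> R m n"
    then show "inv f (h m n x) \<in> cells Z m n"
      using hom_onD(1)[OF h, of x m n] f by (auto simp: prelabel_simps)
  next
    fix m n k l a b x assume ab: "a \<in> ops m k" "b \<in> ops n l" and x: "x \<in> R m n"
    then obtain z where "h m n x = f z" using hom_onD(1)[OF h x] by (auto simp: prelabel_simps)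
    then show "inv f (h k l (act D m n a b x)) = act Z m n a b (inv f (h m n x))"
      using hom_onD(2)[OF h ab x] f by (simp add: prelabel_simps)
  qed
  have uvx: "p m n (inv e (u m n x)) = inv e' (v m n x)" if x: "x \<in> S m n" for m n x
  proof -
    obtain z where "u m n x = e z" "z \<in> cells X m n" using hom_onD(1)[OF u x] by (auto simp: prelabel_simps)
    then show ?thesis using uv[OF x] p' e e' by (metis inv_f_f)
  qed
  obtain w where w: "hom_on D T X w" "\<And>m n x. x \<in> S m n \<Longrightarrow> w m n x = inv e (u m n x)"
    "\<And>m n x. x \<in> T m n \<Longrightarrow> p m n (w m n x) = inv e' (v m n x)"
    by (rule liftsD[OF l un[OF u e] un[OF v e'] uvx]) (assumption | rule that)+
  have "hom_on D T (prelabel e X) (\<lambda>m n x. e (w m n x))"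
    using w(1) e unfolding hom_on_def by (auto simp: prelabel_simps)
  moreover have "e (w m n x) = u m n x" if "x \<in> S m n" for m n x
    using w(2)[OF that] hom_onD(1)[OF u that] e by (auto simp: prelabel_simps)
  moreover have "p' m n (e (w m n x)) = v m n x" if "x \<in> T m n" for m n x
    using w(3)[OF that] p'[OF hom_onD(1)[OF w(1) that]] hom_onD(1)[OF v that] e'
    by (auto simp: prelabel_simps)
  ultimately show "\<exists>w. hom_on D T (prelabel e X) w \<and> (\<forall>m n. \<forall>x\<in>S m n. w m n x = u m n x) \<and>
      (\<forall>m n. \<forall>x\<in>T m n. p' m n (w m n x) = v m n x)" by blast
qed

lemma prism_fib_prelabel:
  assumes l: "prism_fib X p Y" and e: "inj e" and e': "inj e'"
    and p': "\<And>m n x. x \<in> cells X m n \<Longrightarrow> p' m n (e x) = e' (p m n x)"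
  shows "prism_fib (prelabel e X) p' (prelabel e' Y)"
  unfolding prism_fib_def
  by (intro allI lifts_prelabel[OF l[unfolded prism_fib_def, rule_format] e e' p'])

lemma pointed_prelabel:
  assumes X: "pointed_bisimplicial X" and e: "inj e"
  shows "pointed_bisimplicial (prelabel e X)"
  using X unfolding pointed_bisimplicial_def bisimplicial_def
  by (auto simp: prelabel_simps e)

lemma kan_prelabel:
  assumes "kan X" and e: "inj e"
  shows "kan (prelabel e X)"
proof -
  have "prism_fib (prelabel e X) (\<lambda>_ _ _. ()) (prelabel id (point ()))"
    using assms(1) unfolding kan_point[where c = "()"]
    by (rule prism_fib_prelabel[OF _ e inj_on_id]) simp
  then show ?thesis
    by (subst (asm) kan_iff_prism_fib[where c = "\<lambda>_ _. ()"]) (auto simp: prelabel_simps point_def)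
qed

lemma fibrant_imp_kan:
  assumes "fibrant X"
  shows "kan X"
proof -
  have "prism_fib X (to_point X) (\<Delta> 0 0)"
    using assms unfolding fibrant_def by (intro horn_fib_imp_prism_fib fibration_imp_horn_fib)
  then show ?thesis
    by (subst (asm) kan_iff_prism_fib[where c = origin])
      (simp_all add: to_point_def cells_point_simplex origin_def[symmetric] act_origin del: replicate_Suc)
qed

lemma inj_Atom: "inj Atom"
  by (rule injI) simp

lemma kan_fib_loops_0:
  assumes fib: "fibration X p Y" and X: "pointed_bisimplicial X" and Y: "pointed_bisimplicial Y"
    and pt: "p 0 0 (pt X) = pt Y" and fibr: "fibrant Y"
  shows "kan_fib (loops 0 X) (loops_map 0 X p) (loops 0 Y)"
proof -
  have p: "bihom X Y p" using fib bimaps_hom_on unfolding fibration_def by blast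
  have bX: "bisimplicial X" and ptX: "pt X \<in> cells X 0 0" using X unfolding pointed_bisimplicial_def by auto
  have "prism_fib X p Y" by (intro horn_fib_imp_prism_fib fibration_imp_horn_fib fib)
  then have "prism_fib (prelabel Atom X) (loops_map 0 X p) (prelabel Atom Y)"
    by (rule prism_fib_prelabel[OF _ inj_Atom inj_Atom]) simp
  moreover have "bihom (prelabel Atom X) (prelabel Atom Y) (loops_map 0 X p)"
    using hom_onD[OF p] bisimplicialD(1)[OF bX]
    by (auto intro!: hom_onI simp: prelabel_simps inj_Atom)
  ultimately show ?thesis
    unfolding kan_fib_def
    using pointed_prelabel[OF X inj_Atom] pointed_prelabel[OF Y inj_Atom] ptX pt
      kan_prelabel[OF fibrant_imp_kan[OF fibr] inj_Atom]
    by (simp add: prelabel_simps)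
qed

lemma fiber_loops_0:
  "fiber (loops 0 X) (loops_map 0 X p) (loops 0 Y) = loops 0 (fiber X p Y)"
proof -
  have "act (prelabel Atom X) = act (prelabel Atom (fiber X p Y))"
    unfolding prelabel_def relabel_def bisset.defs pbisset.defs by (simp add: fiber_def)
  moreover have "cells (fiber (loops 0 X) (loops_map 0 X p) (loops 0 Y)) m n = cells (loops 0 (fiber X p Y)) m n" for m n
    by (auto simp: fiber_simps prelabel_simps inj_Atom)
  ultimately show ?thesis
    by (intro pbisset.equality) (auto simp: fun_eq_iff fiber_simps prelabel_simps)
qed

lemma loops_map_incl: "loops_map k F (incl F) = incl (loops k F)"
proof (induction k)
  case 0
  show ?case by (auto simp: fun_eq_iff incl_def prelabel_simps restrict_def)
next
  case (Suc k)
  then show ?case by (simp add: loop_map_incl)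
qed

theorem theorem3p31:
  fixes F X :: "'a pbisset" and Y :: "'b pbisset"
    and i :: "('a, 'a) bimap" and p :: "('a, 'b) bimap" and m n :: nat
  assumes "fiber_sequence F i X p Y"
  shows "long_exact_sequence
    (\<lambda>k. pi_BC m n (loops k F)) (\<lambda>k. pi_map m n (loops k X) (loops_map k F i))
    (\<lambda>k. pi_BC m n (loops k X)) (\<lambda>k. pi_map m n (loops k Y) (loops_map k X p))
    (\<lambda>k. pi_BC m n (loops k Y)) (\<lambda>k. tau m n (loops k F) (loops k X) (loops_map k X p))"
proof -
  have F: "F = fiber X p Y" and i: "i = incl F"
    and *: "pointed_bisimplicial X" "pointed_bisimplicial Y" "fibration X p Y" "p 0 0 (pt X) = pt Y" "fibrant Y"
    using assms unfolding fiber_sequence_def by auto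
  have fib: "kan_fib (loops k X) (loops_map k X p) (loops k Y)" for k
  proof (induction k)
    case 0
    show ?case by (rule kan_fib_loops_0[OF *(3,1,2,4,5)])
  next
    case (Suc k)
    then show ?case by (simp add: kan_fib_loop)
  qed
  \<comment> \<open>Being an equality, this rewrites the results of the locale, which are stated for
    \<open>fiber\<close>, into statements about \<open>loops k F\<close>.\<close>
  have fibF: "fiber (loops k X) (loops_map k X p) (loops k Y) = loops k F" for k
  proof (induction k)
    case 0
    show ?case unfolding F by (rule fiber_loops_0)
  next
    case (Suc k)
    then show ?case by (simp add: fiber_loop)
  qed
  note rules = kan_fibration.exact_step kan_fibration.pointed_map_tau kan_fibration.exact_at_total
    kan_fibration.exact_at_fiber kan_fibration.exact_at_loop
  show ?thesis
    unfolding long_exact_sequence_def i loops_map_incl loops.simps(2) loops_map.simps(2)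
    by (intro allI conjI rules[OF kan_fibration.intro[OF fib], unfolded fibF])
qed

end
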